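(* Let $\mu$ be a partition of $n$ and $\lambda$ a composition of $n$, and suppose $A_1,\dots,A_r$ are row-standard $\mu$-tableaux of type $\lambda$ which are identical in row $1$. Write $\tilde\mu=(\mu_2,\mu_3,\dots)$, and let $\tilde A_1,\dots,\tilde A_r$ be the $\tilde\mu$-tableaux obtained by deleting the first row from each of $A_1,\dots,A_r$. If $c_1,\dots,c_r\in\mathbb F$ are such that $\sum_{i=1}^rc_i\hat\phi_{\tilde A_i}=0$, then $\sum_{i=1}^rc_i\hat\phi_{A_i}=0$.
   Context: $\mathbb F$ is an arbitrary field and $q\in\mathbb F$ is a fixed non-zero element. $\mathfrak S_n$ is the symmetric group on $\{1,\dots,n\}$, acting on the right (in a product $uv$, $u$ is applied first), with Coxeter length function $l$ and simple transpositions $s_i=(i\ i{+}1)$. $\mathcal H_n$ is the unital associative $\mathbb F$-algebra with generators $T_1,\dots,T_{n-1}$ and relations $(T_i-q)(T_i+1)=0$, $T_iT_j=T_jT_i$ for $i\le j-2$, and $T_iT_{i+1}T_i=T_{i+1}T_iT_{i+1}$ (so $\mathcal H_0=\mathcal H_1=\mathbb F$). For $w\in\mathfrak S_n$ with reduced expression $w=s_{i_1}\cdots s_{i_k}$, put $T_w=T_{i_1}\cdots T_{i_k}$. Modules are right modules and maps are written on the right. A composition of $n$ is a sequence of non-negative integers (zeros allowed, trailing zeros ignored) with sum $n$; a partition is a weakly decreasing composition; $\mu'$ is the conjugate of a partition $\mu$. For a composition $\lambda$ of $n$, $W_\lambda\le\mathfrak S_n$ is the standard Young subgroup, $x_\lambda=\sum_{w\in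 W_\lambda}T_w$, $y_\lambda=\sum_{w\in W_\lambda}(-q)^{-l(w)}T_w$ and $M^\lambda=x_\lambda\mathcal H_n$. $\mathfrak t^\lambda$ is the $\lambda$-tableau with $1,\dots,n$ in order along successive rows; for a partition $\mu$, $\mathfrak t_\mu$ is the $\mu$-tableau with $1,\dots,n$ in order down successive columns, $w_\mu$ is the permutation with $\mathfrak t^\mu w_\mu=\mathfrak t_\mu$ (permutations act on entries), and $S^\mu=x_\mu T_{w_\mu}y_{\mu'}\mathcal H_n\subseteq M^\mu$ is the Specht module. For compositions $\mu,\lambda$ of $n$, a $\mu$-tableau of type $\lambda$ is a filling of the Young diagram of $\mu$ with positive integers in which each $i$ occurs $\lambda_i$ times; it is row-standard if entries weakly increase along rows. For a row-standard $\mu$-tableau $A$ of type $\lambda$, $1_A\in\mathfrak S_n$ is the permutation such that $\mathfrak t^\lambda1_A$ is the $\lambda$-tableau with entries $1,\dots,n$, increasing along rows, in which $i$ lies in row $r$ if the position occupied by $i$ in $\mathfrak t^\mu$ is occupied by $r$ in $A$. The homomorphism $\phi_A:M^\mu\to M^\lambda$ of $\mathcal H_n$-modules is given by $x_\mu\phi_A=\sum_{w\in W_\lambda1_AW_\mu}T_w$. If $\mu$ is a partition, $\hat\phi_A$ is the restriction of $\phi_A$ to $S^\mu$. The homomorphisms $\hat\phi_{\tilde A_i}$ are defined in the same way over $\mathcal H_{n-\mu_1}$. *)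

theory Defs
  imports
    "HOL-Algebra.QuotRing"
    "HOL-Library.Poly_Mapping"
    "HOL-Library.FuncSet"
    "HOL-Combinatorics.Permutations"
begin

section \<open>The Hecke algebra by generators and relations\<close>

text \<open>
  Words are wrapped in a datatype so that concatenation can serve as the monoid operation
  required by the convolution product of \<^typ>\<open>'a \<Rightarrow>\<^sub>0 'b\<close>. Hence \<open>word \<Rightarrow>\<^sub>0 'f\<close> is the free
  associative unital algebra over \<open>'f\<close> on generators indexed by all natural numbers.
\<close>

datatype word = Word (letters: "nat list")

instantiation word :: monoid_add
begin

definition zero_word :: word where
  "zero_word = Word []"

definition plus_word :: "word \<Rightarrow> word \<Rightarrow> word" where
  "plus_word u v = Word (letters u @ letters v)"

instance
  by standard (simp_all add: zero_word_def plus_word_def)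

end

type_synonym 'f free = "word \<Rightarrow>\<^sub>0 'f"

definition free_scalar :: "'f::field \<Rightarrow> 'f free" where
  "free_scalar c = Poly_Mapping.single 0 c"

definition free_gen :: "nat \<Rightarrow> 'f::field free" where
  "free_gen i = Poly_Mapping.single (Word [i]) 1"

text \<open>The free algebra on the generators with indices \<open>1, \<dots>, n - 1\<close>.\<close>

definition free_algebra :: "nat \<Rightarrow> 'f::field free ring" where
  "free_algebra n =
     \<lparr>carrier = {p. \<forall>w \<in> Poly_Mapping.keys p. set (letters w) \<subseteq> {1..<n}},
      monoid.mult = (*), one = 1, ring.zero = 0, add = (+)\<rparr>"

definition hecke_relators :: "nat \<Rightarrow> 'f::field \<Rightarrow> 'f free set" where
  "hecke_relators n q =
     {(free_gen i - free_scalar q) * (free_gen i + 1) | i. i \<in> {1..<n}} \<union>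
     {free_gen i * free_gen j - free_gen j * free_gen i | i j.
        i \<in> {1..<n} \<and> j \<in> {1..<n} \<and> i + 2 \<le> j} \<union>
     {free_gen i * free_gen (i + 1) * free_gen i
        - free_gen (i + 1) * free_gen i * free_gen (i + 1) | i.
        i \<in> {1..<n} \<and> i + 1 \<in> {1..<n}}"

definition hecke_ideal :: "nat \<Rightarrow> 'f::field \<Rightarrow> 'f free set" where
  "hecke_ideal n q = Idl\<^bsub>free_algebra n\<^esub> (hecke_relators n q)"

definition hecke :: "nat \<Rightarrow> 'f::field \<Rightarrow> 'f free set ring" where
  "hecke n q = free_algebra n Quot hecke_ideal n q"

definition hecke_gen :: "nat \<Rightarrow> 'f::field \<Rightarrow> nat \<Rightarrow> 'f free set" where
  "hecke_gen n q i = hecke_ideal n q +>\<^bsub>free_algebra n\<^esub> free_gen i"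

definition hecke_smult :: "nat \<Rightarrow> 'f::field \<Rightarrow> 'f \<Rightarrow> 'f free set \<Rightarrow> 'f free set" where
  "hecke_smult n q c h =
     (hecke_ideal n q +>\<^bsub>free_algebra n\<^esub> free_scalar c) \<otimes>\<^bsub>hecke n q\<^esub> h"


section \<open>The symmetric group and the elements \<open>T\<^sub>w\<close>\<close>

text \<open>
  The symmetric group on \<open>{1..n}\<close> is the set of all \<open>w\<close> with \<open>w permutes {1..n}\<close>.
  It acts on the right, so the product \<open>u v\<close> (first \<open>u\<close>, then \<open>v\<close>) is \<open>v \<circ> u\<close>.
\<close>

definition perm_prod :: "(nat \<Rightarrow> nat) \<Rightarrow> (nat \<Rightarrow> nat) \<Rightarrow> nat \<Rightarrow> nat" (infixl \<open>\<cdot>\<^sub>p\<close> 70) where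
  "u \<cdot>\<^sub>p v = v \<circ> u"

fun word_perm :: "nat list \<Rightarrow> nat \<Rightarrow> nat" where
  "word_perm [] = id"
| "word_perm (i # is) = Transposition.transpose i (i + 1) \<cdot>\<^sub>p word_perm is"

definition expression :: "nat \<Rightarrow> (nat \<Rightarrow> nat) \<Rightarrow> nat list \<Rightarrow> bool" where
  "expression n w is \<longleftrightarrow> set is \<subseteq> {1..<n} \<and> word_perm is = w"

definition coxeter_length :: "nat \<Rightarrow> (nat \<Rightarrow> nat) \<Rightarrow> nat" where
  "coxeter_length n w = (LEAST k. \<exists>is. expression n w is \<and> length is = k)"

definition reduced_expression :: "nat \<Rightarrow> (nat \<Rightarrow> nat) \<Rightarrow> nat list \<Rightarrow> bool" where
  "reduced_expression n w is \<longleftrightarrow> expression n w is \<and> length is = coxeter_length n w"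

text \<open>By Matsumoto's theorem, the choice of the reduced expression is immaterial.\<close>

definition hecke_T :: "nat \<Rightarrow> 'f::field \<Rightarrow> (nat \<Rightarrow> nat) \<Rightarrow> 'f free set" where
  "hecke_T n q w =
     foldr (\<lambda>i h. hecke_gen n q i \<otimes>\<^bsub>hecke n q\<^esub> h)
       (SOME is. reduced_expression n w is) \<one>\<^bsub>hecke n q\<^esub>"


section \<open>Compositions, partitions and tableaux\<close>

text \<open>
  A composition is a function \<open>a\<close> whose parts are \<open>a 1, a 2, \<dots>\<close>; the value \<open>a 0\<close> plays no role
  and is normalised to \<open>0\<close>. In this representation trailing zeros are ignored automatically.
\<close>

definition composition :: "nat \<Rightarrow> (nat \<Rightarrow> nat) \<Rightarrow> bool" where
  "composition n a \<longleftrightarrow> a 0 = 0 \<and> finite {i. a i \<noteq> 0} \<and> (\<Sum>i | a i \<noteq> 0. a i) = n"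

definition is_partition :: "nat \<Rightarrow> (nat \<Rightarrow> nat) \<Rightarrow> bool" where
  "is_partition n a \<longleftrightarrow> composition n a \<and> (\<forall>i \<ge> 1. a (i + 1) \<le> a i)"

definition conjugate :: "(nat \<Rightarrow> nat) \<Rightarrow> nat \<Rightarrow> nat" where
  "conjugate a j = (if j = 0 then 0 else card {i. 1 \<le> i \<and> j \<le> a i})"

definition drop_part :: "(nat \<Rightarrow> nat) \<Rightarrow> nat \<Rightarrow> nat" where
  "drop_part a i = (if i = 0 then 0 else a (i + 1))"

definition diagram :: "(nat \<Rightarrow> nat) \<Rightarrow> (nat \<times> nat) set" where
  "diagram a = {(r, c). 1 \<le> r \<and> 1 \<le> c \<and> c \<le> a r}"

text \<open>
  A tableau is a function of row and column; only its values on the diagram are relevant.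
\<close>

type_synonym tableau = "nat \<Rightarrow> nat \<Rightarrow> nat"

definition tableau_type :: "(nat \<Rightarrow> nat) \<Rightarrow> tableau \<Rightarrow> nat \<Rightarrow> nat" where
  "tableau_type a A i = card {(r, c). (r, c) \<in> diagram a \<and> A r c = i}"

definition tableau_of_type :: "(nat \<Rightarrow> nat) \<Rightarrow> (nat \<Rightarrow> nat) \<Rightarrow> tableau \<Rightarrow> bool" where
  "tableau_of_type a b A \<longleftrightarrow>
     (\<forall>(r, c) \<in> diagram a. 1 \<le> A r c) \<and> (\<forall>i \<ge> 1. tableau_type a A i = b i)"

definition row_standard :: "(nat \<Rightarrow> nat) \<Rightarrow> tableau \<Rightarrow> bool" where
  "row_standard a A \<longleftrightarrow>
     (\<forall>r c c'. (r, c) \<in> diagram a \<and> (r, c') \<in> diagram a \<and> c \<le> c' \<longrightarrow> A r c \<le> A r c')"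

definition drop_row :: "tableau \<Rightarrow> tableau" where
  "drop_row A r c = A (r + 1) c"

text \<open>\<open>row_tableau a\<close> is $\mathfrak t^a$ and \<open>col_tableau a\<close> is $\mathfrak t_a$.\<close>

definition row_tableau :: "(nat \<Rightarrow> nat) \<Rightarrow> tableau" where
  "row_tableau a r c = (\<Sum>j = 1..<r. a j) + c"

definition col_tableau :: "(nat \<Rightarrow> nat) \<Rightarrow> tableau" where
  "col_tableau a r c = (\<Sum>j = 1..<c. conjugate a j) + r"

definition young_subgroup :: "nat \<Rightarrow> (nat \<Rightarrow> nat) \<Rightarrow> (nat \<Rightarrow> nat) set" where
  "young_subgroup n a =
     {w. w permutes {1..n} \<and>
         (\<forall>r \<ge> 1. w ` (row_tableau a r ` {1..a r}) = row_tableau a r ` {1..a r})}"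

definition w_perm :: "nat \<Rightarrow> (nat \<Rightarrow> nat) \<Rightarrow> nat \<Rightarrow> nat" where
  "w_perm n a =
     (THE w. w permutes {1..n} \<and>
        (\<forall>(r, c) \<in> diagram a. w (row_tableau a r c) = col_tableau a r c))"

text \<open>
  \<open>one_perm n a b A\<close> is $1_A$ for a row-standard \<open>a\<close>-tableau \<open>A\<close> of type \<open>b\<close>: the
  \<open>b\<close>-tableau $\mathfrak t^b 1_A$ has entry \<open>p (row_tableau b r c)\<close> at \<open>(r, c)\<close>.
\<close>

definition one_perm ::
  "nat \<Rightarrow> (nat \<Rightarrow> nat) \<Rightarrow> (nat \<Rightarrow> nat) \<Rightarrow> tableau \<Rightarrow> nat \<Rightarrow> nat" where
  "one_perm n a b A =
     (THE p. p permutes {1..n} \<and>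
        (\<forall>r c c'. (r, c) \<in> diagram b \<and> (r, c') \<in> diagram b \<and> c < c' \<longrightarrow>
           p (row_tableau b r c) < p (row_tableau b r c')) \<and>
        (\<forall>(r, c) \<in> diagram a. \<exists>d. (A r c, d) \<in> diagram b \<and>
           p (row_tableau b (A r c) d) = row_tableau a r c))"


section \<open>Permutation modules, Specht modules and homomorphisms\<close>

definition x_elem :: "nat \<Rightarrow> 'f::field \<Rightarrow> (nat \<Rightarrow> nat) \<Rightarrow> 'f free set" where
  "x_elem n q a = (\<Oplus>\<^bsub>hecke n q\<^esub>w \<in> young_subgroup n a. hecke_T n q w)"

definition y_elem :: "nat \<Rightarrow> 'f::field \<Rightarrow> (nat \<Rightarrow> nat) \<Rightarrow> 'f free set" where
  "y_elem n q a =
     (\<Oplus>\<^bsub>hecke n q\<^esub>w \<in> young_subgroup n a.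
        hecke_smult n q ((- q) powi (- int (coxeter_length n w))) (hecke_T n q w))"

definition cyclic_module :: "nat \<Rightarrow> 'f::field \<Rightarrow> 'f free set \<Rightarrow> 'f free set set" where
  "cyclic_module n q z = {z \<otimes>\<^bsub>hecke n q\<^esub> h | h. h \<in> carrier (hecke n q)}"

definition perm_module :: "nat \<Rightarrow> 'f::field \<Rightarrow> (nat \<Rightarrow> nat) \<Rightarrow> 'f free set set" where
  "perm_module n q a = cyclic_module n q (x_elem n q a)"

definition specht_module :: "nat \<Rightarrow> 'f::field \<Rightarrow> (nat \<Rightarrow> nat) \<Rightarrow> 'f free set set" where
  "specht_module n q a =
     cyclic_module n q
       (x_elem n q a \<otimes>\<^bsub>hecke n q\<^esub> hecke_T n q (w_perm n a)
          \<otimes>\<^bsub>hecke n q\<^esub> y_elem n q (conjugate a))"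

text \<open>
  Homomorphisms between right ideals \<open>M\<close> and \<open>N\<close>, regarded as right modules. Linearity over the
  field is the case in which \<open>h\<close> is a scalar. Values outside \<open>M\<close> are fixed so that a
  homomorphism is determined by its values on \<open>M\<close>.
\<close>

definition right_hom ::
  "nat \<Rightarrow> 'f::field \<Rightarrow> 'f free set set \<Rightarrow> 'f free set set \<Rightarrow> ('f free set \<Rightarrow> 'f free set) set" where
  "right_hom n q M N =
     {f \<in> M \<rightarrow>\<^sub>E N.
        (\<forall>x \<in> M. \<forall>y \<in> M. f (x \<oplus>\<^bsub>hecke n q\<^esub> y) = f x \<oplus>\<^bsub>hecke n q\<^esub> f y) \<and>
        (\<forall>x \<in> M. \<forall>h \<in> carrier (hecke n q). f (x \<otimes>\<^bsub>hecke n q\<^esub> h) = f x \<otimes>\<^bsub>hecke n q\<^esub> h)}"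

definition double_coset ::
  "nat \<Rightarrow> (nat \<Rightarrow> nat) \<Rightarrow> (nat \<Rightarrow> nat) \<Rightarrow> (nat \<Rightarrow> nat) \<Rightarrow> (nat \<Rightarrow> nat) set" where
  "double_coset n b p a = {u \<cdot>\<^sub>p p \<cdot>\<^sub>p v | u v. u \<in> young_subgroup n b \<and> v \<in> young_subgroup n a}"

definition phi ::
  "nat \<Rightarrow> 'f::field \<Rightarrow> (nat \<Rightarrow> nat) \<Rightarrow> (nat \<Rightarrow> nat) \<Rightarrow> tableau \<Rightarrow> 'f free set \<Rightarrow> 'f free set" where
  "phi n q a b A =
     (THE f. f \<in> right_hom n q (perm_module n q a) (perm_module n q b) \<and>
        f (x_elem n q a) =
          (\<Oplus>\<^bsub>hecke n q\<^esub>w \<in> double_coset n b (one_perm n a b A) a. hecke_T n q w))"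

definition phi_hat ::
  "nat \<Rightarrow> 'f::field \<Rightarrow> (nat \<Rightarrow> nat) \<Rightarrow> (nat \<Rightarrow> nat) \<Rightarrow> tableau \<Rightarrow> 'f free set \<Rightarrow> 'f free set" where
  "phi_hat n q a b A = restrict (phi n q a b A) (specht_module n q a)"

end

(*
  Let m be the length of the first row of mu, and let sh: H_(n-m) -> H_n be the algebra map with
  T_i |-> T_(i+m). Everything rests on T_u T_v = T_(uv) whenever v does not undo an inversion of u
  (Matsumoto's theorem), which turns decompositions of sets of permutations into minimal coset
  representatives and elements of Young subgroups into factorisations of the corresponding sums.

  The double coset W_lambda 1_A W_mu consists of the w for which the number of x in row i of
  t^lambda with w(x) in row j of t^mu equals the number of i's in row j of A. Factoring w over the
  subgroup fixing 1, ..., m shows that the sum of T_w over this double coset is G sh(E), where E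
  is the sum over the double coset of the truncated tableau, and G depends only on lambda and the
  first row of A. On the other side, T_(w_mu) y_(mu') lies in sh(T_(w_mu~) y_(mu~')) H_n, because
  w_mu = sh(w_mu~) z with lengths adding, and z W_(mu') is stable under left multiplication by
  sh(W_(mu~')). Hence the relation for mu~ is transported by sh to the one for mu; no basis theorem
  for H_n is needed.
*)
theory Submission
  imports Defs
begin

text \<open>The maps \<open>phi\<close> must first be shown to exist. The double coset sum is
  written in two ways: as H x_mu, so that the map is left multiplication by H and no choice has to
  be checked, and as x_lambda K, so that its values lie in M^lambda. The hypothesis, evaluated at
  the generator of the smaller Specht module, then becomes an equation in H_(n-m): the
  c_i-combination of the truncated double coset sums, multiplied on the right by T_(w_mu~) y_(mu~'),
  vanishes. All sums involved have the form sum of a^l(w) T_w, with a = 1 for x and for double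
  cosets and a = -1/q for y. The weight is multiplicative whenever lengths add, so one factorisation
  lemma serves every case. Likewise the row and column groups, the group moving only points beyond m
  and the shifted column group are all stabilisers of a monotone function on {1..n}, and one theory
  of minimal coset representatives covers them. Lengths are treated as inversion numbers, which
  makes additivity of lengths a condition on pairs of points.\<close>

section \<open>Inversions, Coxeter length and reduced words\<close>

definition inversions :: "nat \<Rightarrow> (nat \<Rightarrow> nat) \<Rightarrow> (nat \<times> nat) set" where
  "inversions n w = {(i, j). 1 \<le> i \<and> i < j \<and> j \<le> n \<and> w j < w i}"

lemma finite_inversions [simp]: "finite (inversions n w)"
  by (rule finite_subset[of _ "{1..n} \<times> {1..n}"]) (auto simp: inversions_def)

lemma permutes_le:
  assumes "w permutes {1..n::nat}" "1 \<le> i" "i \<le> n"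
  shows "1 \<le> w i" "w i \<le> n"
  using permutes_in_image[OF assms(1), of i] assms by auto

lemma transpose_permutes_range:
  assumes "i \<in> {1..<n::nat}"
  shows "Transposition.transpose i (i + 1) permutes {1..n}"
  by (rule permutes_swap_id) (use assms in auto)

lemma perm_prod_permutes:
  assumes "u permutes S" "v permutes S"
  shows "(u \<cdot>\<^sub>p v) permutes S"
  unfolding perm_prod_def by (rule permutes_compose[OF assms])

lemma perm_prod_assoc: "u \<cdot>\<^sub>p v \<cdot>\<^sub>p w = u \<cdot>\<^sub>p (v \<cdot>\<^sub>p w)"
  by (simp add: perm_prod_def comp_assoc)

lemma perm_prod_apply: "(u \<cdot>\<^sub>p v) x = v (u x)"
  by (simp add: perm_prod_def)

lemma transpose_cancel [simp]:
  "Transposition.transpose i j \<cdot>\<^sub>p (Transposition.transpose i j \<cdot>\<^sub>p w) = w"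
  by (simp add: perm_prod_def comp_assoc)

lemma word_perm_append: "word_perm (is @ js) = word_perm is \<cdot>\<^sub>p word_perm js"
  by (induction "is") (auto simp: perm_prod_def comp_assoc)

lemma word_perm_permutes: "set is \<subseteq> {1..<n} \<Longrightarrow> word_perm is permutes {1..n}"
proof (induction "is")
  case (Cons i "is")
  then show ?case
    using perm_prod_permutes[OF transpose_permutes_range, of i n]
    by simp
qed (simp add: permutes_id)

text \<open>Renaming positions by s_i matches old and new inversions: since i and i + 1 are
  adjacent, no other pair of positions changes its order, and only the pair (i, i + 1) is
  gained.\<close>

lemma card_inversions_ascent:
  assumes "w permutes {1..n}" "i \<in> {1..<n}" "w i < w (i + 1)"
  shows "card (inversions n (Transposition.transpose i (i + 1) \<cdot>\<^sub>p w)) = Suc (card (inversions n w))"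
proof -
  let ?s = "Transposition.transpose i (i + 1)"
  have eq: "inversions n (?s \<cdot>\<^sub>p w) = insert (i, i + 1) (map_prod ?s ?s ` inversions n w)" (is "?L = ?R")
  proof (intro Set.set_eqI iffI)
    fix p assume p: "p \<in> ?L"
    obtain x y where xy: "p = (x, y)" by (cases p)
    have h: "1 \<le> x" "x < y" "y \<le> n" "w (?s y) < w (?s x)"
      using p by (auto simp: inversions_def perm_prod_apply xy)
    show "p \<in> ?R"
    proof (cases "x = i \<and> y = i + 1")
      case False
      then have "?s x < ?s y" "1 \<le> ?s x" "?s y \<le> n"
        using h assms by (auto simp: Transposition.transpose_def)
      then have "(?s x, ?s y) \<in> inversions n w"
        using h by (auto simp: inversions_def perm_prod_apply)
      then show ?thesis
        unfolding xy by (intro insertI2 rev_image_eqI[of "(?s x, ?s y)"]) auto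
    qed (simp add: xy)
  next
    fix p assume p: "p \<in> ?R"
    then consider "p = (i, i + 1)" | x y where "(x, y) \<in> inversions n w" "p = (?s x, ?s y)"
      by auto
    then show "p \<in> ?L"
    proof cases
      case 1
      then show ?thesis using assms by (auto simp: inversions_def perm_prod_apply)
    next
      case (2 x y)
      then have h: "1 \<le> x" "x < y" "y \<le> n" "w y < w x"
        by (auto simp: inversions_def perm_prod_apply)
      then have "\<not> (x = i \<and> y = i + 1)" using assms(3) by auto
      then have "?s x < ?s y" "1 \<le> ?s x" "?s y \<le> n"
        using h assms by (auto simp: Transposition.transpose_def)
      then show ?thesis using 2 h by (auto simp: inversions_def perm_prod_apply)
    qed
  qed
  have "(i, i + 1) \<notin> map_prod ?s ?s ` inversions n w"
  proof
    assume "(i, i + 1) \<in> map_prod ?s ?s ` inversions n w"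
    then obtain x y where "(x, y) \<in> inversions n w" "?s x = i" "?s y = i + 1" by auto
    moreover from this have "x = i + 1" "y = i"
      by (metis transpose_involutory transpose_apply_first transpose_apply_second)+
    ultimately show False by (auto simp: inversions_def perm_prod_apply)
  qed
  moreover have "inj_on (map_prod ?s ?s) (inversions n w)"
    by (rule inj_on_subset[OF map_prod_inj_on[OF inj_transpose inj_transpose]]) simp
  ultimately show ?thesis
    unfolding eq by (simp add: card_image)
qed

lemma card_inversions_descent:
  assumes "w permutes {1..n}" "i \<in> {1..<n}" "w (i + 1) < w i"
  shows "card (inversions n w) = Suc (card (inversions n (Transposition.transpose i (i + 1) \<cdot>\<^sub>p w)))"
  using card_inversions_ascent[of "Transposition.transpose i (i + 1) \<cdot>\<^sub>p w" n i]
    perm_prod_permutes[OF transpose_permutes_range[OF assms(2)] assms(1)] assms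
  by (simp add: perm_prod_apply)

lemma ascent_or_descent:
  fixes w :: "nat \<Rightarrow> nat"
  assumes "w permutes S"
  shows "w i < w (i + 1) \<or> w (i + 1) < w i"
proof -
  have "w i \<noteq> w (i + 1)" by (simp add: inj_eq[OF permutes_inj[OF assms]])
  then show ?thesis by linarith
qed

lemma strict_mono_permutes_eq_id:
  assumes "w permutes {1..n::nat}" "\<And>i. i \<in> {1..<n} \<Longrightarrow> w i < w (i + 1)"
  shows "w = id"
proof -
  have mono: "strict_mono_on {1..n} w"
  proof (rule strict_mono_onI)
    fix r s assume "r \<in> {1..n}" "s \<in> {1..n}" "r < s"
    then show "w r < w s"
    proof (induction s)
      case (Suc s)
      then show ?case
        using assms(2)[of s] by (cases "r = s") fastforce+
    qed auto
  qed
  have *: "map w [1..<Suc n] = [1..<Suc n]"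
  proof (rule sorted_distinct_set_unique)
    show "sorted (map w [1..<Suc n])"
      using mono by (auto simp: sorted_map sorted_wrt_iff_nth_less strict_mono_on_def less_imp_le
          simp del: upt_Suc)
    show "distinct (map w [1..<Suc n])"
      using permutes_inj_on[OF assms(1)] by (auto simp: distinct_map simp del: upt_Suc)
    show "set (map w [1..<Suc n]) = set [1..<Suc n]"
      using permutes_image[OF assms(1)] by (auto simp: atLeastLessThanSuc_atLeastAtMost simp del: upt_Suc)
  qed (simp_all del: upt_Suc)
  have "\<forall>x \<in> {1..n}. w x = x"
    using * map_eq_conv[of w "[1..<Suc n]" "\<lambda>x. x"]
    by (simp add: atLeastLessThanSuc_atLeastAtMost del: upt_Suc)
  then show ?thesis
    using assms(1) by (auto simp: permutes_def fun_eq_iff)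
qed

text \<open>Only the identity has no descent, and stripping off a descent lowers the inversion
  number by exactly one.\<close>

lemma exists_reduced_word:
  "w permutes {1..n} \<Longrightarrow> \<exists>is. expression n w is \<and> length is = card (inversions n w)"
proof (induction "card (inversions n w)" arbitrary: w rule: less_induct)
  case less
  show ?case
  proof (cases "\<forall>i \<in> {1..<n}. w i < w (i + 1)")
    case True
    then have [simp]: "w = id" using strict_mono_permutes_eq_id[OF less.prems] by blast
    have "inversions n id = {}" by (auto simp: inversions_def)
    then show ?thesis by (intro exI[of _ "[]"]) (auto simp: expression_def)
  next
    case False
    then obtain i where i: "i \<in> {1..<n}" "w (i + 1) < w i"
      using ascent_or_descent[OF less.prems] by blast
    let ?v = "Transposition.transpose i (i + 1) \<cdot>\<^sub>p w"
    have v: "?v permutes {1..n}"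
      by (rule perm_prod_permutes[OF transpose_permutes_range[OF i(1)] less.prems])
    note c = card_inversions_descent[OF less.prems i]
    obtain "is" where "is": "expression n ?v is" "length is = card (inversions n ?v)"
      using less.hyps[OF _ v] c by auto
    then have "word_perm is = ?v" "set is \<subseteq> {1..<n}"
      by (simp_all only: expression_def)
    then have "expression n w (i # is)"
      using i(1) unfolding expression_def word_perm.simps by (simp only: transpose_cancel) simp
    moreover have "length (i # is) = card (inversions n w)"
      using c "is"(2) by simp
    ultimately show ?thesis by blast
  qed
qed

text \<open>Each letter raises or lowers the inversion number by one, so this number bounds the
  length of every word from below.\<close>

lemma card_inversions_le_length:
  "set is \<subseteq> {1..<n} \<Longrightarrow> card (inversions n (word_perm is)) \<le> length is"
proof (induction "is")
  case Nil
  have "inversions n (word_perm []) = {}" by (auto simp: inversions_def)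
  then show ?case by (simp only: card.empty)
next
  case (Cons i "is")
  then have *: "word_perm is permutes {1..n}" "i \<in> {1..<n}"
    using word_perm_permutes by auto
  have "card (inversions n (word_perm is)) \<le> length is"
    using Cons by simp
  then have "card (inversions n (Transposition.transpose i (i + 1) \<cdot>\<^sub>p word_perm is)) \<le> Suc (length is)"
    using ascent_or_descent[OF *(1), of i] card_inversions_ascent[OF *]
      card_inversions_descent[OF *] by linarith
  then show ?case unfolding word_perm.simps length_Cons .
qed

lemma coxeter_length_eq:
  assumes "w permutes {1..n}"
  shows "coxeter_length n w = card (inversions n w)"
  unfolding coxeter_length_def
proof (rule Least_equality)
  show "\<exists>is. expression n w is \<and> length is = card (inversions n w)"
    by (rule exists_reduced_word[OF assms])
  show "card (inversions n w) \<le> k" if "\<exists>is. expression n w is \<and> length is = k" for k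
    using that card_inversions_le_length[of _ n] unfolding expression_def by fast
qed

lemma reduced_expression_iff:
  "reduced_expression n w is \<longleftrightarrow> expression n w is \<and> length is = card (inversions n w)"
proof (cases "expression n w is")
  case True
  then have "w permutes {1..n}"
    using word_perm_permutes[of "is" n] by (simp add: expression_def)
  then show ?thesis
    unfolding reduced_expression_def by (simp only: coxeter_length_eq)
qed (simp add: reduced_expression_def)

text \<open>If the first letter were an ascent, the tail would be too short for its permutation,
  whose inversion number has gone up. At a descent both numbers drop by one. All inductions on
  reduced words go through this criterion.\<close>

lemma reduced_expression_Cons_iff:
  assumes "w permutes {1..n}"
  shows "reduced_expression n w (i # is) \<longleftrightarrow>
    i \<in> {1..<n} \<and> w (i + 1) < w i \<and>
    reduced_expression n (Transposition.transpose i (i + 1) \<cdot>\<^sub>p w) is"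
proof -
  let ?s = "Transposition.transpose i (i + 1)"
  have e: "expression n w (i # is) \<longleftrightarrow> i \<in> {1..<n} \<and> expression n (?s \<cdot>\<^sub>p w) is"
  proof
    assume "expression n w (i # is)"
    then show "i \<in> {1..<n} \<and> expression n (?s \<cdot>\<^sub>p w) is"
      by (auto simp: expression_def)
  next
    assume a: "i \<in> {1..<n} \<and> expression n (?s \<cdot>\<^sub>p w) is"
    then have "?s \<cdot>\<^sub>p word_perm is = ?s \<cdot>\<^sub>p (?s \<cdot>\<^sub>p w)"
      by (simp only: expression_def)
    then show "expression n w (i # is)"
      using a by (simp add: expression_def)
  qed
  show ?thesis
  proof (cases "i \<in> {1..<n} \<and> expression n (?s \<cdot>\<^sub>p w) is")
    case True
    then have le: "card (inversions n (?s \<cdot>\<^sub>p w)) \<le> length is"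
      using card_inversions_le_length[of "is" n] unfolding expression_def by metis
    have "reduced_expression n w (i # is) \<longleftrightarrow> card (inversions n w) = Suc (length is)"
      using e True by (auto simp: reduced_expression_iff)
    moreover have "reduced_expression n (?s \<cdot>\<^sub>p w) is \<longleftrightarrow> card (inversions n (?s \<cdot>\<^sub>p w)) = length is"
      using True by (auto simp: reduced_expression_iff)
    ultimately show ?thesis
      using True le ascent_or_descent[OF assms, of i] card_inversions_ascent[OF assms, of i]
        card_inversions_descent[OF assms, of i] by linarith
  qed (use e in \<open>auto simp: reduced_expression_iff\<close>)
qed

lemma exists_reduced_expression:
  "w permutes {1..n} \<Longrightarrow> \<exists>is. reduced_expression n w is"
  using exists_reduced_word reduced_expression_iff by blast

text \<open>The condition says that no inversion of \<open>u\<close> is undone by \<open>v\<close>.\<close>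

definition reduced_pair :: "nat \<Rightarrow> (nat \<Rightarrow> nat) \<Rightarrow> (nat \<Rightarrow> nat) \<Rightarrow> bool" where
  "reduced_pair n u v \<longleftrightarrow>
     (\<forall>x \<in> {1..n}. \<forall>y \<in> {1..n}. u x < u y \<and> v (u y) < v (u x) \<longrightarrow> x < y)"

text \<open>The inversions of the product are those of u together with the pullback along u of those
  of v. The hypothesis is used twice: it keeps inversions of u from being undone, and it puts the
  pulled back pairs in increasing order.\<close>

lemma card_inversions_prod:
  assumes u: "u permutes {1..n}" and v: "v permutes {1..n}" and red: "reduced_pair n u v"
  shows "card (inversions n (u \<cdot>\<^sub>p v)) = card (inversions n u) + card (inversions n v)"
proof -
  define P where "P = {(x, y). x \<in> {1..n} \<and> y \<in> {1..n} \<and> u x < u y \<and> v (u y) < v (u x)}"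
  have finP: "finite P"
    by (rule finite_subset[of _ "{1..n} \<times> {1..n}"]) (auto simp: P_def)
  have ne: "u x \<noteq> u y" "v (u x) \<noteq> v (u y)" if "x \<noteq> y" for x y
    using that by (simp_all add: inj_eq[OF permutes_inj[OF u]] inj_eq[OF permutes_inj[OF v]])
  have eq: "inversions n (u \<cdot>\<^sub>p v) = inversions n u \<union> P"
  proof (intro Set.set_eqI iffI; clarify)
    fix x y assume "(x, y) \<in> inversions n (u \<cdot>\<^sub>p v)" "(x, y) \<notin> P"
    then show "(x, y) \<in> inversions n u"
      using ne[of x y] by (auto simp: inversions_def perm_prod_apply P_def)
  next
    fix x y assume a: "(x, y) \<in> inversions n u \<union> P"
    show "(x, y) \<in> inversions n (u \<cdot>\<^sub>p v)"
    proof (cases "(x, y) \<in> P")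
      case True
      then show ?thesis
        using red[unfolded reduced_pair_def, rule_format, of x y] by (auto simp: inversions_def perm_prod_apply P_def)
    next
      case False
      then have h: "1 \<le> x" "x < y" "y \<le> n" "u y < u x" using a by (auto simp: inversions_def perm_prod_apply)
      \<comment> \<open>Otherwise v would undo the inversion (x, y) of u, and the hypothesis with x
        and y exchanged would give y < x.\<close>
      then have "\<not> v (u x) < v (u y)"
        using red[unfolded reduced_pair_def, rule_format, of y x] by auto
      then show ?thesis using h ne[of x y] by (auto simp: inversions_def perm_prod_apply)
    qed
  qed
  have "bij_betw (map_prod u u) P (inversions n v)"
  proof (rule bij_betw_imageI)
    show "inj_on (map_prod u u) P"
      by (rule inj_on_subset[OF map_prod_inj_on[OF permutes_inj[OF u] permutes_inj[OF u]]]) simp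
    show "map_prod u u ` P = inversions n v"
    proof (intro equalityI subsetI)
      fix p assume "p \<in> map_prod u u ` P"
      then obtain x y where "(x, y) \<in> P" "p = (u x, u y)" by auto
      then show "p \<in> inversions n v"
        using permutes_le[OF u, of x] permutes_le[OF u, of y]
        by (simp add: inversions_def P_def)
    next
      fix p assume "p \<in> inversions n v"
      then obtain a b where p: "p = (a, b)" and ab: "(a, b) \<in> inversions n v" by (cases p) auto
      obtain x where x: "a = u x" using permutes_surj[OF u] by (rule surjE)
      obtain y where y: "b = u y" using permutes_surj[OF u] by (rule surjE)
      have "x \<in> {1..n}" "y \<in> {1..n}"
        using ab permutes_in_image[OF u, of x] permutes_in_image[OF u, of y]
        by (auto simp: inversions_def perm_prod_apply x y)
      then have "(x, y) \<in> P" using ab by (auto simp: inversions_def perm_prod_apply P_def x y)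
      then show "p \<in> map_prod u u ` P"
        by (intro rev_image_eqI[of "(x, y)"]) (auto simp: p x y)
    qed
  qed
  then have "card P = card (inversions n v)" by (rule bij_betw_same_card)
  moreover have "inversions n u \<inter> P = {}" by (auto simp: inversions_def perm_prod_apply P_def)
  ultimately show ?thesis using finP by (simp add: eq card_Un_disjoint)
qed

lemma reduced_expression_append:
  assumes u: "u permutes {1..n}" and v: "v permutes {1..n}" and red: "reduced_pair n u v"
    and "reduced_expression n u is" "reduced_expression n v js"
  shows "reduced_expression n (u \<cdot>\<^sub>p v) (is @ js)"
  using assms(4,5) card_inversions_prod[OF u v red]
  by (simp add: reduced_expression_iff expression_def word_perm_append)

section \<open>Matsumoto's theorem\<close>

text \<open>Matsumoto's theorem concerns only the braid relations, so it is proved for any monoid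
  satisfying them. The multiplicative monoid of the Hecke algebra is the intended instance.\<close>

locale braid_monoid = monoid G for G (structure) +
  fixes n :: nat and g :: "nat \<Rightarrow> 'a"
  assumes g_closed [simp]: "i \<in> {1..<n} \<Longrightarrow> g i \<in> carrier G"
    and g_comm: "i \<in> {1..<n} \<Longrightarrow> j \<in> {1..<n} \<Longrightarrow> i + 2 \<le> j \<Longrightarrow> g i \<otimes> g j = g j \<otimes> g i"
    and g_braid: "i \<in> {1..<n} \<Longrightarrow> i + 1 \<in> {1..<n} \<Longrightarrow>
      g i \<otimes> g (i + 1) \<otimes> g i = g (i + 1) \<otimes> g i \<otimes> g (i + 1)"
begin

definition word_prod :: "nat list \<Rightarrow> 'a" where
  "word_prod is = foldr (\<lambda>i h. g i \<otimes> h) is \<one>"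

lemma word_prod_simps [simp]:
  "word_prod [] = \<one>" "word_prod (i # is) = g i \<otimes> word_prod is"
  by (auto simp: word_prod_def)

lemma word_prod_closed [simp]: "set is \<subseteq> {1..<n} \<Longrightarrow> word_prod is \<in> carrier G"
  by (induction "is") auto

lemma word_prod_append:
  "set is \<subseteq> {1..<n} \<Longrightarrow> set js \<subseteq> {1..<n} \<Longrightarrow>
    word_prod (is @ js) = word_prod is \<otimes> word_prod js"
  by (induction "is") (auto simp: m_assoc)

text \<open>If two reduced words start with different letters i and j, then w has descents at both
  and begins with the longest element of the subgroup generated by s_i and s_j. Let
  \<open>ks\<close> be a reduced word of what remains. By induction each tail may be replaced by one
  ending in \<open>ks\<close>, and a single braid relation identifies the two results.\<close>

lemma matsumoto:
  "w permutes {1..n} \<Longrightarrow> reduced_expression n w is \<Longrightarrow> reduced_expression n w js \<Longrightarrow>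
    word_prod is = word_prod js"
proof (induction "length is" arbitrary: w "is" js rule: less_induct)
  case less
  have len: "length is = length js"
    using less.prems by (auto simp: reduced_expression_def)
  show ?case
  proof (cases "is")
    case Nil
    then show ?thesis using len by auto
  next
    case (Cons i is')
    then obtain j js' where js: "js = j # js'" using len by (cases js) auto
    let ?s = "\<lambda>i. Transposition.transpose i (i + 1)"
    note w = less.prems(1)
    have i: "i \<in> {1..<n}" "w (i + 1) < w i" "reduced_expression n (?s i \<cdot>\<^sub>p w) is'"
      using less.prems(2) unfolding Cons reduced_expression_Cons_iff[OF w] by auto
    have j: "j \<in> {1..<n}" "w (j + 1) < w j" "reduced_expression n (?s j \<cdot>\<^sub>p w) js'"
      using less.prems(3) unfolding js reduced_expression_Cons_iff[OF w] by auto
    have siw: "(?s i \<cdot>\<^sub>p w) permutes {1..n}" and sjw: "(?s j \<cdot>\<^sub>p w) permutes {1..n}"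
      by (intro perm_prod_permutes transpose_permutes_range w i(1) j(1))+
    have IH: "word_prod is' = word_prod ks" if "reduced_expression n (?s i \<cdot>\<^sub>p w) ks" for ks
      using less.hyps[OF _ siw i(3) that] Cons by auto
    have IH': "word_prod js' = word_prod ks" if "reduced_expression n (?s j \<cdot>\<^sub>p w) ks" for ks
      using less.hyps[OF _ sjw j(3) that] len js by auto
    have far: "word_prod is = word_prod js" if ij: "i + 2 \<le> j \<or> j + 2 \<le> i"
    proof -
      let ?v = "?s j \<cdot>\<^sub>p (?s i \<cdot>\<^sub>p w)"
      have v: "?v permutes {1..n}" by (rule perm_prod_permutes[OF transpose_permutes_range[OF j(1)] siw])
      obtain ks where ks: "reduced_expression n ?v ks" using exists_reduced_expression[OF v] by blast
      have v': "?v = ?s i \<cdot>\<^sub>p (?s j \<cdot>\<^sub>p w)"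
        using ij by (auto simp: fun_eq_iff Transposition.transpose_def perm_prod_apply)
      have "word_prod is' = word_prod (j # ks)"
        using ks ij j siw by (intro IH) (auto simp: reduced_expression_Cons_iff transpose_apply_other perm_prod_apply)
      moreover have "word_prod js' = word_prod (i # ks)"
        using ks ij i sjw unfolding v'
        by (intro IH') (auto simp: reduced_expression_Cons_iff transpose_apply_other perm_prod_apply)
      moreover have "word_prod ks \<in> carrier G"
        using ks by (auto simp: reduced_expression_def expression_def)
      moreover have "g i \<otimes> g j = g j \<otimes> g i"
        using ij g_comm[of i j] g_comm[of j i] i(1) j(1) by auto
      ultimately show ?thesis
        using i(1) j(1) by (simp add: Cons js m_assoc[symmetric])
    qed
    \<comment> \<open>Stated for fresh letters and tails, so that the case i = j + 1 follows by
      exchanging the two words.\<close>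
    have near: "word_prod (i # is') = word_prod (j # js')"
      if ij: "j = i + 1" and i: "i \<in> {1..<n}" "w (i + 1) < w i"
        and j: "j \<in> {1..<n}" "w (j + 1) < w j"
        and IH: "\<And>ks. reduced_expression n (?s i \<cdot>\<^sub>p w) ks \<Longrightarrow> word_prod is' = word_prod ks"
        and IH': "\<And>ks. reduced_expression n (?s j \<cdot>\<^sub>p w) ks \<Longrightarrow> word_prod js' = word_prod ks"
      for i j is' js'
    proof -
      let ?v1 = "?s i \<cdot>\<^sub>p w" and ?u1 = "?s j \<cdot>\<^sub>p w"
      let ?v2 = "?s j \<cdot>\<^sub>p ?v1" and ?u2 = "?s i \<cdot>\<^sub>p ?u1"
      let ?v = "?s i \<cdot>\<^sub>p ?v2"
      have perm: "?v1 permutes {1..n}" "?u1 permutes {1..n}" "?v2 permutes {1..n}"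
        "?u2 permutes {1..n}" "?v permutes {1..n}"
        by (intro perm_prod_permutes transpose_permutes_range w i(1) j(1))+
      obtain ks where ks: "reduced_expression n ?v ks"
        using exists_reduced_expression[OF perm(5)] by blast
      have v': "?v = ?s j \<cdot>\<^sub>p ?u2"
        by (auto simp: fun_eq_iff Transposition.transpose_def perm_prod_apply ij)
      \<comment> \<open>Descents at i and i + 1 mean w(i) > w(i+1) > w(i+2), so three letters can be
        stripped in either order, each time at a descent.\<close>
      have "word_prod is' = word_prod (j # i # ks)"
        using ks ij i j perm
        by (intro IH) (auto simp: reduced_expression_Cons_iff Transposition.transpose_def perm_prod_apply)
      moreover have "word_prod js' = word_prod (i # j # ks)"
        using ks ij i j perm unfolding v'
        by (intro IH') (auto simp: reduced_expression_Cons_iff Transposition.transpose_def perm_prod_apply)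
      moreover have "word_prod ks \<in> carrier G"
        using ks by (auto simp: reduced_expression_def expression_def)
      ultimately show ?thesis
        using i(1) j(1) ij g_braid[of i] by (simp add: m_assoc[symmetric])
    qed
    consider "i = j" | "i + 2 \<le> j \<or> j + 2 \<le> i" | "j = i + 1" | "i = j + 1" by linarith
    then show ?thesis
    proof cases
      case 1
      then show ?thesis using IH[of js'] j(3) Cons js by simp
    next
      case 3
      then show ?thesis unfolding Cons js using near i j IH IH' by blast
    next
      case 4
      then show ?thesis unfolding Cons js using near[OF 4 j(1,2) i(1,2) IH' IH] by simp
    qed (rule far)
  qed
qed

end

section \<open>The Hecke algebra as a ring\<close>

text \<open>Reduces additive identities in the free algebra to monomials; this gives centrality of
  the scalars and multiplicativity of the shift.\<close>

lemma poly_mapping_single_induct [case_names zero single_plus]: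
  assumes "P 0" "\<And>k v p. P p \<Longrightarrow> P (Poly_Mapping.single k v + p)"
  shows "P p"
proof (induction p rule: update_induct)
  case (update f k v)
  have "Poly_Mapping.update k v f = Poly_Mapping.single k v + f"
    using update(1)
    by (intro poly_mapping_eqI) (auto simp: lookup_update lookup_add lookup_single in_keys_iff when_def)
  then show ?case using assms(2) update by simp
qed (fact assms(1))

lemma free_scalar_commute: "free_scalar c * p = p * free_scalar c"
proof (induction p rule: poly_mapping_single_induct)
  case (single_plus k v p)
  then show ?case
    by (simp add: free_scalar_def distrib_left distrib_right mult_single mult.commute)
qed simp

lemma free_algebra_simps:
  "p \<in> carrier (free_algebra n) \<longleftrightarrow> (\<forall>w \<in> Poly_Mapping.keys p. set (letters w) \<subseteq> {1..<n})"
  "p \<otimes>\<^bsub>free_algebra n\<^esub> r = p * r" "\<one>\<^bsub>free_algebra n\<^esub> = 1"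
  "\<zero>\<^bsub>free_algebra n\<^esub> = 0" "p \<oplus>\<^bsub>free_algebra n\<^esub> r = p + r"
  by (simp_all add: free_algebra_def)

lemma free_algebra_closed:
  "p \<in> carrier (free_algebra n) \<Longrightarrow> r \<in> carrier (free_algebra n) \<Longrightarrow> p + r \<in> carrier (free_algebra n)"
  "p \<in> carrier (free_algebra n) \<Longrightarrow> r \<in> carrier (free_algebra n) \<Longrightarrow> p * r \<in> carrier (free_algebra n)"
  "p \<in> carrier (free_algebra n) \<Longrightarrow> r \<in> carrier (free_algebra n) \<Longrightarrow> p - r \<in> carrier (free_algebra n)"
  "1 \<in> carrier (free_algebra n)" "0 \<in> carrier (free_algebra n)"
  "free_scalar c \<in> carrier (free_algebra n)"
  "i \<in> {1..<n} \<Longrightarrow> free_gen i \<in> carrier (free_algebra n)"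
proof -
  assume p: "p \<in> carrier (free_algebra n)" and r: "r \<in> carrier (free_algebra n)"
  show "p + r \<in> carrier (free_algebra n)"
    using p r keys_add[of p r] unfolding free_algebra_simps by blast
  have "Poly_Mapping.keys (p - r) \<subseteq> Poly_Mapping.keys p \<union> Poly_Mapping.keys r"
    by (auto simp: in_keys_iff lookup_minus)
  then show "p - r \<in> carrier (free_algebra n)"
    using p r unfolding free_algebra_simps by blast
  show "p * r \<in> carrier (free_algebra n)"
    unfolding free_algebra_simps
  proof
    fix w assume "w \<in> Poly_Mapping.keys (p * r)"
    then obtain a b where ab: "w = a + b" "a \<in> Poly_Mapping.keys p" "b \<in> Poly_Mapping.keys r"
      using keys_mult[of p r] by auto
    then have "set (letters a) \<subseteq> {1..<n}" "set (letters b) \<subseteq> {1..<n}"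
      using p r unfolding free_algebra_simps by blast+
    then show "set (letters w) \<subseteq> {1..<n}" by (simp add: ab(1) plus_word_def)
  qed
qed (auto simp: free_algebra_simps free_scalar_def free_gen_def zero_word_def
    simp flip: single_one split: if_splits)

lemma ring_free_algebra: "ring (free_algebra n :: 'f::field free ring)"
proof (rule ringI)
  show "abelian_group (free_algebra n)"
  proof (rule abelian_groupI, goal_cases)
    case (6 x)
    then show ?case
      using free_algebra_closed(3)[of 0 n x] free_algebra_closed(5)[of n]
      by (intro bexI[of _ "0 - x"]) (simp_all add: free_algebra_simps(2-))
  qed (simp_all add: free_algebra_simps(2-) free_algebra_closed add_ac)
  show "Group.monoid (free_algebra n)"
    by (rule monoidI) (simp_all add: free_algebra_simps(2-) free_algebra_closed mult.assoc)
qed (simp_all add: free_algebra_simps(2-) distrib_left distrib_right)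

interpretation free: ring "free_algebra n" for n by (rule ring_free_algebra)

lemma hecke_relatorsI:
  "i \<in> {1..<n} \<Longrightarrow> (free_gen i - free_scalar q) * (free_gen i + 1) \<in> hecke_relators n q"
  "i \<in> {1..<n} \<Longrightarrow> j \<in> {1..<n} \<Longrightarrow> i + 2 \<le> j \<Longrightarrow>
    free_gen i * free_gen j - free_gen j * free_gen i \<in> hecke_relators n q"
  "i \<in> {1..<n} \<Longrightarrow> i + 1 \<in> {1..<n} \<Longrightarrow>
    free_gen i * free_gen (i + 1) * free_gen i - free_gen (i + 1) * free_gen i * free_gen (i + 1)
      \<in> hecke_relators n q"
  unfolding hecke_relators_def by blast+

lemma hecke_relators_closed: "hecke_relators n q \<subseteq> carrier (free_algebra n)"
  unfolding hecke_relators_def by (auto intro!: free_algebra_closed)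

lemma hecke_ideal_ideal: "ideal (hecke_ideal n q) (free_algebra n)"
  unfolding hecke_ideal_def by (rule free.genideal_ideal[OF hecke_relators_closed])

interpretation hecke: ring "hecke n q" for n q
  unfolding hecke_def by (rule ideal.quotient_is_ring[OF hecke_ideal_ideal])

definition hecke_class :: "nat \<Rightarrow> 'f::field \<Rightarrow> 'f free \<Rightarrow> 'f free set" where
  "hecke_class n q p = hecke_ideal n q +>\<^bsub>free_algebra n\<^esub> p"

definition hecke_scalar :: "nat \<Rightarrow> 'f::field \<Rightarrow> 'f \<Rightarrow> 'f free set" where
  "hecke_scalar n q c = hecke_class n q (free_scalar c)"

lemma hecke_gen_class: "hecke_gen n q i = hecke_class n q (free_gen i)"
  by (simp add: hecke_gen_def hecke_class_def)

lemma hecke_smult_scalar: "hecke_smult n q c h = hecke_scalar n q c \<otimes>\<^bsub>hecke n q\<^esub> h"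
  by (simp add: hecke_smult_def hecke_class_def hecke_scalar_def)

lemma hecke_class_hom: "hecke_class n q \<in> ring_hom (free_algebra n) (hecke n q)"
  using ideal.rcos_ring_hom[OF hecke_ideal_ideal[of n q]] unfolding hecke_class_def hecke_def by simp

lemma hecke_class_simps:
  assumes "p \<in> carrier (free_algebra n)"
  shows "hecke_class n q p \<in> carrier (hecke n q)"
    and "r \<in> carrier (free_algebra n) \<Longrightarrow>
      hecke_class n q (p * r) = hecke_class n q p \<otimes>\<^bsub>hecke n q\<^esub> hecke_class n q r"
    and "r \<in> carrier (free_algebra n) \<Longrightarrow>
      hecke_class n q (p + r) = hecke_class n q p \<oplus>\<^bsub>hecke n q\<^esub> hecke_class n q r"
  using assms ring_hom_closed[OF hecke_class_hom] ring_hom_mult[OF hecke_class_hom, of p n r q]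
    ring_hom_add[OF hecke_class_hom, of p n r q]
  by (auto simp: free_algebra_simps)

lemma hecke_class_one: "hecke_class n q 1 = \<one>\<^bsub>hecke n q\<^esub>"
  using ring_hom_one[OF hecke_class_hom, of n q] by (simp add: free_algebra_simps)

lemma hecke_carrierE:
  assumes "X \<in> carrier (hecke n q)"
  obtains p where "p \<in> carrier (free_algebra n)" "X = hecke_class n q p"
  using assms by (auto simp: hecke_def FactRing_def A_RCOSETS_def' hecke_class_def)

lemma hecke_class_eq:
  assumes "p \<in> carrier (free_algebra n)" "r \<in> carrier (free_algebra n)" "p - r \<in> hecke_ideal n q"
  shows "hecke_class n q p = hecke_class n q r"
proof -
  have "p = (p - r) \<oplus>\<^bsub>free_algebra n\<^esub> r" by (simp add: free_algebra_simps)
  then have "p \<in> hecke_ideal n q +>\<^bsub>free_algebra n\<^esub> r"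
    using assms(3) unfolding a_r_coset_def' by blast
  then show ?thesis
    unfolding hecke_class_def
    using free.a_repr_independence[OF _ assms(2) ideal.axioms(1)[OF hecke_ideal_ideal, THEN additive_subgroup.a_subgroup]] by metis
qed

text \<open>The two kinds of braid relators are differences, so this turns each of them into an
  equation between classes.\<close>

lemma hecke_class_relator:
  assumes "p \<in> carrier (free_algebra n)" "r \<in> carrier (free_algebra n)" "p - r \<in> hecke_relators n q"
  shows "hecke_class n q p = hecke_class n q r"
  using hecke_class_eq[OF assms(1,2)] free.genideal_self[OF hecke_relators_closed] assms(3)
  unfolding hecke_ideal_def by blast

lemma hecke_gen_closed [simp]: "i \<in> {1..<n} \<Longrightarrow> hecke_gen n q i \<in> carrier (hecke n q)"
  by (simp add: hecke_gen_class hecke_class_simps free_algebra_closed del: atLeastLessThan_iff)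

interpretation hecke: braid_monoid "hecke n q" n "hecke_gen n q" for n q
proof (unfold_locales, goal_cases)
  case (1 i)
  then show ?case by (rule hecke_gen_closed)
next
  case (2 i j)
  have "hecke_class n q (free_gen i * free_gen j) = hecke_class n q (free_gen j * free_gen i)"
    by (intro hecke_class_relator free_algebra_closed hecke_relatorsI 2)
  then show ?case
    using 2 by (simp add: hecke_gen_class free_algebra_closed flip: hecke_class_simps(2))
next
  case (3 i)
  have "hecke_class n q (free_gen i * free_gen (i + 1) * free_gen i)
    = hecke_class n q (free_gen (i + 1) * free_gen i * free_gen (i + 1))"
    by (intro hecke_class_relator free_algebra_closed hecke_relatorsI 3)
  then show ?case
    using 3 by (simp add: hecke_gen_class free_algebra_closed flip: hecke_class_simps(2))
qed

lemma hecke_scalar_closed [simp]: "hecke_scalar n q c \<in> carrier (hecke n q)"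
  by (simp add: hecke_scalar_def hecke_class_simps free_algebra_closed)

lemma hecke_scalar_central:
  assumes "X \<in> carrier (hecke n q)"
  shows "hecke_scalar n q c \<otimes>\<^bsub>hecke n q\<^esub> X = X \<otimes>\<^bsub>hecke n q\<^esub> hecke_scalar n q c"
proof -
  obtain p where "p \<in> carrier (free_algebra n)" "X = hecke_class n q p"
    using assms by (rule hecke_carrierE)
  then show ?thesis
    using free_scalar_commute[of c p]
    by (simp add: hecke_scalar_def free_algebra_closed flip: hecke_class_simps(2))
qed

lemma hecke_scalar_mult: "hecke_scalar n q (c * d) = hecke_scalar n q c \<otimes>\<^bsub>hecke n q\<^esub> hecke_scalar n q d"
proof -
  have "free_scalar (c * d) = free_scalar c * free_scalar d"
    by (simp add: free_scalar_def mult_single)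
  then show ?thesis
    by (simp add: hecke_scalar_def hecke_class_simps free_algebra_closed)
qed

lemma hecke_scalar_one: "hecke_scalar n q 1 = \<one>\<^bsub>hecke n q\<^esub>"
  by (simp add: hecke_scalar_def free_scalar_def hecke_class_one)

lemma hecke_smult_closed [simp]:
  "h \<in> carrier (hecke n q) \<Longrightarrow> hecke_smult n q c h \<in> carrier (hecke n q)"
  by (simp add: hecke_smult_scalar)

lemma hecke_smult_one: "h \<in> carrier (hecke n q) \<Longrightarrow> hecke_smult n q 1 h = h"
  by (simp add: hecke_smult_scalar hecke_scalar_one)

lemma hecke_smult_mult:
  assumes "x \<in> carrier (hecke n q)" "y \<in> carrier (hecke n q)"
  shows "hecke_smult n q c x \<otimes>\<^bsub>hecke n q\<^esub> y = hecke_smult n q c (x \<otimes>\<^bsub>hecke n q\<^esub> y)"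
    and "x \<otimes>\<^bsub>hecke n q\<^esub> hecke_smult n q c y = hecke_smult n q c (x \<otimes>\<^bsub>hecke n q\<^esub> y)"
    and "hecke_smult n q c (hecke_smult n q d x) = hecke_smult n q (c * d) x"
proof -
  show "hecke_smult n q c x \<otimes>\<^bsub>hecke n q\<^esub> y = hecke_smult n q c (x \<otimes>\<^bsub>hecke n q\<^esub> y)"
    "hecke_smult n q c (hecke_smult n q d x) = hecke_smult n q (c * d) x"
    using assms by (simp_all add: hecke_smult_scalar hecke.m_assoc hecke_scalar_mult)
  have "x \<otimes>\<^bsub>hecke n q\<^esub> (hecke_scalar n q c \<otimes>\<^bsub>hecke n q\<^esub> y)
    = (hecke_scalar n q c \<otimes>\<^bsub>hecke n q\<^esub> x) \<otimes>\<^bsub>hecke n q\<^esub> y"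
    using assms by (simp add: hecke_scalar_central hecke.m_assoc)
  then show "x \<otimes>\<^bsub>hecke n q\<^esub> hecke_smult n q c y = hecke_smult n q c (x \<otimes>\<^bsub>hecke n q\<^esub> y)"
    using assms by (simp add: hecke_smult_scalar hecke.m_assoc)
qed

section \<open>Products of the elements T_w\<close>

text \<open>By Matsumoto's theorem the reduced word picked by \<open>SOME\<close> in
  \<open>hecke_T\<close> may be replaced by any other one.\<close>

lemma hecke_T_eq_word_prod:
  assumes w: "w permutes {1..n}" and "reduced_expression n w is"
  shows "hecke_T n q w = hecke.word_prod n q is"
proof -
  have "reduced_expression n w (SOME is. reduced_expression n w is)"
    using assms(2) by (rule someI)
  then have "hecke.word_prod n q (SOME is. reduced_expression n w is) = hecke.word_prod n q is"
    by (rule hecke.matsumoto[OF w _ assms(2)])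
  then show ?thesis by (simp add: hecke_T_def hecke.word_prod_def)
qed

lemma hecke_T_closed [simp]:
  assumes w: "w permutes {1..n}"
  shows "hecke_T n q w \<in> carrier (hecke n q)"
proof -
  obtain "is" where "is": "reduced_expression n w is" using exists_reduced_expression[OF w] by blast
  then have "set is \<subseteq> {1..<n}" by (simp add: reduced_expression_def expression_def)
  then show ?thesis unfolding hecke_T_eq_word_prod[OF w "is"] by (rule hecke.word_prod_closed)
qed

lemma hecke_T_prod:
  assumes u: "u permutes {1..n}" and v: "v permutes {1..n}" and red: "reduced_pair n u v"
  shows "hecke_T n q (u \<cdot>\<^sub>p v) = hecke_T n q u \<otimes>\<^bsub>hecke n q\<^esub> hecke_T n q v"
proof -
  obtain "is" js where r: "reduced_expression n u is" "reduced_expression n v js"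
    using exists_reduced_expression u v by meson
  then have "set is \<subseteq> {1..<n}" "set js \<subseteq> {1..<n}"
    by (simp_all add: reduced_expression_def expression_def)
  then show ?thesis
    unfolding hecke_T_eq_word_prod[OF u r(1)] hecke_T_eq_word_prod[OF v r(2)]
      hecke_T_eq_word_prod[OF perm_prod_permutes[OF u v] reduced_expression_append[OF u v red r]]
    by (rule hecke.word_prod_append)
qed

section \<open>Shifting the indices of the generators\<close>

text \<open>The substitution of the generator i + m for the generator i, extended linearly from
  words. As the sum runs over the support, additivity is proved after enlarging both index sets to a
  common one.\<close>

definition shift_free :: "nat \<Rightarrow> 'f::field free \<Rightarrow> 'f free" where
  "shift_free m p = (\<Sum>w \<in> Poly_Mapping.keys p.
     Poly_Mapping.single (Word (map (\<lambda>i. i + m) (letters w))) (Poly_Mapping.lookup p w))"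

lemma shift_free_superset:
  assumes "finite S" "Poly_Mapping.keys p \<subseteq> S"
  shows "shift_free m p = (\<Sum>w \<in> S.
     Poly_Mapping.single (Word (map (\<lambda>i. i + m) (letters w))) (Poly_Mapping.lookup p w))"
  unfolding shift_free_def using assms
  by (intro sum.mono_neutral_left) (auto simp: in_keys_iff)

lemma shift_free_single:
  "shift_free m (Poly_Mapping.single w c) = Poly_Mapping.single (Word (map (\<lambda>i. i + m) (letters w))) c"
  by (subst shift_free_superset[of "{w}"]) auto

lemma shift_free_add: "shift_free m (p + r) = shift_free m p + shift_free m r"
proof -
  let ?S = "Poly_Mapping.keys p \<union> Poly_Mapping.keys r"
  show ?thesis
    using keys_add[of p r]
    by (simp add: shift_free_superset[of ?S] lookup_add single_add sum.distrib)
qed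

lemma shift_free_zero: "shift_free m 0 = 0"
  by (simp add: shift_free_def)

lemma shift_free_one: "shift_free m 1 = 1"
proof -
  have "Word (map (\<lambda>i. i + m) (letters 0)) = 0" by (simp add: zero_word_def)
  then show ?thesis using shift_free_single[of m 0 1] by simp
qed

lemma shift_free_mult: "shift_free m (p * r) = shift_free m p * shift_free m r"
proof (induction p rule: poly_mapping_single_induct)
  case (single_plus k v p)
  have "shift_free m (Poly_Mapping.single k v * r)
    = Poly_Mapping.single (Word (map (\<lambda>i. i + m) (letters k))) v * shift_free m r"
  proof (induction r rule: poly_mapping_single_induct)
    case (single_plus l u r)
    then show ?case
      by (simp add: distrib_left shift_free_add mult_single shift_free_single plus_word_def)
  qed (simp add: shift_free_zero)
  then show ?case
    using single_plus by (simp add: distrib_right shift_free_add shift_free_single)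
qed (simp add: shift_free_zero)

lemma shift_free_diff: "shift_free m (p - r) = shift_free m p - shift_free m r"
  using shift_free_add[of m "p - r" r] by (simp add: algebra_simps)

lemma shift_free_gen: "shift_free m (free_gen i) = free_gen (i + m)"
  by (simp add: free_gen_def shift_free_single)

lemma shift_free_scalar: "shift_free m (free_scalar c) = free_scalar c"
  by (simp add: free_scalar_def shift_free_single zero_word_def)

lemma shift_free_closed:
  assumes "p \<in> carrier (free_algebra k)" "k + m \<le> n"
  shows "shift_free m p \<in> carrier (free_algebra n)"
  unfolding free_algebra_simps
proof
  fix w assume "w \<in> Poly_Mapping.keys (shift_free m p)"
  then obtain v where v: "v \<in> Poly_Mapping.keys p" "w = Word (map (\<lambda>i. i + m) (letters v))"
    unfolding shift_free_def using keys_sum by (fastforce split: if_splits)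
  then have "set (letters v) \<subseteq> {1..<k}"
    using assms(1) unfolding free_algebra_simps by blast
  then show "set (letters w) \<subseteq> {1..<n}"
    using assms(2) by (fastforce simp: v)
qed

text \<open>An element of the quotient is a coset, that is, a set. Its image under shifting and
  taking classes turns out to be a singleton, so no representative has to be chosen.\<close>

definition hecke_shift :: "nat \<Rightarrow> nat \<Rightarrow> 'f::field \<Rightarrow> 'f free set \<Rightarrow> 'f free set" where
  "hecke_shift n m q X = the_elem ((\<lambda>p. hecke_class n q (shift_free m p)) ` X)"

lemma shift_hom:
  assumes "k + m \<le> n"
  shows "ring_hom_ring (free_algebra k) (hecke n q) (\<lambda>p. hecke_class n q (shift_free m p))"
proof (intro ring_hom_ringI2 ring_free_algebra hecke.ring_axioms ring_hom_memI)
qed (use assms in \<open>simp_all add: free_algebra_simps(2-) free_algebra_closed shift_free_closed[of _ k]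
    shift_free_add shift_free_mult shift_free_one hecke_class_simps hecke_class_one\<close>)

lemma shift_relators:
  assumes "k + m \<le> n" "p \<in> hecke_relators k q"
  shows "shift_free m p \<in> hecke_relators n q"
proof -
  consider i where "i \<in> {1..<k}" "p = (free_gen i - free_scalar q) * (free_gen i + 1)"
    | i j where "i \<in> {1..<k}" "j \<in> {1..<k}" "i + 2 \<le> j" "p = free_gen i * free_gen j - free_gen j * free_gen i"
    | i where "i \<in> {1..<k}" "i + 1 \<in> {1..<k}" "p = free_gen i * free_gen (i + 1) * free_gen i
        - free_gen (i + 1) * free_gen i * free_gen (i + 1)"
    using assms(2) unfolding hecke_relators_def by blast
  then show ?thesis
  proof cases
    case (1 i)
    then have "shift_free m p = (free_gen (i + m) - free_scalar q) * (free_gen (i + m) + 1)"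
      by (simp add: shift_free_add shift_free_mult shift_free_one shift_free_diff shift_free_gen
          shift_free_scalar)
    moreover have "i + m \<in> {1..<n}" using 1 assms(1) by auto
    ultimately show ?thesis by (simp only: hecke_relatorsI)
  next
    case (2 i j)
    then have "shift_free m p = free_gen (i + m) * free_gen (j + m) - free_gen (j + m) * free_gen (i + m)"
      by (simp add: shift_free_mult shift_free_diff shift_free_gen)
    moreover have "i + m \<in> {1..<n}" "j + m \<in> {1..<n}" "i + m + 2 \<le> j + m" using 2 assms(1) by auto
    ultimately show ?thesis by (simp only: hecke_relatorsI)
  next
    case (3 i)
    then have "shift_free m p = free_gen (i + m) * free_gen (i + m + 1) * free_gen (i + m)
        - free_gen (i + m + 1) * free_gen (i + m) * free_gen (i + m + 1)"
      by (simp add: shift_free_mult shift_free_diff shift_free_gen)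
    moreover have "i + m \<in> {1..<n}" "i + m + 1 \<in> {1..<n}" using 3 assms(1) by auto
    ultimately show ?thesis by (simp only: hecke_relatorsI)
  qed
qed

text \<open>Shifting followed by passing to classes is a ring homomorphism. Its kernel is an ideal
  containing the relators, hence contains all of \<open>hecke_ideal\<close>, so the map is constant
  on every coset.\<close>

lemma hecke_shift_class:
  assumes "k + m \<le> n" "p \<in> carrier (free_algebra k)"
  shows "hecke_shift n m q (hecke_class k q p) = hecke_class n q (shift_free m p)"
proof -
  let ?h = "\<lambda>p. hecke_class n q (shift_free m p)"
  interpret h: ring_hom_ring "free_algebra k" "hecke n q" ?h by (rule shift_hom[OF assms(1)])
  have zero: "\<zero>\<^bsub>hecke n q\<^esub> = hecke_class n q 0"
    using h.hom_zero by (simp add: free_algebra_simps shift_free_zero)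
  have "hecke_ideal k q \<subseteq> a_kernel (free_algebra k) (hecke n q) ?h"
    unfolding hecke_ideal_def
  proof (rule free.genideal_minimal[OF h.kernel_is_ideal])
    show "hecke_relators k q \<subseteq> a_kernel (free_algebra k) (hecke n q) ?h"
    proof
      fix p assume p: "p \<in> hecke_relators k q"
      then have "shift_free m p \<in> hecke_relators n q" by (rule shift_relators[OF assms(1)])
      then have "hecke_class n q (shift_free m p) = hecke_class n q 0"
        using subsetD[OF hecke_relators_closed, of "shift_free m p" n q]
        by (intro hecke_class_relator free_algebra_closed) simp_all
      then show "p \<in> a_kernel (free_algebra k) (hecke n q) ?h"
        using subsetD[OF hecke_relators_closed p] unfolding a_kernel_def' zero by blast
    qed
  qed
  then have ker: "?h i = \<zero>\<^bsub>hecke n q\<^esub>" if "i \<in> hecke_ideal k q" for i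
    using that unfolding a_kernel_def' by blast
  have "?h ` hecke_class k q p = {?h p}"
  proof (intro equalityI subsetI)
    fix y assume "y \<in> ?h ` hecke_class k q p"
    then obtain i where i: "i \<in> hecke_ideal k q" "y = ?h (i + p)"
      by (auto simp: hecke_class_def a_r_coset_def' free_algebra_simps)
    then have "i \<in> carrier (free_algebra k)" using additive_subgroup.a_Hcarr[OF ideal.axioms(1)[OF hecke_ideal_ideal]] by blast
    then have "y = ?h i \<oplus>\<^bsub>hecke n q\<^esub> ?h p"
      using h.hom_add[of i p] assms(2) by (simp add: i free_algebra_simps)
    then show "y \<in> {?h p}"
      using h.hom_closed[OF assms(2)] ker[OF i(1)] by simp
  next
    have "p \<in> hecke_class k q p"
      unfolding hecke_class_def
      by (rule abelian_subgroup.a_rcos_self[OF abelian_subgroupI3[OF ideal.axioms(1)[OF hecke_ideal_ideal]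
            free.abelian_group_axioms] assms(2)])
    then show "y \<in> ?h ` hecke_class k q p" if "y \<in> {?h p}" for y using that by blast
  qed
  then show ?thesis by (simp add: hecke_shift_def)
qed

lemma hecke_shift_hom:
  assumes "k + m \<le> n"
  shows "hecke_shift n m q \<in> ring_hom (hecke k q) (hecke n q)"
proof (rule ring_hom_memI)
  fix X assume "X \<in> carrier (hecke k q)"
  then obtain p where p: "p \<in> carrier (free_algebra k)" "X = hecke_class k q p"
    by (rule hecke_carrierE)
  show "hecke_shift n m q X \<in> carrier (hecke n q)"
    using shift_free_closed[OF p(1) assms] by (simp add: p hecke_shift_class[OF assms] hecke_class_simps)
  fix Y assume "Y \<in> carrier (hecke k q)"
  then obtain r where r: "r \<in> carrier (free_algebra k)" "Y = hecke_class k q r"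
    by (rule hecke_carrierE)
  note s = shift_free_closed[OF p(1) assms] shift_free_closed[OF r(1) assms]
  have "X \<otimes>\<^bsub>hecke k q\<^esub> Y = hecke_class k q (p * r)" "X \<oplus>\<^bsub>hecke k q\<^esub> Y = hecke_class k q (p + r)"
    using p r by (simp_all add: hecke_class_simps)
  note XY = this
  show "hecke_shift n m q (X \<otimes>\<^bsub>hecke k q\<^esub> Y)
      = hecke_shift n m q X \<otimes>\<^bsub>hecke n q\<^esub> hecke_shift n m q Y"
    "hecke_shift n m q (X \<oplus>\<^bsub>hecke k q\<^esub> Y)
      = hecke_shift n m q X \<oplus>\<^bsub>hecke n q\<^esub> hecke_shift n m q Y"
    unfolding XY hecke_shift_class[OF assms free_algebra_closed(1)[OF p(1) r(1)]]
      hecke_shift_class[OF assms free_algebra_closed(2)[OF p(1) r(1)]]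
    unfolding p(2) r(2) hecke_shift_class[OF assms p(1)] hecke_shift_class[OF assms r(1)]
    using s by (simp_all add: shift_free_mult shift_free_add hecke_class_simps)
next
  show "hecke_shift n m q \<one>\<^bsub>hecke k q\<^esub> = \<one>\<^bsub>hecke n q\<^esub>"
    using hecke_shift_class[OF assms, of 1 q]
    by (simp add: free_algebra_closed shift_free_one hecke_class_one)
qed

lemma hecke_shift_gen:
  assumes "k + m \<le> n" "i \<in> {1..<k}"
  shows "hecke_shift n m q (hecke_gen k q i) = hecke_gen n q (i + m)"
  by (simp only: hecke_gen_class hecke_shift_class[OF assms(1) free_algebra_closed(7)[OF assms(2)]]
      shift_free_gen)

lemma hecke_shift_scalar:
  assumes "k + m \<le> n"
  shows "hecke_shift n m q (hecke_scalar k q c) = hecke_scalar n q c"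
  by (simp only: hecke_scalar_def hecke_shift_class[OF assms free_algebra_closed(6)] shift_free_scalar)

lemma hecke_shift_smult:
  assumes "k + m \<le> n" "h \<in> carrier (hecke k q)"
  shows "hecke_shift n m q (hecke_smult k q c h) = hecke_smult n q c (hecke_shift n m q h)"
  using ring_hom_mult[OF hecke_shift_hom[OF assms(1)] hecke_scalar_closed assms(2)]
  by (simp add: hecke_smult_scalar hecke_shift_scalar[OF assms(1)])

lemma hecke_shift_word_prod:
  assumes "k + m \<le> n" "set is \<subseteq> {1..<k}"
  shows "hecke_shift n m q (hecke.word_prod k q is) = hecke.word_prod n q (map (\<lambda>i. i + m) is)"
  using assms(2)
proof (induction "is")
  case Nil
  then show ?case using ring_hom_one[OF hecke_shift_hom[OF assms(1)]] by simp
next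
  case (Cons i "is")
  then have "i \<in> {1..<k}" "set is \<subseteq> {1..<k}" by auto
  then have "hecke_gen k q i \<in> carrier (hecke k q)" "hecke.word_prod k q is \<in> carrier (hecke k q)"
    by (blast intro: hecke_gen_closed hecke.word_prod_closed)+
  from ring_hom_mult[OF hecke_shift_hom[OF assms(1)] this] show ?case
    using Cons \<open>i \<in> {1..<k}\<close> by (simp add: hecke_shift_gen[OF assms(1)])
qed

section \<open>Embedding the smaller symmetric group into the larger one\<close>

definition shift_perm :: "nat \<Rightarrow> (nat \<Rightarrow> nat) \<Rightarrow> nat \<Rightarrow> nat" where
  "shift_perm m v x = (if x \<le> m then x else v (x - m) + m)"

lemma shift_perm_transpose:
  assumes "1 \<le> i"
  shows "shift_perm m (Transposition.transpose i (i + 1)) = Transposition.transpose (i + m) (i + m + 1)"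
  using assms by (auto simp: fun_eq_iff shift_perm_def Transposition.transpose_def)

text \<open>Guards the truncated subtraction in \<open>shift_perm\<close>: points beyond m are sent
  beyond m, so composites stay in the second branch of the definition.\<close>

lemma permutes_pos:
  fixes v :: "nat \<Rightarrow> nat"
  assumes "v permutes {1..k}" "0 < x"
  shows "0 < v x"
proof (cases "x \<le> k")
  case True
  then show ?thesis using permutes_le[OF assms(1), of x] assms(2) by simp
next
  case False
  then show ?thesis using permutes_not_in[OF assms(1), of x] assms(2) by simp
qed

lemma shift_perm_prod:
  assumes "u permutes {1..k}"
  shows "shift_perm m (u \<cdot>\<^sub>p v) = shift_perm m u \<cdot>\<^sub>p shift_perm m v"
proof
  fix x
  show "shift_perm m (u \<cdot>\<^sub>p v) x = (shift_perm m u \<cdot>\<^sub>p shift_perm m v) x"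
  proof (cases "x \<le> m")
    case False
    then have "0 < u (x - m)" by (intro permutes_pos[OF assms]) simp
    then show ?thesis using False by (auto simp: shift_perm_def perm_prod_apply)
  qed (simp add: shift_perm_def perm_prod_apply)
qed

lemma word_perm_shift:
  "set is \<subseteq> {1..<k} \<Longrightarrow> word_perm (map (\<lambda>i. i + m) is) = shift_perm m (word_perm is)"
proof (induction "is")
  case Nil
  show ?case by (auto simp: fun_eq_iff shift_perm_def)
next
  case (Cons i "is")
  then have i: "i \<in> {1..<k}" and IH: "word_perm (map (\<lambda>i. i + m) is) = shift_perm m (word_perm is)"
    by auto
  have "1 \<le> i" using i by simp
  then show ?case
    unfolding list.map word_perm.simps IH shift_perm_prod[OF transpose_permutes_range[OF i]]
    by (simp only: shift_perm_transpose)
qed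

lemma shift_perm_permutes:
  assumes "v permutes {1..k}" "k + m \<le> n"
  shows "shift_perm m v permutes {1..n}"
proof -
  obtain "is" where e: "expression k v is" using exists_reduced_word[OF assms(1)] by blast
  then have s: "set is \<subseteq> {1..<k}" "word_perm is = v" by (simp_all add: expression_def)
  have "set (map (\<lambda>i. i + m) is) \<subseteq> {1..<n}"
    using s(1) assms(2) by (fastforce simp: subset_eq)
  from word_perm_permutes[OF this] show ?thesis
    by (simp only: word_perm_shift[OF s(1)] s(2))
qed

text \<open>Points up to m are fixed and lie below everything else, points beyond k + m are fixed
  and lie above, so neither occurs in an inversion. What remains is a translate of the inversions of
  v.\<close>

lemma card_inversions_shift:
  assumes "v permutes {1..k}" "k + m \<le> n"
  shows "card (inversions n (shift_perm m v)) = card (inversions k v)"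
proof -
  have "inversions n (shift_perm m v) = (\<lambda>(x, y). (x + m, y + m)) ` inversions k v"
  proof (intro equalityI subsetI)
    fix p assume "p \<in> inversions n (shift_perm m v)"
    then obtain x y where p: "p = (x, y)" "1 \<le> x" "x < y" "y \<le> n"
      "shift_perm m v y < shift_perm m v x"
      by (auto simp: inversions_def)
    have x: "m < x"
    proof (rule ccontr)
      assume "\<not> m < x"
      then have "shift_perm m v y < x" using p by (simp add: shift_perm_def)
      then show False using p(3) \<open>\<not> m < x\<close> by (auto simp: shift_perm_def split: if_splits)
    qed
    then have lt: "v (y - m) < v (x - m)" using p by (simp add: shift_perm_def)
    have "y - m \<le> k"
    proof (rule ccontr)
      assume "\<not> y - m \<le> k"
      then have "y - m < v (x - m)"
        using lt permutes_not_in[OF assms(1), of "y - m"] by simp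
      moreover have "v (x - m) \<le> k \<or> v (x - m) = x - m"
        using permutes_le[OF assms(1), of "x - m"] permutes_not_in[OF assms(1), of "x - m"] x
        by (cases "x - m \<le> k") auto
      ultimately show False using \<open>\<not> y - m \<le> k\<close> p(3) x by linarith
    qed
    then have "(x - m, y - m) \<in> inversions k v"
      using lt x p(3) by (auto simp: inversions_def intro: diff_less_mono)
    then show "p \<in> (\<lambda>(x, y). (x + m, y + m)) ` inversions k v"
      using x p by (intro rev_image_eqI[of "(x - m, y - m)"]) auto
  next
    fix p assume "p \<in> (\<lambda>(x, y). (x + m, y + m)) ` inversions k v"
    then show "p \<in> inversions n (shift_perm m v)"
      using assms(2) by (auto simp: inversions_def shift_perm_def)
  qed
  moreover have "inj_on (\<lambda>(x, y). (x + m, y + m)) (inversions k v)"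
    by (auto simp: inj_on_def)
  ultimately show ?thesis by (simp add: card_image)
qed

text \<open>A shifted reduced word is again reduced, because shifting preserves both the length of
  the word and the inversion number.\<close>

lemma hecke_shift_T:
  assumes v: "v permutes {1..k}" and kn: "k + m \<le> n"
  shows "hecke_shift n m q (hecke_T k q v) = hecke_T n q (shift_perm m v)"
proof -
  obtain "is" where r: "reduced_expression k v is" using exists_reduced_expression[OF v] by blast
  then have s: "set is \<subseteq> {1..<k}" "word_perm is = v" "length is = card (inversions k v)"
    by (simp_all add: reduced_expression_iff expression_def)
  have "set (map (\<lambda>i. i + m) is) \<subseteq> {1..<n}"
    using s(1) kn by (fastforce simp: subset_eq)
  then have r': "reduced_expression n (shift_perm m v) (map (\<lambda>i. i + m) is)"
    unfolding reduced_expression_iff expression_def card_inversions_shift[OF v kn]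
      word_perm_shift[OF s(1)] by (simp add: s)
  show ?thesis
    unfolding hecke_T_eq_word_prod[OF v r] hecke_T_eq_word_prod[OF shift_perm_permutes[OF v kn] r']
    by (rule hecke_shift_word_prod[OF kn s(1)])
qed

section \<open>Coset decompositions for Young subgroups\<close>

lemma permutes_eqI:
  assumes "d permutes S" "e permutes S" "\<And>x. x \<in> S \<Longrightarrow> d x = e x"
  shows "d = e"
proof
  show "d x = e x" for x
    using assms(3)[of x] permutes_not_in[OF assms(1), of x] permutes_not_in[OF assms(2), of x]
    by (cases "x \<in> S") simp_all
qed

text \<open>At the least point where g and h differ, the smaller of the two values is taken by the
  other function at an earlier point, where g and h agree; this contradicts strict monotonicity. It
  yields uniqueness of minimal coset representatives.\<close>

lemma strict_mono_on_unique:
  fixes g h :: "nat \<Rightarrow> 'a::linorder"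
  assumes "\<And>x y. x \<in> B \<Longrightarrow> y \<in> B \<Longrightarrow> x < y \<Longrightarrow> g x < g y"
    and "\<And>x y. x \<in> B \<Longrightarrow> y \<in> B \<Longrightarrow> x < y \<Longrightarrow> h x < h y"
    and "g ` B = h ` B" "x \<in> B"
  shows "g x = h x"
  using assms(4)
proof (induction x rule: less_induct)
  case (less x)
  have *: "False" if lt: "g' x < h' x" and img: "g' ` B = h' ` B"
    and IH: "\<And>y. y < x \<Longrightarrow> y \<in> B \<Longrightarrow> g' y = h' y"
    and g: "\<And>x y. x \<in> B \<Longrightarrow> y \<in> B \<Longrightarrow> x < y \<Longrightarrow> g' x < g' y"
    and h: "\<And>x y. x \<in> B \<Longrightarrow> y \<in> B \<Longrightarrow> x < y \<Longrightarrow> h' x < h' y" for g' h' :: "nat \<Rightarrow> 'a"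
  proof -
    obtain y where y: "y \<in> B" "g' x = h' y" using img less.prems by blast
    have "y < x"
      using lt h[OF less.prems y(1)] y(2) by (metis less_asym linorder_neqE_nat)
    then show False using IH[of y] g[OF y(1) less.prems] y by auto
  qed
  show ?case
    using *[of g h] *[of h g] assms(1-3) less.IH by (metis linorder_neqE)
qed

text \<open>The maximiser of \<open>\<Sum>x. x * d x\<close> cannot be improved by sorting two of its values.\<close>

lemma exists_swap_minimal:
  fixes S :: "(nat \<Rightarrow> nat) set"
  assumes "finite S" "S \<noteq> {}"
  shows "\<exists>d \<in> S. \<forall>x \<in> {1..n}. \<forall>y \<in> {1..n}. x < y \<and> d y < d x \<longrightarrow>
    d \<circ> Transposition.transpose x y \<notin> S"
proof -
  let ?g = "\<lambda>d. \<Sum>x \<in> {1..n}. x * d x"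
  have "Max (?g ` S) \<in> ?g ` S" using assms by simp
  then obtain d where d: "d \<in> S" "?g d = Max (?g ` S)" by auto
  show ?thesis
  proof (intro bexI[OF _ d(1)] ballI impI notI)
    fix x y assume x: "x \<in> {1..n}" and y: "y \<in> {1..n}" and xy: "x < y \<and> d y < d x"
    let ?e = "d \<circ> Transposition.transpose x y"
    assume "?e \<in> S"
    then have "?g ?e \<in> ?g ` S" by (rule imageI)
    then have le: "?g ?e \<le> ?g d" unfolding d(2) using assms(1) by (intro Max_ge) simp_all
    let ?R = "{1..n} - {x} - {y}"
    have split: "?g h = x * h x + (y * h y + (\<Sum>z \<in> ?R. z * h z))" for h :: "nat \<Rightarrow> nat"
    proof -
      have "?g h = x * h x + (\<Sum>z \<in> {1..n} - {x}. z * h z)"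
        by (rule sum.remove[OF _ x]) simp
      also have "(\<Sum>z \<in> {1..n} - {x}. z * h z) = y * h y + (\<Sum>z \<in> ?R. z * h z)"
        by (rule sum.remove) (use y xy in auto)
      finally show ?thesis .
    qed
    have "(\<Sum>z \<in> ?R. z * ?e z) = (\<Sum>z \<in> ?R. z * d z)"
      by (intro sum.cong) (auto simp: transpose_apply_other)
    then have "x * d y + y * d x \<le> x * d x + y * d y"
      using le unfolding split[of ?e] split[of d] by simp
    \<comment> \<open>The swap changes the sum by (y - x)(d x - d y) = s t, which is
      positive.\<close>
    moreover obtain s t where "y = x + s" "d x = d y + t" "0 < s" "0 < t"
      using xy by (metis less_imp_add_positive)
    ultimately show False by (simp add: algebra_simps)
  qed
qed

section \<open>Block groups and minimal coset representatives\<close>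

definition block_group :: "nat \<Rightarrow> (nat \<Rightarrow> nat) \<Rightarrow> (nat \<Rightarrow> nat) set" where
  "block_group n f = {w. w permutes {1..n} \<and> (\<forall>x \<in> {1..n}. f (w x) = f x)}"

text \<open>For monotone f and W the block group of f, these are the shortest elements of the cosets
  d W, where W acts after d. For the cosets W d of \<open>left_minimal\<close> the order is tested
  on the blocks themselves instead of their preimages.\<close>

definition right_minimal :: "nat \<Rightarrow> (nat \<Rightarrow> nat) \<Rightarrow> (nat \<Rightarrow> nat) \<Rightarrow> bool" where
  "right_minimal n f d \<longleftrightarrow>
     (\<forall>x \<in> {1..n}. \<forall>y \<in> {1..n}. x < y \<and> f (d x) = f (d y) \<longrightarrow> d x < d y)"

definition left_minimal :: "nat \<Rightarrow> (nat \<Rightarrow> nat) \<Rightarrow> (nat \<Rightarrow> nat) \<Rightarrow> bool" where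
  "left_minimal n f d \<longleftrightarrow> (\<forall>x \<in> {1..n}. \<forall>y \<in> {1..n}. x < y \<and> f x = f y \<longrightarrow> d x < d y)"

lemma finite_perm_set: "D \<subseteq> {w. w permutes {1..n::nat}} \<Longrightarrow> finite D"
  by (rule finite_subset[OF _ finite_permutations[of "{1..n}"]]) auto

lemma finite_block_group [simp]: "finite (block_group n f)"
  by (rule finite_perm_set[of _ n]) (auto simp: block_group_def)

lemma id_block_group: "id \<in> block_group n f"
  by (simp add: block_group_def permutes_id)

lemma block_group_prod:
  assumes "u \<in> block_group n f" "v \<in> block_group n f"
  shows "u \<cdot>\<^sub>p v \<in> block_group n f"
proof -
  have u: "u permutes {1..n}" and v: "v permutes {1..n}"
    and f: "\<forall>x \<in> {1..n}. f (u x) = f x" "\<forall>x \<in> {1..n}. f (v x) = f x"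
    using assms unfolding block_group_def by blast+
  have "f (v (u x)) = f x" if "x \<in> {1..n}" for x
  proof -
    have "u x \<in> {1..n}" using that permutes_in_image[OF u] by blast
    then show ?thesis using f that by metis
  qed
  then show ?thesis
    using perm_prod_permutes[OF u v] unfolding block_group_def perm_prod_apply by blast
qed

lemma transpose_block_group:
  assumes "x \<in> {1..n}" "y \<in> {1..n}" "f x = f y"
  shows "Transposition.transpose x y \<in> block_group n f"
  using permutes_swap_id[OF assms(1,2)] assms(3)
  by (auto simp: block_group_def Transposition.transpose_def)

text \<open>Monotonicity of f makes the blocks intervals, so v can reverse two values of d only
  inside one block, and there d has kept the order.\<close>

lemma reduced_pair_right_minimal:
  assumes mono: "\<And>x y. x \<in> {1..n} \<Longrightarrow> y \<in> {1..n} \<Longrightarrow> x \<le> y \<Longrightarrow> f x \<le> f y"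
    and d: "d permutes {1..n}" "right_minimal n f d" and v: "v \<in> block_group n f"
  shows "reduced_pair n d v"
  unfolding reduced_pair_def
proof (intro ballI impI)
  fix x y assume x: "x \<in> {1..n}" and y: "y \<in> {1..n}" and xy: "d x < d y \<and> v (d y) < v (d x)"
  have dx: "d x \<in> {1..n}" and dy: "d y \<in> {1..n}"
    using x y permutes_in_image[OF d(1)] by blast+
  have vp: "v permutes {1..n}" and fv: "\<And>x. x \<in> {1..n} \<Longrightarrow> f (v x) = f x"
    using v unfolding block_group_def by blast+
  have "v (d x) \<in> {1..n}" "v (d y) \<in> {1..n}"
    using dx dy permutes_in_image[OF vp] by blast+
  then have "f (d y) \<le> f (d x)" "f (d x) \<le> f (d y)"
    using mono[of "v (d y)" "v (d x)"] mono[OF dx dy] xy fv[OF dx] fv[OF dy] by simp_all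
  then have "\<not> y < x"
    using d(2)[unfolded right_minimal_def, rule_format, OF y x] xy by auto
  moreover have "x \<noteq> y" using xy by auto
  ultimately show "x < y" by simp
qed

text \<open>Two values of v reversed by d lie in different blocks, since d increases on each block.
  As v preserves the blocks and these are intervals, v has not inverted the two points.\<close>

lemma reduced_pair_left_minimal:
  assumes mono: "\<And>x y. x \<in> {1..n} \<Longrightarrow> y \<in> {1..n} \<Longrightarrow> x \<le> y \<Longrightarrow> f x \<le> f y"
    and d: "d permutes {1..n}" "left_minimal n f d" and v: "v \<in> block_group n f"
  shows "reduced_pair n v d"
  unfolding reduced_pair_def
proof (intro ballI impI)
  fix x y assume x: "x \<in> {1..n}" and y: "y \<in> {1..n}" and xy: "v x < v y \<and> d (v y) < d (v x)"
  have vp: "v permutes {1..n}" and fv: "\<And>x. x \<in> {1..n} \<Longrightarrow> f (v x) = f x"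
    using v unfolding block_group_def by blast+
  have vx: "v x \<in> {1..n}" and vy: "v y \<in> {1..n}"
    using x y permutes_in_image[OF vp] by blast+
  have "f (v x) \<noteq> f (v y)"
    using d(2)[unfolded left_minimal_def, rule_format, OF vx vy] xy by auto
  then have "f x < f y" using mono[OF vx vy] xy fv[OF x] fv[OF y] by simp
  then show "x < y" using mono[OF y x] by (meson leD leI)
qed

text \<open>D is a union of cosets d W. A maximiser of the sum of x * d(x) over a coset is its
  minimal representative, and sortedness leaves room for only one.\<close>

lemma bij_betw_right_cosets:
  assumes D: "D \<subseteq> {w. w permutes {1..n}}"
    and closed: "\<And>d v. d \<in> D \<Longrightarrow> v \<in> block_group n f \<Longrightarrow> d \<cdot>\<^sub>p v \<in> D"
  shows "bij_betw (\<lambda>(d, v). d \<cdot>\<^sub>p v) ({d \<in> D. right_minimal n f d} \<times> block_group n f) D"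
proof (rule bij_betw_imageI)
  show "inj_on (\<lambda>(d, v). d \<cdot>\<^sub>p v) ({d \<in> D. right_minimal n f d} \<times> block_group n f)"
  proof (rule inj_onI, clarify)
    fix d v e u
    assume d: "d \<in> D" "right_minimal n f d" and v: "v \<in> block_group n f"
      and e: "e \<in> D" "right_minimal n f e" and u: "u \<in> block_group n f"
      and eq: "d \<cdot>\<^sub>p v = e \<cdot>\<^sub>p u"
    have dp: "d permutes {1..n}" and ep: "e permutes {1..n}" using D d e by blast+
    have eq': "v (d x) = u (e x)" for x using fun_cong[OF eq, of x] by (simp add: perm_prod_apply)
    have fde: "f (d x) = f (e x)" if "x \<in> {1..n}" for x
    proof -
      have "d x \<in> {1..n}" "e x \<in> {1..n}"
        using that permutes_in_image[OF dp] permutes_in_image[OF ep] by blast+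
      then have "f (d x) = f (v (d x))" "f (e x) = f (u (e x))"
        using u v unfolding block_group_def by auto
      then show ?thesis by (simp add: eq')
    qed
    \<comment> \<open>Both d and e map the preimage of the block containing d x increasingly onto
      this block, and the two preimages coincide.\<close>
    have "d x = e x" if x: "x \<in> {1..n}" for x
    proof (rule strict_mono_on_unique[where g = d and h = e and x = x and B = "{y \<in> {1..n}. f (d y) = f (d x)}"])
      have *: "g ` {y \<in> {1..n}. f (g y) = b} = {y \<in> {1..n}. f y = b}"
        if g: "g permutes {1..n}" for g b
      proof (intro equalityI subsetI)
        fix z assume z: "z \<in> {y \<in> {1..n}. f y = b}"
        then have "z \<in> g ` {1..n}" using permutes_image[OF g] by simp
        then show "z \<in> g ` {y \<in> {1..n}. f (g y) = b}" using z by blast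
      qed (use permutes_in_image[OF g] in blast)
      have fib: "{y \<in> {1..n}. f (d y) = f (d x)} = {y \<in> {1..n}. f (e y) = f (d x)}"
        using fde by auto
      show "d ` {y \<in> {1..n}. f (d y) = f (d x)} = e ` {y \<in> {1..n}. f (d y) = f (d x)}"
        using *[OF dp, of "f (d x)"] *[OF ep, of "f (d x)"] unfolding fib by (rule trans[OF _ sym])
    qed (use x d(2) e(2) fde in \<open>auto simp: right_minimal_def\<close>)
    then have de: "d = e" by (rule permutes_eqI[OF dp ep])
    have "v = u"
    proof
      fix z
      obtain x where "z = e x" using permutes_surj[OF ep] by (rule surjE)
      then show "v z = u z" using eq'[of x] de by simp
    qed
    with de show "d = e \<and> v = u" by simp
  qed
  show "(\<lambda>(d, v). d \<cdot>\<^sub>p v) ` ({d \<in> D. right_minimal n f d} \<times> block_group n f) = D"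
  proof (intro equalityI subsetI)
    fix w assume w: "w \<in> D"
    let ?S = "(\<lambda>v. w \<cdot>\<^sub>p v) ` block_group n f"
    have "finite ?S" "?S \<noteq> {}" using id_block_group[of n f] by auto
    then obtain d where d: "d \<in> ?S" and max: "\<forall>x \<in> {1..n}. \<forall>y \<in> {1..n}. x < y \<and> d y < d x \<longrightarrow>
        d \<circ> Transposition.transpose x y \<notin> ?S"
      using exists_swap_minimal[of ?S n] by blast
    then obtain v where v: "v \<in> block_group n f" "d = w \<cdot>\<^sub>p v" by blast
    have dD: "d \<in> D" using closed[OF w v(1)] v(2) by simp
    then have dp: "d permutes {1..n}" using D by blast
    have "right_minimal n f d"
      unfolding right_minimal_def
    proof (intro ballI impI, rule ccontr)
      fix x y assume x: "x \<in> {1..n}" and y: "y \<in> {1..n}" and xy: "x < y \<and> f (d x) = f (d y)"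
        and "\<not> d x < d y"
      then have lt: "d y < d x"
        using inj_eq[OF permutes_inj[OF dp], of x y] by (metis linorder_neqE_nat less_irrefl)
      have dx: "d x \<in> {1..n}" and dy: "d y \<in> {1..n}"
        using x y permutes_in_image[OF dp] by blast+
      \<comment> \<open>Exchanging two values of d from one block is right multiplication by an
        element of W, so it does not leave the coset.\<close>
      have "d \<circ> Transposition.transpose x y = d \<cdot>\<^sub>p Transposition.transpose (d x) (d y)"
        unfolding perm_prod_def
        using inj_eq[OF permutes_inj[OF dp]] by (auto simp: fun_eq_iff Transposition.transpose_def)
      also have "\<dots> = w \<cdot>\<^sub>p (v \<cdot>\<^sub>p Transposition.transpose (d x) (d y))"
        by (simp add: v(2) perm_prod_assoc)
      also have "\<dots> \<in> ?S"
        using block_group_prod[OF v(1) transpose_block_group[OF dx dy]] xy by blast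
      finally show False using max x y xy lt by blast
    qed
    moreover obtain v' where v': "v' \<in> block_group n f" "d \<cdot>\<^sub>p v' = w"
    proof
      have vp: "v permutes {1..n}" using v unfolding block_group_def by blast
      show "d \<cdot>\<^sub>p (inv_into UNIV v) = w"
        unfolding v(2) perm_prod_def using permutes_inv_o(2)[OF vp] by (simp add: o_assoc)
      have "f (inv_into UNIV v x) = f x" if "x \<in> {1..n}" for x
      proof -
        have "inv_into UNIV v x \<in> {1..n}" using that permutes_in_image[OF permutes_inv[OF vp]] by blast
        then have "f (v (inv_into UNIV v x)) = f (inv_into UNIV v x)" using v(1) unfolding block_group_def by blast
        then show ?thesis using permutes_inverses(1)[OF vp] by simp
      qed
      then show "inv_into UNIV v \<in> block_group n f"
        using permutes_inv[OF vp] unfolding block_group_def by blast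
    qed
    ultimately show "w \<in> (\<lambda>(d, v). d \<cdot>\<^sub>p v) ` ({d \<in> D. right_minimal n f d} \<times> block_group n f)"
      using dD by (intro rev_image_eqI[of "(d, v')"]) auto
  qed (use closed in auto)
qed

text \<open>The mirror image for cosets W d: d and e agree because they increase on each block and
  send it onto the same set, and exchanging two positions in one block is left multiplication by an
  element of W.\<close>

lemma bij_betw_left_cosets:
  assumes D: "D \<subseteq> {w. w permutes {1..n}}"
    and closed: "\<And>d v. d \<in> D \<Longrightarrow> v \<in> block_group n f \<Longrightarrow> v \<cdot>\<^sub>p d \<in> D"
  shows "bij_betw (\<lambda>(v, d). v \<cdot>\<^sub>p d) (block_group n f \<times> {d \<in> D. left_minimal n f d}) D"
proof (rule bij_betw_imageI)
  show "inj_on (\<lambda>(v, d). v \<cdot>\<^sub>p d) (block_group n f \<times> {d \<in> D. left_minimal n f d})"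
  proof (rule inj_onI, clarify)
    fix d v e u
    assume d: "d \<in> D" "left_minimal n f d" and v: "v \<in> block_group n f"
      and e: "e \<in> D" "left_minimal n f e" and u: "u \<in> block_group n f"
      and eq: "v \<cdot>\<^sub>p d = u \<cdot>\<^sub>p e"
    have dp: "d permutes {1..n}" and ep: "e permutes {1..n}" using D d e by blast+
    have eq': "d (v x) = e (u x)" for x using fun_cong[OF eq, of x] by (simp add: perm_prod_apply)
    have *: "g ` {y \<in> {1..n}. f y = b} = {y \<in> {1..n}. f y = b}"
      if g: "g \<in> block_group n f" for g b
    proof -
      have gp: "g permutes {1..n}" and fg: "\<And>x. x \<in> {1..n} \<Longrightarrow> f (g x) = f x"
        using g unfolding block_group_def by blast+
      show ?thesis
      proof (intro equalityI subsetI)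
        fix z assume z: "z \<in> {y \<in> {1..n}. f y = b}"
        then have "z \<in> g ` {1..n}" using permutes_image[OF gp] by simp
        then obtain y where y: "y \<in> {1..n}" "z = g y" by blast
        then have "f y = b" using z fg[OF y(1)] by simp
        then show "z \<in> g ` {y \<in> {1..n}. f y = b}" using y by blast
      next
        fix z assume "z \<in> g ` {y \<in> {1..n}. f y = b}"
        then obtain y where y: "y \<in> {1..n}" "f y = b" "z = g y" by blast
        then have "g y \<in> {1..n}" using permutes_in_image[OF gp, of y] by simp
        then show "z \<in> {y \<in> {1..n}. f y = b}"
          using fg[OF y(1)] y by simp
      qed
    qed
    have "d x = e x" if x: "x \<in> {1..n}" for x
    proof (rule strict_mono_on_unique[where g = d and h = e and x = x and B = "{y \<in> {1..n}. f y = f x}"])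
      have "d ` {y \<in> {1..n}. f y = f x} = d ` v ` {y \<in> {1..n}. f y = f x}" using *[OF v] by simp
      also have "\<dots> = e ` u ` {y \<in> {1..n}. f y = f x}" by (simp add: image_image eq')
      also have "\<dots> = e ` {y \<in> {1..n}. f y = f x}" using *[OF u] by simp
      finally show "d ` {y \<in> {1..n}. f y = f x} = e ` {y \<in> {1..n}. f y = f x}" .
    qed (use x d(2) e(2) in \<open>auto simp: left_minimal_def\<close>)
    then have de: "d = e" by (rule permutes_eqI[OF dp ep])
    have "v x = u x" for x
      using eq'[of x] inj_eq[OF permutes_inj[OF ep]] by (simp add: de)
    with de show "v = u \<and> d = e" by auto
  qed
  show "(\<lambda>(v, d). v \<cdot>\<^sub>p d) ` (block_group n f \<times> {d \<in> D. left_minimal n f d}) = D"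
  proof (intro equalityI subsetI)
    fix w assume w: "w \<in> D"
    let ?S = "(\<lambda>v. v \<cdot>\<^sub>p w) ` block_group n f"
    have "finite ?S" "?S \<noteq> {}" using id_block_group[of n f] by auto
    then obtain d where d: "d \<in> ?S" and max: "\<forall>x \<in> {1..n}. \<forall>y \<in> {1..n}. x < y \<and> d y < d x \<longrightarrow>
        d \<circ> Transposition.transpose x y \<notin> ?S"
      using exists_swap_minimal[of ?S n] by blast
    then obtain v where v: "v \<in> block_group n f" "d = v \<cdot>\<^sub>p w" by blast
    have dD: "d \<in> D" using closed[OF w v(1)] v(2) by simp
    then have dp: "d permutes {1..n}" using D by blast
    have "left_minimal n f d"
      unfolding left_minimal_def
    proof (intro ballI impI, rule ccontr)
      fix x y assume x: "x \<in> {1..n}" and y: "y \<in> {1..n}" and xy: "x < y \<and> f x = f y"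
        and "\<not> d x < d y"
      then have lt: "d y < d x"
        using inj_eq[OF permutes_inj[OF dp], of x y] by (metis linorder_neqE_nat less_irrefl)
      have "d \<circ> Transposition.transpose x y = (Transposition.transpose x y \<cdot>\<^sub>p v) \<cdot>\<^sub>p w"
        by (simp add: v(2) perm_prod_def o_assoc)
      also have "\<dots> \<in> ?S"
        using block_group_prod[OF transpose_block_group[OF x y] v(1)] xy by blast
      finally show False using max x y xy lt by blast
    qed
    moreover obtain v' where v': "v' \<in> block_group n f" "v' \<cdot>\<^sub>p d = w"
    proof
      have vp: "v permutes {1..n}" using v unfolding block_group_def by blast
      show "(inv_into UNIV v) \<cdot>\<^sub>p d = w"
        unfolding v(2) perm_prod_def using permutes_inv_o(1)[OF vp] by (simp add: comp_assoc)
      have "f (inv_into UNIV v x) = f x" if "x \<in> {1..n}" for x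
      proof -
        have "inv_into UNIV v x \<in> {1..n}" using that permutes_in_image[OF permutes_inv[OF vp]] by blast
        then have "f (v (inv_into UNIV v x)) = f (inv_into UNIV v x)" using v(1) unfolding block_group_def by blast
        then show ?thesis using permutes_inverses(1)[OF vp] by simp
      qed
      then show "inv_into UNIV v \<in> block_group n f"
        using permutes_inv[OF vp] unfolding block_group_def by blast
    qed
    ultimately show "w \<in> (\<lambda>(v, d). v \<cdot>\<^sub>p d) ` (block_group n f \<times> {d \<in> D. left_minimal n f d})"
      using dD by (intro rev_image_eqI[of "(v', d)"]) auto
  qed (use closed in auto)
qed

section \<open>Weighted sums of basis elements\<close>

lemma (in semiring) finsum_mult_finsum:
  assumes "finite A" "finite B" "f \<in> A \<rightarrow> carrier R" "g \<in> B \<rightarrow> carrier R"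
  shows "(\<Oplus>x \<in> A. f x) \<otimes> (\<Oplus>y \<in> B. g y) = (\<Oplus>p \<in> A \<times> B. case p of (x, y) \<Rightarrow> f x \<otimes> g y)"
  using assms(1,3)
proof (induction A rule: finite_induct)
  case empty
  have "(\<Oplus>y \<in> B. g y) \<in> carrier R" by (rule finsum_closed[OF assms(4)])
  then show ?case by simp
next
  case (insert x A)
  have c: "f x \<in> carrier R" "f \<in> A \<rightarrow> carrier R" "(\<Oplus>y \<in> B. g y) \<in> carrier R"
    using insert.prems finsum_closed[OF assms(4)] by auto
  have eq: "insert x A \<times> B = Pair x ` B \<union> A \<times> B" by auto
  have "(\<Oplus>y \<in> insert x A. f y) \<otimes> (\<Oplus>y \<in> B. g y)
      = f x \<otimes> (\<Oplus>y \<in> B. g y) \<oplus> (\<Oplus>x \<in> A. f x) \<otimes> (\<Oplus>y \<in> B. g y)"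
    using insert c by (simp add: l_distr)
  also have "f x \<otimes> (\<Oplus>y \<in> B. g y) = (\<Oplus>y \<in> B. f x \<otimes> g y)"
    by (rule finsum_rdistr[OF assms(2) c(1) assms(4)])
  also have "\<dots> = (\<Oplus>p \<in> Pair x ` B. case p of (x, y) \<Rightarrow> f x \<otimes> g y)"
    using c(1) assms(4) by (subst finsum_reindex) (auto simp: inj_on_def Pi_def)
  also have "(\<Oplus>x \<in> A. f x) \<otimes> (\<Oplus>y \<in> B. g y) = (\<Oplus>p \<in> A \<times> B. case p of (x, y) \<Rightarrow> f x \<otimes> g y)"
    by (rule insert.IH[OF c(2)])
  also have "(\<Oplus>p \<in> Pair x ` B. case p of (x, y) \<Rightarrow> f x \<otimes> g y) \<oplus> (\<Oplus>p \<in> A \<times> B. case p of (x, y) \<Rightarrow> f x \<otimes> g y)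
      = (\<Oplus>p \<in> insert x A \<times> B. case p of (x, y) \<Rightarrow> f x \<otimes> g y)"
    unfolding eq
    by (rule finsum_Un_disjoint[symmetric])
      (use insert.hyps assms c in \<open>auto simp: Pi_def\<close>)
  finally show ?case .
qed

lemma ring_hom_finsum:
  assumes "ring R" "ring S" and h: "h \<in> ring_hom R S" and f: "f \<in> A \<rightarrow> carrier R" and "finite A"
  shows "h (finsum R f A) = finsum S (\<lambda>x. h (f x)) A"
proof -
  interpret R: ring R by fact
  interpret S: ring S by fact
  interpret h: ring_hom_ring R S h
    by (rule ring_hom_ringI2[OF assms(1,2) h])
  show ?thesis
    using assms(5) f
  proof (induction A rule: finite_induct)
    case (insert x A)
    then have "f x \<in> carrier R" "f \<in> A \<rightarrow> carrier R" "(\<lambda>x. h (f x)) \<in> A \<rightarrow> carrier S"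
      by (auto simp: Pi_def)
    then show ?case using insert by simp
  qed simp
qed

text \<open>The parameter a unifies the cases: a = 1 gives x and the double coset sums, a = -1/q
  gives y.\<close>

definition hecke_sum :: "nat \<Rightarrow> 'f::field \<Rightarrow> 'f \<Rightarrow> (nat \<Rightarrow> nat) set \<Rightarrow> 'f free set" where
  "hecke_sum n q a D = (\<Oplus>\<^bsub>hecke n q\<^esub>w \<in> D.
     hecke_smult n q (a ^ card (inversions n w)) (hecke_T n q w))"

lemma hecke_sum_closed [simp]:
  "D \<subseteq> {w. w permutes {1..n}} \<Longrightarrow> hecke_sum n q a D \<in> carrier (hecke n q)"
  unfolding hecke_sum_def
  by (rule hecke.finsum_closed) (auto intro!: hecke_smult_closed hecke_T_closed)

lemma hecke_sum_one:
  assumes "D \<subseteq> {w. w permutes {1..n}}"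
  shows "hecke_sum n q 1 D = (\<Oplus>\<^bsub>hecke n q\<^esub>w \<in> D. hecke_T n q w)"
  unfolding hecke_sum_def
proof (rule hecke.finsum_cong')
  fix w assume "w \<in> D"
  then have "hecke_T n q w \<in> carrier (hecke n q)" using assms by (intro hecke_T_closed) auto
  then show "hecke_smult n q (1 ^ card (inversions n w)) (hecke_T n q w) = hecke_T n q w"
    by (simp add: hecke_smult_one)
qed (use assms in \<open>auto intro!: hecke_T_closed\<close>)

lemma hecke_sum_singleton:
  assumes "w permutes {1..n}"
  shows "hecke_sum n q a {w} = hecke_smult n q (a ^ card (inversions n w)) (hecke_T n q w)"
  unfolding hecke_sum_def
  using hecke_smult_closed[OF hecke_T_closed[OF assms], of q] by (simp add: Pi_def)

text \<open>For a reduced pair lengths add, so the weight a^l(w) multiplies exactly as T_w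
  does.\<close>

lemma hecke_sum_factor:
  assumes D1: "D1 \<subseteq> {w. w permutes {1..n}}" and D2: "D2 \<subseteq> {w. w permutes {1..n}}"
    and red: "\<And>u v. u \<in> D1 \<Longrightarrow> v \<in> D2 \<Longrightarrow> reduced_pair n u v"
    and bij: "bij_betw (\<lambda>(u, v). u \<cdot>\<^sub>p v) (D1 \<times> D2) D"
  shows "hecke_sum n q a D = hecke_sum n q a D1 \<otimes>\<^bsub>hecke n q\<^esub> hecke_sum n q a D2"
proof -
  let ?t = "\<lambda>w. hecke_smult n q (a ^ card (inversions n w)) (hecke_T n q w)"
  have closed: "?t w \<in> carrier (hecke n q)" if "w permutes {1..n}" for w
    by (intro hecke_smult_closed hecke_T_closed that)
  have D: "D = (\<lambda>(u, v). u \<cdot>\<^sub>p v) ` (D1 \<times> D2)" using bij by (simp add: bij_betw_def)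
  have closed_prod: "?t (case p of (u, v) \<Rightarrow> u \<cdot>\<^sub>p v) \<in> carrier (hecke n q)" if mem: "p \<in> D1 \<times> D2" for p
  proof -
    obtain u v where p: "p = (u, v)" "u \<in> D1" "v \<in> D2" using mem by auto
    then have "(u \<cdot>\<^sub>p v) permutes {1..n}" using D1 D2 perm_prod_permutes by blast
    from closed[OF this] show ?thesis by (simp only: p(1) prod.case)
  qed
  have "hecke_sum n q a D1 \<otimes>\<^bsub>hecke n q\<^esub> hecke_sum n q a D2
      = (\<Oplus>\<^bsub>hecke n q\<^esub>p \<in> D1 \<times> D2. case p of (u, v) \<Rightarrow> ?t u \<otimes>\<^bsub>hecke n q\<^esub> ?t v)"
    unfolding hecke_sum_def
    by (rule hecke.finsum_mult_finsum)
      (use D1 D2 finite_perm_set[OF D1] finite_perm_set[OF D2] closed in \<open>auto simp: Pi_def\<close>)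
  also have "\<dots> = (\<Oplus>\<^bsub>hecke n q\<^esub>p \<in> D1 \<times> D2. ?t (case p of (u, v) \<Rightarrow> u \<cdot>\<^sub>p v))"
  proof (rule hecke.finsum_cong')
    show "(\<lambda>p. ?t (case p of (u, v) \<Rightarrow> u \<cdot>\<^sub>p v)) \<in> D1 \<times> D2 \<rightarrow> carrier (hecke n q)"
      using closed_prod by (rule Pi_I)
    fix p assume "p \<in> D1 \<times> D2"
    then obtain u v where p: "p = (u, v)" "u \<in> D1" "v \<in> D2" by auto
    have u: "u permutes {1..n}" and v: "v permutes {1..n}" using D1 D2 p by auto
    note r = red[OF p(2,3)]
    show "(case p of (u, v) \<Rightarrow> ?t u \<otimes>\<^bsub>hecke n q\<^esub> ?t v)
        = ?t (case p of (u, v) \<Rightarrow> u \<cdot>\<^sub>p v)"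
      using hecke_T_closed[OF u, of q] hecke_T_closed[OF v, of q]
      by (simp add: p(1) hecke_T_prod[OF u v r] card_inversions_prod[OF u v r] hecke_smult_mult
          power_add mult.commute)
  qed simp
  also have "\<dots> = hecke_sum n q a D"
    unfolding hecke_sum_def D
  proof (rule hecke.finsum_reindex[symmetric])
    show "inj_on (\<lambda>(u, v). u \<cdot>\<^sub>p v) (D1 \<times> D2)" using bij by (simp add: bij_betw_def)
    show "?t \<in> (\<lambda>(u, v). u \<cdot>\<^sub>p v) ` (D1 \<times> D2) \<rightarrow> carrier (hecke n q)"
      using closed_prod by blast
  qed
  finally show ?thesis by (rule sym)
qed

lemma block_group_perms: "block_group n f \<subseteq> {w. w permutes {1..n}}"
  by (auto simp: block_group_def)

lemma hecke_sum_right_cosets: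
  assumes mono: "\<And>x y. x \<in> {1..n} \<Longrightarrow> y \<in> {1..n} \<Longrightarrow> x \<le> y \<Longrightarrow> f x \<le> f y"
    and D: "D \<subseteq> {w. w permutes {1..n}}"
    and closed: "\<And>d v. d \<in> D \<Longrightarrow> v \<in> block_group n f \<Longrightarrow> d \<cdot>\<^sub>p v \<in> D"
  shows "hecke_sum n q a D
    = hecke_sum n q a {d \<in> D. right_minimal n f d} \<otimes>\<^bsub>hecke n q\<^esub> hecke_sum n q a (block_group n f)"
proof (rule hecke_sum_factor[OF _ block_group_perms _ bij_betw_right_cosets[OF D closed]])
  show "{d \<in> D. right_minimal n f d} \<subseteq> {w. w permutes {1..n}}" using D by blast
  show "reduced_pair n u v" if "u \<in> {d \<in> D. right_minimal n f d}" "v \<in> block_group n f" for u v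
    by (rule reduced_pair_right_minimal[OF mono]) (use that D in blast)+
qed

lemma hecke_sum_left_cosets:
  assumes mono: "\<And>x y. x \<in> {1..n} \<Longrightarrow> y \<in> {1..n} \<Longrightarrow> x \<le> y \<Longrightarrow> f x \<le> f y"
    and D: "D \<subseteq> {w. w permutes {1..n}}"
    and closed: "\<And>d v. d \<in> D \<Longrightarrow> v \<in> block_group n f \<Longrightarrow> v \<cdot>\<^sub>p d \<in> D"
  shows "hecke_sum n q a D
    = hecke_sum n q a (block_group n f) \<otimes>\<^bsub>hecke n q\<^esub> hecke_sum n q a {d \<in> D. left_minimal n f d}"
proof (rule hecke_sum_factor[OF block_group_perms _ _ bij_betw_left_cosets[OF D closed]])
  show "{d \<in> D. left_minimal n f d} \<subseteq> {w. w permutes {1..n}}" using D by blast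
  show "reduced_pair n u v" if "u \<in> block_group n f" "v \<in> {d \<in> D. left_minimal n f d}" for u v
    by (rule reduced_pair_left_minimal[OF mono]) (use that D in blast)+
qed

lemma shift_perm_inj:
  assumes "u permutes {1..k}" "v permutes {1..k}" "shift_perm m u = shift_perm m v"
  shows "u = v"
proof (rule permutes_eqI[OF assms(1,2)])
  fix x assume "x \<in> {1..k}"
  then have "shift_perm m u (x + m) = u x + m" "shift_perm m v (x + m) = v x + m"
    by (auto simp: shift_perm_def)
  then show "u x = v x" using assms(3) by simp
qed

lemma hecke_shift_sum:
  assumes D: "D \<subseteq> {w. w permutes {1..k}}" and kn: "k + m \<le> n"
  shows "hecke_shift n m q (hecke_sum k q a D) = hecke_sum n q a (shift_perm m ` D)"
proof -
  let ?t = "\<lambda>n w. hecke_smult n q (a ^ card (inversions n w)) (hecke_T n q w)"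
  have closed: "?t n w \<in> carrier (hecke n q)" if "w permutes {1..n}" for w n
    by (intro hecke_smult_closed hecke_T_closed that)
  have "hecke_shift n m q (hecke_sum k q a D)
      = (\<Oplus>\<^bsub>hecke n q\<^esub>w \<in> D. hecke_shift n m q (?t k w))"
    unfolding hecke_sum_def
    by (rule ring_hom_finsum[OF hecke.ring_axioms hecke.ring_axioms hecke_shift_hom[OF kn]])
      (use D closed finite_perm_set[OF D] in auto)
  also have "\<dots> = (\<Oplus>\<^bsub>hecke n q\<^esub>w \<in> D. ?t n (shift_perm m w))"
  proof (rule hecke.finsum_cong')
    show "(\<lambda>w. ?t n (shift_perm m w)) \<in> D \<rightarrow> carrier (hecke n q)"
      using D closed shift_perm_permutes[OF _ kn] by auto
    fix w assume "w \<in> D"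
    then have w: "w permutes {1..k}" using D by blast
    show "hecke_shift n m q (?t k w) = ?t n (shift_perm m w)"
      by (simp only: hecke_shift_smult[OF kn hecke_T_closed[OF w]] hecke_shift_T[OF w kn]
          card_inversions_shift[OF w kn])
  qed simp
  also have "\<dots> = hecke_sum n q a (shift_perm m ` D)"
    unfolding hecke_sum_def
  proof (rule hecke.finsum_reindex[symmetric])
    show "inj_on (shift_perm m) D" using shift_perm_inj D by (blast intro: inj_onI)
    show "?t n \<in> shift_perm m ` D \<rightarrow> carrier (hecke n q)"
      using D closed shift_perm_permutes[OF _ kn] by auto
  qed
  finally show ?thesis .
qed

section \<open>Tableaux\<close>

lemma row_tableau_less:
  assumes "(r, c) \<in> diagram a" "(r', c') \<in> diagram a" "r < r'"
  shows "row_tableau a r c < row_tableau a r' c'"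
proof -
  have "(\<Sum>j = 1..<r. a j) + a r = (\<Sum>j = 1..<Suc r. a j)"
    using assms(1) by (simp add: diagram_def)
  also have "\<dots> \<le> (\<Sum>j = 1..<r'. a j)"
    using assms(3) by (intro sum_mono2) auto
  finally show ?thesis using assms(1,2) by (simp add: row_tableau_def diagram_def)
qed

lemma row_tableau_less_iff:
  assumes "(r, c) \<in> diagram a" "(r', c') \<in> diagram a"
  shows "row_tableau a r c < row_tableau a r' c' \<longleftrightarrow> r < r' \<or> r = r' \<and> c < c'"
  using row_tableau_less[OF assms] row_tableau_less[OF assms(2,1)]
  by (cases r r' rule: linorder_cases) (auto simp: row_tableau_def)

lemma row_tableau_inj:
  assumes "(r, c) \<in> diagram a" "(r', c') \<in> diagram a" "row_tableau a r c = row_tableau a r' c'"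
  shows "r = r' \<and> c = c'"
  using row_tableau_less[OF assms(1,2)] row_tableau_less[OF assms(2,1)] assms(3)
  by (cases r r' rule: linorder_cases) (auto simp: row_tableau_def)

lemma compositionD:
  assumes "composition n a"
  obtains N where "\<And>i. N \<le> i \<Longrightarrow> a i = 0" "a 0 = 0" "(\<Sum>j = 1..<N. a j) = n" "1 \<le> N"
proof -
  have fin: "finite {i. a i \<noteq> 0}" and a0: "a 0 = 0" and sum: "(\<Sum>i | a i \<noteq> 0. a i) = n"
    using assms by (auto simp: composition_def)
  obtain N where N: "\<forall>i \<in> {i. a i \<noteq> 0}. i < N"
    using fin finite_nat_set_iff_bounded by blast
  then have z: "a i = 0" if "N \<le> i" for i using that by (metis leD mem_Collect_eq)
  have "(\<Sum>j = 1..<Suc N. a j) = (\<Sum>i | a i \<noteq> 0. a i)"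
  proof (rule sum.mono_neutral_right)
    show "{i. a i \<noteq> 0} \<subseteq> {1..<Suc N}"
    proof
      fix i assume i: "i \<in> {i. a i \<noteq> 0}"
      then have "i < N" "i \<noteq> 0" using N a0 by (blast, metis mem_Collect_eq)
      then show "i \<in> {1..<Suc N}" by simp
    qed
  qed auto
  then show ?thesis using that[of "Suc N"] z a0 sum by auto
qed

lemma row_tableau_image:
  assumes "\<And>i. N \<le> i \<Longrightarrow> a i = 0" "a 0 = 0"
  shows "(\<lambda>(r, c). row_tableau a r c) ` diagram a = {1..\<Sum>j = 1..<N. a j}"
proof -
  have *: "x \<in> (\<lambda>(r, c). row_tableau a r c) ` diagram a" if "1 \<le> x" "x \<le> (\<Sum>j = 1..<M. a j)" for x M
    using that
  proof (induction M)
    case (Suc M)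
    show ?case
    proof (cases "x \<le> (\<Sum>j = 1..<M. a j)")
      case False
      then have M: "1 \<le> M" using Suc.prems by (cases M) auto
      then have s: "(\<Sum>j = 1..<Suc M. a j) = (\<Sum>j = 1..<M. a j) + a M" by simp
      show ?thesis
        by (rule rev_image_eqI[of "(M, x - (\<Sum>j = 1..<M. a j))"])
          (use False M Suc.prems s in \<open>auto simp: diagram_def row_tableau_def\<close>)
    qed (use Suc in auto)
  qed simp
  show ?thesis
  proof (intro equalityI subsetI)
    fix x assume "x \<in> (\<lambda>(r, c). row_tableau a r c) ` diagram a"
    then obtain r c where rc: "(r, c) \<in> diagram a" "x = row_tableau a r c" by auto
    have "r < N" using rc(1) assms(1)[of r] by (force simp: diagram_def)
    have "(\<Sum>j = 1..<r. a j) + a r = (\<Sum>j = 1..<Suc r. a j)"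
      using rc(1) by (simp add: diagram_def)
    also have "\<dots> \<le> (\<Sum>j = 1..<N. a j)"
      using \<open>r < N\<close> by (intro sum_mono2) auto
    finally show "x \<in> {1..\<Sum>j = 1..<N. a j}"
      using rc by (auto simp: diagram_def row_tableau_def)
  qed (use * in auto)
qed

lemma bij_betw_row_tableau:
  assumes "composition n a"
  shows "bij_betw (\<lambda>(r, c). row_tableau a r c) (diagram a) {1..n}"
proof -
  obtain N where N: "\<And>i. N \<le> i \<Longrightarrow> a i = 0" "a 0 = 0" "(\<Sum>j = 1..<N. a j) = n"
    using compositionD[OF assms] by metis
  have "inj_on (\<lambda>(r, c). row_tableau a r c) (diagram a)"
    using row_tableau_inj by (force simp: inj_on_def)
  then show ?thesis
    using row_tableau_image[of N a] N by (simp add: bij_betw_def)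
qed

text \<open>Size as a number of boxes: transposing a diagram or deleting its first row then becomes
  a matter of counting.\<close>

lemma composition_iff:
  "composition n a \<longleftrightarrow> a 0 = 0 \<and> finite {i. a i \<noteq> 0} \<and> card (diagram a) = n"
proof -
  have "card (diagram a) = n" if "composition n a" for n
    using bij_betw_same_card[OF bij_betw_row_tableau[OF that]] by simp
  then show ?thesis
    by (auto simp: composition_def)
qed

definition row_of :: "(nat \<Rightarrow> nat) \<Rightarrow> nat \<Rightarrow> nat" where
  "row_of a x = (THE r. \<exists>c. (r, c) \<in> diagram a \<and> row_tableau a r c = x)"

lemma row_of_row_tableau [simp]: "(r, c) \<in> diagram a \<Longrightarrow> row_of a (row_tableau a r c) = r"
  unfolding row_of_def using row_tableau_inj by (intro the_equality) blast+

lemma row_tableau_cases: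
  assumes "composition n a" "x \<in> {1..n}"
  obtains r c where "(r, c) \<in> diagram a" "x = row_tableau a r c"
proof -
  have "x \<in> (\<lambda>(r, c). row_tableau a r c) ` diagram a"
    using bij_betw_imp_surj_on[OF bij_betw_row_tableau[OF assms(1)]] assms(2) by simp
  then show ?thesis using that by auto
qed

lemma row_tableau_in_range:
  assumes "composition n a" "(r, c) \<in> diagram a"
  shows "row_tableau a r c \<in> {1..n}"
  using bij_betwE[OF bij_betw_row_tableau[OF assms(1)]] assms(2) by auto

lemma row_of_mono:
  assumes "composition n a" "x \<in> {1..n}" "y \<in> {1..n}" "x \<le> y"
  shows "row_of a x \<le> row_of a y"
proof -
  obtain r c r' c' where rc: "(r, c) \<in> diagram a" "x = row_tableau a r c"
    "(r', c') \<in> diagram a" "y = row_tableau a r' c'"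
    using row_tableau_cases assms by metis
  then have "\<not> r' < r" using row_tableau_less[of r' c' a r c] assms(4) by auto
  then show ?thesis using rc by simp
qed

lemma row_image:
  assumes "composition n a" "1 \<le> r"
  shows "row_tableau a r ` {1..a r} = {x \<in> {1..n}. row_of a x = r}"
proof (intro equalityI subsetI)
  fix x assume "x \<in> row_tableau a r ` {1..a r}"
  then obtain c where "(r, c) \<in> diagram a" "x = row_tableau a r c"
    using assms(2) by (auto simp: diagram_def)
  then show "x \<in> {x \<in> {1..n}. row_of a x = r}" using row_tableau_in_range[OF assms(1)] by auto
next
  fix x assume x: "x \<in> {x \<in> {1..n}. row_of a x = r}"
  then obtain r' c where "(r', c) \<in> diagram a" "x = row_tableau a r' c"
    using row_tableau_cases[OF assms(1), of x] by blast
  then show "x \<in> row_tableau a r ` {1..a r}" using x by (auto simp: diagram_def)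
qed

lemma row_of_pos:
  assumes "composition n a" "x \<in> {1..n}"
  shows "1 \<le> row_of a x"
proof -
  obtain r c where "(r, c) \<in> diagram a" "x = row_tableau a r c"
    using row_tableau_cases[OF assms] by blast
  then show ?thesis by (auto simp: diagram_def)
qed

lemma card_row_of:
  assumes "composition n a" "1 \<le> r"
  shows "card {x \<in> {1..n}. row_of a x = r} = a r"
proof -
  have "inj_on (row_tableau a r) {1..a r}" by (auto simp: inj_on_def row_tableau_def)
  then have "card (row_tableau a r ` {1..a r}) = a r" by (simp add: card_image)
  then show ?thesis by (simp only: row_image[OF assms])
qed

lemma young_subgroup_block_group:
  assumes "composition n a"
  shows "young_subgroup n a = block_group n (row_of a)"
proof (intro equalityI subsetI)
  fix w assume "w \<in> young_subgroup n a"
  then have w: "w permutes {1..n}"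
    and *: "\<And>r. r \<ge> 1 \<Longrightarrow> w ` row_tableau a r ` {1..a r} = row_tableau a r ` {1..a r}"
    unfolding young_subgroup_def by blast+
  have r: "w ` {x \<in> {1..n}. row_of a x = r} = {x \<in> {1..n}. row_of a x = r}" if "r \<ge> 1" for r
    using *[OF that] unfolding row_image[OF assms that] .
  have "row_of a (w x) = row_of a x" if x: "x \<in> {1..n}" for x
  proof -
    have "w x \<in> w ` {y \<in> {1..n}. row_of a y = row_of a x}" using x by blast
    then show ?thesis using r[OF row_of_pos[OF assms x]] by simp
  qed
  then show "w \<in> block_group n (row_of a)" using w by (simp add: block_group_def)
next
  fix w assume "w \<in> block_group n (row_of a)"
  then have w: "w permutes {1..n}" and r: "\<And>x. x \<in> {1..n} \<Longrightarrow> row_of a (w x) = row_of a x"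
    unfolding block_group_def by blast+
  have "w ` {x \<in> {1..n}. row_of a x = r} = {x \<in> {1..n}. row_of a x = r}" for r
  proof (rule card_subset_eq)
    show "w ` {x \<in> {1..n}. row_of a x = r} \<subseteq> {x \<in> {1..n}. row_of a x = r}"
    proof
      fix z assume "z \<in> w ` {x \<in> {1..n}. row_of a x = r}"
      then obtain x where x: "x \<in> {1..n}" "row_of a x = r" "z = w x" by blast
      then show "z \<in> {x \<in> {1..n}. row_of a x = r}"
        using r[OF x(1)] permutes_in_image[OF w, of x] by simp
    qed
    show "card (w ` {x \<in> {1..n}. row_of a x = r}) = card {x \<in> {1..n}. row_of a x = r}"
      by (rule card_image[OF inj_on_subset[OF permutes_inj[OF w]]]) simp
  qed simp
  then have "w ` row_tableau a r ` {1..a r} = row_tableau a r ` {1..a r}" if "1 \<le> r" for r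
    unfolding row_image[OF assms that] .
  then show "w \<in> young_subgroup n a"
    using w unfolding young_subgroup_def by blast
qed

lemma x_elem_hecke_sum:
  assumes "composition n a"
  shows "x_elem n q a = hecke_sum n q 1 (block_group n (row_of a))"
  unfolding x_elem_def young_subgroup_block_group[OF assms]
  by (rule hecke_sum_one[OF block_group_perms, symmetric])

lemma y_elem_hecke_sum:
  assumes "composition n a"
  shows "y_elem n q a = hecke_sum n q (inverse (- q)) (block_group n (row_of a))"
  unfolding y_elem_def young_subgroup_block_group[OF assms] hecke_sum_def
proof (rule hecke.finsum_cong')
  fix w assume "w \<in> block_group n (row_of a)"
  then have "w permutes {1..n}" by (simp add: block_group_def)
  then show "hecke_smult n q ((- q) powi (- int (coxeter_length n w))) (hecke_T n q w)
    = hecke_smult n q (inverse (- q) ^ card (inversions n w)) (hecke_T n q w)"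
    by (simp only: coxeter_length_eq power_int_minus power_int_of_nat power_inverse)
qed (auto simp: block_group_def intro!: hecke_smult_closed hecke_T_closed)

section \<open>Permutations attached to tableaux\<close>

text \<open>Equal fibre sizes mean equal multisets of values. This supplies a candidate for 1_A and
  the left factor in the description of double cosets.\<close>

lemma exists_permutes_fibres:
  assumes "finite S" "\<And>i. card {x \<in> S. f x = i} = card {x \<in> S. g x = i}"
  shows "\<exists>p. p permutes S \<and> (\<forall>x \<in> S. f x = g (p x))"
proof -
  have "image_mset f (mset_set S) = image_mset g (mset_set S)"
    using assms by (intro multiset_eqI) (simp add: count_image_mset_eq_card_vimage)
  then show ?thesis using image_mset_eq_implies_permutes[OF assms(1)] by metis
qed

text \<open>The two lists of values are sorted and have the same multiset, so they coincide.\<close>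

lemma mono_eq_of_fibres:
  fixes f g :: "nat \<Rightarrow> nat"
  assumes "\<And>x y. x \<in> {1..k} \<Longrightarrow> y \<in> {1..k} \<Longrightarrow> x \<le> y \<Longrightarrow> f x \<le> f y"
    and "\<And>x y. x \<in> {1..k} \<Longrightarrow> y \<in> {1..k} \<Longrightarrow> x \<le> y \<Longrightarrow> g x \<le> g y"
    and fib: "\<And>i. card {x \<in> {1..k}. f x = i} = card {x \<in> {1..k}. g x = i}"
    and x: "x \<in> {1..k}"
  shows "f x = g x"
proof -
  let ?l = "[1..<Suc k]"
  have s: "sorted (map h ?l)" if "\<And>x y. x \<in> {1..k} \<Longrightarrow> y \<in> {1..k} \<Longrightarrow> x \<le> y \<Longrightarrow> h x \<le> h y"
    for h :: "nat \<Rightarrow> nat"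
    unfolding sorted_map
    by (rule sorted_wrt_mono_rel[OF _ sorted_wrt_upt]) (use that in auto)
  have m: "mset (map h ?l) = image_mset h (mset_set {1..k})" for h :: "nat \<Rightarrow> nat"
    by (simp only: mset_map mset_upt atLeastLessThanSuc_atLeastAtMost)
  have "image_mset f (mset_set {1..k}) = image_mset g (mset_set {1..k})"
    using fib by (intro multiset_eqI) (simp add: count_image_mset_eq_card_vimage)
  then have "mset (map f ?l) = mset (map g ?l)" by (simp only: m)
  moreover have "sorted (map f ?l)" "sorted (map g ?l)"
    using s[of f] s[of g] assms(1,2) by blast+
  ultimately have "map f ?l = map g ?l"
    by (metis properties_for_sort)
  then show ?thesis
    using x by (simp add: atLeastLessThanSuc_atLeastAtMost del: upt_Suc)
qed

text \<open>Carries A from boxes to {1..n} along t^a, so that the condition on 1_A becomes an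
  equation between functions of numbers.\<close>

definition entry_of :: "(nat \<Rightarrow> nat) \<Rightarrow> tableau \<Rightarrow> nat \<Rightarrow> nat" where
  "entry_of a A y = (THE i. \<exists>r c. (r, c) \<in> diagram a \<and> row_tableau a r c = y \<and> A r c = i)"

lemma entry_of_row_tableau [simp]:
  "(r, c) \<in> diagram a \<Longrightarrow> entry_of a A (row_tableau a r c) = A r c"
  unfolding entry_of_def using row_tableau_inj by (intro the_equality) blast+

lemma card_entry_of:
  assumes "composition n a"
  shows "card {y \<in> {1..n}. P (row_of a y) (entry_of a A y)}
    = card {(r, c). (r, c) \<in> diagram a \<and> P r (A r c)}"
proof -
  let ?t = "\<lambda>(r, c). row_tableau a r c"
  have "{y \<in> {1..n}. P (row_of a y) (entry_of a A y)} = ?t ` {(r, c). (r, c) \<in> diagram a \<and> P r (A r c)}"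
  proof (intro equalityI subsetI)
    fix y assume y: "y \<in> {y \<in> {1..n}. P (row_of a y) (entry_of a A y)}"
    then obtain r c where "(r, c) \<in> diagram a" "y = row_tableau a r c"
      using row_tableau_cases[OF assms, of y] by blast
    then show "y \<in> ?t ` {(r, c). (r, c) \<in> diagram a \<and> P r (A r c)}"
      using y by (intro rev_image_eqI[of "(r, c)"]) auto
  next
    fix y assume "y \<in> ?t ` {(r, c). (r, c) \<in> diagram a \<and> P r (A r c)}"
    then obtain r c where "(r, c) \<in> diagram a" "y = row_tableau a r c" "P r (A r c)" by auto
    then show "y \<in> {y \<in> {1..n}. P (row_of a y) (entry_of a A y)}"
      using row_tableau_in_range[OF assms, of r c] by simp
  qed
  moreover have "inj_on ?t {(r, c). (r, c) \<in> diagram a \<and> P r (A r c)}"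
    by (rule inj_on_subset[OF bij_betw_imp_inj_on[OF bij_betw_row_tableau[OF assms]]]) auto
  ultimately show ?thesis by (simp add: card_image)
qed

lemma card_entry_of_type:
  assumes a: "composition n a" and b: "composition n b" and A: "tableau_of_type a b A"
  shows "card {y \<in> {1..n}. entry_of a A y = i} = card {x \<in> {1..n}. row_of b x = i}"
proof (cases "i = 0")
  case True
  have "entry_of a A y \<noteq> 0" if y: "y \<in> {1..n}" for y
  proof -
    obtain r c where "(r, c) \<in> diagram a" "y = row_tableau a r c"
      using row_tableau_cases[OF a y] by blast
    then show ?thesis using A by (auto simp: tableau_of_type_def)
  qed
  then have "{y \<in> {1..n}. entry_of a A y = 0} = {}" by blast
  moreover have "{x \<in> {1..n}. row_of b x = 0} = {}" using row_of_pos[OF b] by fastforce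
  ultimately show ?thesis using True by (simp only: card.empty)
next
  case False
  then have "card {x \<in> {1..n}. row_of b x = i} = b i" by (intro card_row_of[OF b]) simp
  moreover have "b i = tableau_type a A i" using A False by (simp add: tableau_of_type_def)
  moreover have "card {y \<in> {1..n}. entry_of a A y = i} = tableau_type a A i"
    unfolding tableau_type_def by (rule card_entry_of[OF a])
  ultimately show ?thesis by simp
qed

text \<open>Exhibits 1_A as a shortest coset representative: the first condition is minimality with
  respect to the row group of b, and the second says that the entry of A at position p(x) is the row
  of x in t^b.\<close>

lemma one_perm_predicate_iff:
  assumes a: "composition n a" and b: "composition n b" and p: "p permutes {1..n}"
  shows "(\<forall>r c c'. (r, c) \<in> diagram b \<and> (r, c') \<in> diagram b \<and> c < c' \<longrightarrow>
           p (row_tableau b r c) < p (row_tableau b r c')) \<and>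
        (\<forall>(r, c) \<in> diagram a. \<exists>d. (A r c, d) \<in> diagram b \<and>
           p (row_tableau b (A r c) d) = row_tableau a r c) \<longleftrightarrow>
    left_minimal n (row_of b) p \<and> (\<forall>x \<in> {1..n}. entry_of a A (p x) = row_of b x)"
    (is "?C1 \<and> ?C2 \<longleftrightarrow> ?D1 \<and> ?D2")
proof -
  have "?C1 \<longleftrightarrow> ?D1"
  proof
    assume C: ?C1
    show ?D1
      unfolding left_minimal_def
    proof (intro ballI impI)
      fix x y assume x: "x \<in> {1..n}" and y: "y \<in> {1..n}" and xy: "x < y \<and> row_of b x = row_of b y"
      obtain r c r' c' where rc: "(r, c) \<in> diagram b" "x = row_tableau b r c"
        "(r', c') \<in> diagram b" "y = row_tableau b r' c'"
        using row_tableau_cases[OF b] x y by metis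
      then have "r = r'" "c < c'" using xy row_tableau_less_iff[of r c b r' c'] by auto
      then show "p x < p y" using C rc by blast
    qed
  next
    assume D: ?D1
    show ?C1
    proof (intro allI impI)
      fix r c c' assume rc: "(r, c) \<in> diagram b \<and> (r, c') \<in> diagram b \<and> c < c'"
      show "p (row_tableau b r c) < p (row_tableau b r c')"
        using rc row_tableau_in_range[OF b, of r]
        by (intro D[unfolded left_minimal_def, rule_format]) (auto simp: row_tableau_less_iff)
    qed
  qed
  moreover have "?C2 \<longleftrightarrow> ?D2"
  proof
    assume C: ?C2
    show ?D2
    proof
      fix x assume x: "x \<in> {1..n}"
      then have "p x \<in> {1..n}" using permutes_in_image[OF p, of x] by simp
      then obtain r c where rc: "(r, c) \<in> diagram a" "p x = row_tableau a r c"
        using row_tableau_cases[OF a] by blast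
      then obtain d where d: "(A r c, d) \<in> diagram b" "p (row_tableau b (A r c) d) = p x"
        using C by fastforce
      then have "x = row_tableau b (A r c) d" using inj_eq[OF permutes_inj[OF p]] by metis
      then show "entry_of a A (p x) = row_of b x" using d rc by simp
    qed
  next
    assume D: ?D2
    have "\<exists>d. (A r c, d) \<in> diagram b \<and> p (row_tableau b (A r c) d) = row_tableau a r c"
      if rc: "(r, c) \<in> diagram a" for r c
    proof -
      have "row_tableau a r c \<in> p ` {1..n}"
        using row_tableau_in_range[OF a rc] permutes_image[OF p] by simp
      then obtain x where x: "x \<in> {1..n}" "p x = row_tableau a r c" by auto
      obtain r' d where d: "(r', d) \<in> diagram b" "x = row_tableau b r' d"
        using row_tableau_cases[OF b x(1)] by blast
      have "A r c = r'" using D x rc d by fastforce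
      then show ?thesis using d x by blast
    qed
    then show ?C2 by blast
  qed
  ultimately show ?thesis by blast
qed

text \<open>The p satisfying the entry equation exist because A has content b, and they are stable
  under left multiplication by W_b, so there is a minimal one. It is unique because it sends row i
  of t^b increasingly onto the positions of i in A.\<close>

lemma one_perm_properties:
  assumes a: "composition n a" and b: "composition n b" and A: "tableau_of_type a b A"
  shows "one_perm n a b A permutes {1..n}"
    and "\<And>x. x \<in> {1..n} \<Longrightarrow> entry_of a A (one_perm n a b A x) = row_of b x"
proof -
  let ?P = "\<lambda>p. p permutes {1..n} \<and> left_minimal n (row_of b) p \<and>
    (\<forall>x \<in> {1..n}. entry_of a A (p x) = row_of b x)"
  have P: "one_perm n a b A = (THE p. ?P p)"
    unfolding one_perm_def using one_perm_predicate_iff[OF a b] by (intro arg_cong[of _ _ The] ext) blast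
  let ?D = "{p. p permutes {1..n} \<and> (\<forall>x \<in> {1..n}. entry_of a A (p x) = row_of b x)}"
  have closed: "v \<cdot>\<^sub>p p \<in> ?D" if p: "p \<in> ?D" and v: "v \<in> block_group n (row_of b)" for p v
  proof -
    have vp: "v permutes {1..n}" and r: "\<And>x. x \<in> {1..n} \<Longrightarrow> row_of b (v x) = row_of b x"
      using v unfolding block_group_def by blast+
    have "entry_of a A ((v \<cdot>\<^sub>p p) x) = row_of b x" if x: "x \<in> {1..n}" for x
    proof -
      have "v x \<in> {1..n}" using permutes_in_image[OF vp, of x] x by simp
      then have "entry_of a A (p (v x)) = row_of b (v x)" using p by blast
      then show ?thesis using r[OF x] by (simp add: perm_prod_apply)
    qed
    then show ?thesis using perm_prod_permutes[OF vp, of p] p by blast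
  qed
  have "\<exists>!p. ?P p"
  proof -
    obtain p0 where p0: "p0 permutes {1..n}" "\<forall>x \<in> {1..n}. row_of b x = entry_of a A (p0 x)"
      using exists_permutes_fibres[of "{1..n}" "row_of b" "entry_of a A"] card_entry_of_type[OF a b A]
      by auto
    have bij: "bij_betw (\<lambda>(v, d). v \<cdot>\<^sub>p d)
        (block_group n (row_of b) \<times> {d \<in> ?D. left_minimal n (row_of b) d}) ?D"
      by (rule bij_betw_left_cosets) (use closed in blast)+
    have "p0 \<in> ?D" using p0 by simp
    then have "p0 \<in> (\<lambda>(v, d). v \<cdot>\<^sub>p d) `
        (block_group n (row_of b) \<times> {d \<in> ?D. left_minimal n (row_of b) d})"
      by (simp only: bij_betw_imp_surj_on[OF bij])
    then obtain d where d: "?P d" by auto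
    have "e = d" if e: "?P e" for e
    proof (rule permutes_eqI[of _ "{1..n}"])
      show "e permutes {1..n}" "d permutes {1..n}" using e d by blast+
      fix x assume x: "x \<in> {1..n}"
      have im: "g ` {y \<in> {1..n}. row_of b y = row_of b x} = {y \<in> {1..n}. entry_of a A y = row_of b x}"
        if g: "?P g" for g
      proof (intro equalityI subsetI)
        fix z assume "z \<in> g ` {y \<in> {1..n}. row_of b y = row_of b x}"
        then obtain y where y: "y \<in> {1..n}" "row_of b y = row_of b x" "z = g y" by blast
        then show "z \<in> {y \<in> {1..n}. entry_of a A y = row_of b x}"
          using g permutes_in_image[of g "{1..n}" y] by auto
      next
        fix z assume z: "z \<in> {y \<in> {1..n}. entry_of a A y = row_of b x}"
        then have "z \<in> g ` {1..n}" using permutes_image[of g "{1..n}"] g by simp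
        then obtain y where y: "y \<in> {1..n}" "z = g y" by blast
        then have "row_of b y = row_of b x" using g z by auto
        then show "z \<in> g ` {y \<in> {1..n}. row_of b y = row_of b x}" using y by blast
      qed
      show "e x = d x"
      proof (rule strict_mono_on_unique[where g = e and h = d and x = x and
            B = "{y \<in> {1..n}. row_of b y = row_of b x}"])
        show "e ` {y \<in> {1..n}. row_of b y = row_of b x} = d ` {y \<in> {1..n}. row_of b y = row_of b x}"
          using im[OF e] im[OF d] by simp
      qed (use x e d in \<open>auto simp: left_minimal_def\<close>)
    qed
    then show ?thesis using d by blast
  qed
  from theI'[OF this] have *: "?P (one_perm n a b A)" unfolding P .
  then show "one_perm n a b A permutes {1..n}" by blast
  show "entry_of a A (one_perm n a b A x) = row_of b x" if "x \<in> {1..n}" for x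
    using * that by blast
qed

lemma card_permutes_fibre:
  assumes "u permutes {1..n::nat}"
  shows "card {x \<in> {1..n}. P (u x)} = card {x \<in> {1..n}. P x}"
proof -
  have "u ` {x \<in> {1..n}. P (u x)} = {x \<in> {1..n}. P x}"
  proof (intro equalityI subsetI)
    fix z assume z: "z \<in> {x \<in> {1..n}. P x}"
    then have "z \<in> u ` {1..n}" using permutes_image[OF assms] by simp
    then show "z \<in> u ` {x \<in> {1..n}. P (u x)}" using z by blast
  next
    fix z assume "z \<in> u ` {x \<in> {1..n}. P (u x)}"
    then obtain x where "x \<in> {1..n}" "P (u x)" "z = u x" by blast
    then show "z \<in> {x \<in> {1..n}. P x}" using permutes_in_image[OF assms, of x] by simp
  qed
  moreover have "card (u ` {x \<in> {1..n}. P (u x)}) = card {x \<in> {1..n}. P (u x)}"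
    by (rule card_image[OF inj_on_subset[OF permutes_inj[OF assms]]]) simp
  ultimately show ?thesis by simp
qed

text \<open>The row groups can rearrange points freely within rows, so all that survives of w is the
  matrix counting how many points of each row of t^b go to each row of t^a.\<close>

lemma double_coset_eq:
  assumes a: "composition n a" and b: "composition n b" and p: "p permutes {1..n}"
  shows "double_coset n b p a = {w. w permutes {1..n} \<and> (\<forall>i j.
    card {x \<in> {1..n}. row_of b x = i \<and> row_of a (w x) = j}
      = card {x \<in> {1..n}. row_of b x = i \<and> row_of a (p x) = j})}" (is "_ = ?R")
proof (intro equalityI subsetI)
  fix w assume "w \<in> double_coset n b p a"
  then obtain u v where uv: "u \<in> block_group n (row_of b)" "v \<in> block_group n (row_of a)"
    "w = u \<cdot>\<^sub>p p \<cdot>\<^sub>p v"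
    unfolding double_coset_def young_subgroup_block_group[OF a] young_subgroup_block_group[OF b]
    by blast
  have up: "u permutes {1..n}" and ru: "\<And>x. x \<in> {1..n} \<Longrightarrow> row_of b (u x) = row_of b x"
    and vp: "v permutes {1..n}" and rv: "\<And>x. x \<in> {1..n} \<Longrightarrow> row_of a (v x) = row_of a x"
    using uv unfolding block_group_def by blast+
  have wp: "w permutes {1..n}"
    unfolding uv(3) by (intro perm_prod_permutes up vp p)
  have "{x \<in> {1..n}. row_of b x = i \<and> row_of a (w x) = j}
    = {x \<in> {1..n}. row_of b (u x) = i \<and> row_of a (p (u x)) = j}" for i j
  proof (rule Collect_cong, rule conj_cong[OF refl])
    fix x assume x: "x \<in> {1..n}"
    then have "p (u x) \<in> {1..n}"
      using permutes_in_image[OF up, of x] permutes_in_image[OF p, of "u x"] by simp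
    then show "(row_of b x = i \<and> row_of a (w x) = j) = (row_of b (u x) = i \<and> row_of a (p (u x)) = j)"
      using ru[OF x] rv by (simp add: uv(3) perm_prod_apply)
  qed
  then have "card {x \<in> {1..n}. row_of b x = i \<and> row_of a (w x) = j}
      = card {x \<in> {1..n}. row_of b x = i \<and> row_of a (p x) = j}" for i j
    using card_permutes_fibre[OF up, of "\<lambda>y. row_of b y = i \<and> row_of a (p y) = j"] by simp
  then show "w \<in> ?R" using wp by blast
next
  fix w assume w: "w \<in> ?R"
  then have wp: "w permutes {1..n}" by blast
  \<comment> \<open>Matching points by the pair (row in t^b, row of the image in t^a) makes u
    preserve the rows of t^b. The second components then say that the remaining factor v, with w = u
    p v, preserves the rows of t^a.\<close>
  have "\<exists>u. u permutes {1..n} \<and>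
      (\<forall>x \<in> {1..n}. (row_of b x, row_of a (w x)) = (\<lambda>x. (row_of b x, row_of a (p x))) (u x))"
  proof (rule exists_permutes_fibres)
    fix ij :: "nat \<times> nat"
    show "card {x \<in> {1..n}. (row_of b x, row_of a (w x)) = ij}
        = card {x \<in> {1..n}. (row_of b x, row_of a (p x)) = ij}"
      using w by (cases ij) simp
  qed simp
  then obtain u where up: "u permutes {1..n}"
    and u: "\<And>x. x \<in> {1..n} \<Longrightarrow> row_of b x = row_of b (u x) \<and> row_of a (w x) = row_of a (p (u x))"
    by auto
  define s where "s = u \<cdot>\<^sub>p p"
  have sp: "s permutes {1..n}" unfolding s_def by (intro perm_prod_permutes up p)
  define v where "v = w \<circ> inv_into UNIV s"
  have vs: "v (s x) = w x" for x
    unfolding v_def using permutes_inverses(2)[OF sp] by simp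
  have vp: "v permutes {1..n}"
    unfolding v_def by (rule permutes_compose[OF permutes_inv[OF sp] wp])
  have "row_of a (v y) = row_of a y" if y: "y \<in> {1..n}" for y
  proof -
    have "y \<in> s ` {1..n}" using y permutes_image[OF sp] by simp
    then obtain x where "x \<in> {1..n}" "y = s x" by blast
    then show ?thesis using u[of x] by (simp add: vs) (simp add: s_def perm_prod_apply)
  qed
  then have "v \<in> block_group n (row_of a)" using vp unfolding block_group_def by blast
  moreover have "u \<in> block_group n (row_of b)" using up u unfolding block_group_def by simp
  moreover have "w = u \<cdot>\<^sub>p p \<cdot>\<^sub>p v"
    by (simp add: fun_eq_iff perm_prod_apply flip: vs) (simp add: s_def perm_prod_apply)
  ultimately show "w \<in> double_coset n b p a"
    unfolding double_coset_def young_subgroup_block_group[OF a] young_subgroup_block_group[OF b]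
    by blast
qed

lemma double_coset_one_perm:
  assumes a: "composition n a" and b: "composition n b" and A: "tableau_of_type a b A"
  shows "double_coset n b (one_perm n a b A) a = {w. w permutes {1..n} \<and> (\<forall>i j.
    card {x \<in> {1..n}. row_of b x = i \<and> row_of a (w x) = j}
      = card {(r, c). (r, c) \<in> diagram a \<and> A r c = i \<and> r = j})}"
proof -
  let ?p = "one_perm n a b A"
  note p = one_perm_properties[OF a b A]
  have "card {x \<in> {1..n}. row_of b x = i \<and> row_of a (?p x) = j}
      = card {(r, c). (r, c) \<in> diagram a \<and> A r c = i \<and> r = j}" for i j
  proof -
    have "{x \<in> {1..n}. row_of b x = i \<and> row_of a (?p x) = j}
        = {x \<in> {1..n}. entry_of a A (?p x) = i \<and> row_of a (?p x) = j}"
      using p(2) by auto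
    then have "card {x \<in> {1..n}. row_of b x = i \<and> row_of a (?p x) = j}
        = card {x \<in> {1..n}. entry_of a A x = i \<and> row_of a x = j}"
      using card_permutes_fibre[OF p(1), of "\<lambda>y. entry_of a A y = i \<and> row_of a y = j"] by simp
    then show ?thesis using card_entry_of[OF a, of "\<lambda>r e. e = i \<and> r = j" A] by simp
  qed
  then show ?thesis unfolding double_coset_eq[OF a b p(1)] by simp
qed

lemma double_coset_perms:
  assumes "p permutes {1..n}"
  shows "double_coset n b p a \<subseteq> {w. w permutes {1..n}}"
  using assms by (auto simp: double_coset_def young_subgroup_def intro!: perm_prod_permutes)

section \<open>Existence and values of the homomorphisms\<close>

text \<open>Discharges the definite description in \<open>phi\<close>. Uniqueness holds because a
  right linear map on a cyclic module is determined by the image of the generator, its values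
  elsewhere being fixed by extensionality.\<close>

lemma phi_apply:
  assumes a: "composition n a" and b: "composition n b" and A: "tableau_of_type a b A"
    and h: "h \<in> carrier (hecke n q)"
  shows "phi n q a b A (x_elem n q a \<otimes>\<^bsub>hecke n q\<^esub> h)
    = hecke_sum n q 1 (double_coset n b (one_perm n a b A) a) \<otimes>\<^bsub>hecke n q\<^esub> h"
proof -
  let ?D = "double_coset n b (one_perm n a b A) a"
  let ?R = "hecke n q"
  let ?T = "hecke_sum n q 1 ?D" and ?x = "x_elem n q a"
  note p = one_perm_properties(1)[OF a b A]
  note D = double_coset_perms[OF p, of b a]
  have closed_right: "d \<cdot>\<^sub>p v \<in> ?D" if "d \<in> ?D" "v \<in> block_group n (row_of a)" for d v
    using that block_group_prod[of _ n "row_of a"]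
    unfolding double_coset_def young_subgroup_block_group[OF a] young_subgroup_block_group[OF b]
    by (auto simp: perm_prod_assoc) (metis perm_prod_assoc)
  have closed_left: "v \<cdot>\<^sub>p d \<in> ?D" if "d \<in> ?D" "v \<in> block_group n (row_of b)" for d v
    using that block_group_prod[of _ n "row_of b"]
    unfolding double_coset_def young_subgroup_block_group[OF a] young_subgroup_block_group[OF b]
    by (auto simp: perm_prod_assoc) (metis perm_prod_assoc)
  define H where "H = hecke_sum n q 1 {d \<in> ?D. right_minimal n (row_of a) d}"
  define K where "K = hecke_sum n q 1 {d \<in> ?D. left_minimal n (row_of b) d}"
  have H: "H \<in> carrier ?R" unfolding H_def by (rule hecke_sum_closed) (use D in blast)
  have K: "K \<in> carrier ?R" unfolding K_def by (rule hecke_sum_closed) (use D in blast)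
  have x: "?x \<in> carrier ?R" and xb: "x_elem n q b \<in> carrier ?R"
    unfolding x_elem_hecke_sum[OF a] x_elem_hecke_sum[OF b]
    by (intro hecke_sum_closed block_group_perms)+
  \<comment> \<open>The assignment x h \<mapsto> T h would have to be shown independent of h; with T
    = H x it is left multiplication by H, where nothing depends on h.\<close>
  have TH: "?T = H \<otimes>\<^bsub>?R\<^esub> ?x"
    unfolding H_def x_elem_hecke_sum[OF a]
    by (rule hecke_sum_right_cosets[where f = "row_of a", OF row_of_mono[OF a] D closed_right])
  \<comment> \<open>This second factorisation places the image inside M^b.\<close>
  have TK: "?T = x_elem n q b \<otimes>\<^bsub>?R\<^esub> K"
    unfolding K_def x_elem_hecke_sum[OF b]
    by (rule hecke_sum_left_cosets[where f = "row_of b", OF row_of_mono[OF b] D closed_left])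
  have M: "y \<in> perm_module n q a \<longleftrightarrow> (\<exists>h \<in> carrier ?R. y = ?x \<otimes>\<^bsub>?R\<^esub> h)" for y
    by (auto simp: perm_module_def cyclic_module_def)
  have xM: "?x \<in> perm_module n q a"
    unfolding M using x by (intro bexI[of _ "\<one>\<^bsub>?R\<^esub>"]) simp_all
  let ?f = "restrict (\<lambda>y. H \<otimes>\<^bsub>?R\<^esub> y) (perm_module n q a)"
  have MD: "?x \<otimes>\<^bsub>?R\<^esub> h \<in> perm_module n q a" if "h \<in> carrier ?R" for h
    unfolding M using that by blast
  have fx: "?f (?x \<otimes>\<^bsub>?R\<^esub> h) = ?T \<otimes>\<^bsub>?R\<^esub> h" if "h \<in> carrier ?R" for h
    using MD[OF that] that H x by (simp add: TH hecke.m_assoc)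
  have f: "?f \<in> right_hom n q (perm_module n q a) (perm_module n q b)"
    unfolding right_hom_def
  proof (intro CollectI conjI ballI)
    show "?f \<in> perm_module n q a \<rightarrow>\<^sub>E perm_module n q b"
    proof (rule PiE_I)
      fix y assume "y \<in> perm_module n q a"
      then obtain h where h: "h \<in> carrier ?R" "y = ?x \<otimes>\<^bsub>?R\<^esub> h" unfolding M by blast
      have "?f y = x_elem n q b \<otimes>\<^bsub>?R\<^esub> (K \<otimes>\<^bsub>?R\<^esub> h)"
        using h K xb unfolding h(2) fx[OF h(1)] TK by (simp add: hecke.m_assoc)
      then show "?f y \<in> perm_module n q b"
        using h K unfolding perm_module_def cyclic_module_def by blast
    qed simp
    fix y assume "y \<in> perm_module n q a"
    then obtain h where h: "h \<in> carrier ?R" "y = ?x \<otimes>\<^bsub>?R\<^esub> h" unfolding M by blast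
    show "?f (y \<otimes>\<^bsub>?R\<^esub> h') = ?f y \<otimes>\<^bsub>?R\<^esub> h'" if h': "h' \<in> carrier ?R" for h'
    proof -
      have "y \<otimes>\<^bsub>?R\<^esub> h' = ?x \<otimes>\<^bsub>?R\<^esub> (h \<otimes>\<^bsub>?R\<^esub> h')"
        using h h' x by (simp add: hecke.m_assoc)
      then have "?f (y \<otimes>\<^bsub>?R\<^esub> h') = ?T \<otimes>\<^bsub>?R\<^esub> (h \<otimes>\<^bsub>?R\<^esub> h')"
        using fx[of "h \<otimes>\<^bsub>?R\<^esub> h'"] h h' by simp
      then show ?thesis
        using h h' H x unfolding h(2) fx[OF h(1)] by (simp add: TH hecke.m_assoc)
    qed
    fix z assume "z \<in> perm_module n q a"
    then obtain g where g: "g \<in> carrier ?R" "z = ?x \<otimes>\<^bsub>?R\<^esub> g" unfolding M by blast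
    have "y \<oplus>\<^bsub>?R\<^esub> z = ?x \<otimes>\<^bsub>?R\<^esub> (h \<oplus>\<^bsub>?R\<^esub> g)"
      using h g x by (simp add: hecke.r_distr)
    then have "?f (y \<oplus>\<^bsub>?R\<^esub> z) = ?T \<otimes>\<^bsub>?R\<^esub> (h \<oplus>\<^bsub>?R\<^esub> g)"
      using fx[of "h \<oplus>\<^bsub>?R\<^esub> g"] h g by simp
    then show "?f (y \<oplus>\<^bsub>?R\<^esub> z) = ?f y \<oplus>\<^bsub>?R\<^esub> ?f z"
      using h g H x unfolding h(2) g(2) fx[OF h(1)] fx[OF g(1)] by (simp add: TH hecke.r_distr)
  qed
  have fT: "?f ?x = ?T" using fx[of "\<one>\<^bsub>?R\<^esub>"] x H by (simp add: TH)
  have T: "(\<Oplus>\<^bsub>?R\<^esub>w \<in> ?D. hecke_T n q w) = ?T" by (rule hecke_sum_one[OF D, symmetric])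
  have "phi n q a b A = ?f"
    unfolding phi_def T
  proof (rule the_equality)
    show "?f \<in> right_hom n q (perm_module n q a) (perm_module n q b) \<and> ?f ?x = ?T"
      using f fT by blast
    fix g assume g: "g \<in> right_hom n q (perm_module n q a) (perm_module n q b) \<and> g ?x = ?T"
    show "g = ?f"
    proof
      fix y
      show "g y = ?f y"
      proof (cases "y \<in> perm_module n q a")
        case True
        then obtain h where h: "h \<in> carrier ?R" "y = ?x \<otimes>\<^bsub>?R\<^esub> h" unfolding M by blast
        have "g y = g ?x \<otimes>\<^bsub>?R\<^esub> h"
          using g xM h unfolding right_hom_def by blast
        then show ?thesis using g unfolding h(2) fx[OF h(1)] by simp
      next
        case False
        then show ?thesis using g unfolding right_hom_def by (auto simp: PiE_def extensional_def)
      qed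
    qed
  qed
  then show ?thesis using fx[OF h] by simp
qed

section \<open>Deleting the first row\<close>

lemma diagram_drop_part: "(r, c) \<in> diagram (drop_part a) \<longleftrightarrow> 1 \<le> r \<and> (r + 1, c) \<in> diagram a"
  by (auto simp: diagram_def drop_part_def)

lemma row_tableau_drop_part:
  assumes "1 \<le> r"
  shows "row_tableau a (r + 1) c = row_tableau (drop_part a) r c + a 1"
proof -
  have "(\<Sum>j = 1..<r + 1. a j) = a 1 + (\<Sum>j = Suc 1..<Suc r. a j)"
    by (subst sum.atLeast_Suc_lessThan) (use assms in auto)
  also have "(\<Sum>j = Suc 1..<Suc r. a j) = (\<Sum>j = 1..<r. drop_part a j)"
    unfolding sum.shift_bounds_Suc_ivl by (intro sum.cong) (auto simp: drop_part_def)
  finally show ?thesis by (simp add: row_tableau_def)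
qed

lemma composition_drop_part:
  assumes "composition n a"
  shows "composition (n - a 1) (drop_part a)" "a 1 \<le> n"
proof -
  obtain N where N: "\<And>i. N \<le> i \<Longrightarrow> a i = 0" "a 0 = 0" "(\<Sum>j = 1..<N. a j) = n" "1 \<le> N"
    using compositionD[OF assms] by metis
  have fin: "finite (diagram a)"
    using bij_betw_finite[OF bij_betw_row_tableau[OF assms]] by simp
  have split_diagram: "diagram a = Pair 1 ` {1..a 1} \<union> (\<lambda>(r, c). (r + 1, c)) ` diagram (drop_part a)"
  proof (intro equalityI subsetI)
    fix p assume "p \<in> diagram a"
    then obtain r c where p: "p = (r, c)" "(r, c) \<in> diagram a" by (cases p) auto
    show "p \<in> Pair 1 ` {1..a 1} \<union> (\<lambda>(r, c). (r + 1, c)) ` diagram (drop_part a)"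
    proof (cases "r = 1")
      case True
      then show ?thesis using p by (auto simp: diagram_def)
    next
      case False
      then have "(r - 1, c) \<in> diagram (drop_part a)" "p = (r - 1 + 1, c)"
        using p by (auto simp: diagram_def drop_part_def)
      then show ?thesis by (intro UnI2 rev_image_eqI[of "(r - 1, c)"]) auto
    qed
  qed (auto simp: diagram_def drop_part_def split: if_splits)
  have "card (diagram a) = card (Pair (1::nat) ` {1..a 1}) + card ((\<lambda>(r, c). (r + 1, c)) ` diagram (drop_part a))"
    unfolding split_diagram using fin[unfolded split_diagram]
    by (intro card_Un_disjoint) (auto simp: diagram_def)
  moreover have "card (Pair (1::nat) ` {1..a 1}) = a 1"
    by (subst card_image) (auto simp: inj_on_def)
  moreover have "card ((\<lambda>(r, c). (r + 1, c)) ` diagram (drop_part a)) = card (diagram (drop_part a))"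
    by (rule card_image) (auto simp: inj_on_def)
  moreover have "card (diagram a) = n" using assms composition_iff by blast
  ultimately have card: "n = a 1 + card (diagram (drop_part a))" by simp
  then show "a 1 \<le> n" by simp
  have "{i. drop_part a i \<noteq> 0} \<subseteq> {..<N}"
  proof (intro subsetI, rule ccontr)
    fix i assume i: "i \<in> {i. drop_part a i \<noteq> 0}" and "i \<notin> {..<N}"
    then have "N \<le> i + 1" by simp
    then show False using i N(1)[of "i + 1"] by (simp add: drop_part_def split: if_splits)
  qed
  then have "finite {i. drop_part a i \<noteq> 0}" by (rule finite_subset) simp
  moreover have "drop_part a 0 = 0" by (simp add: drop_part_def)
  ultimately show "composition (n - a 1) (drop_part a)"
    unfolding composition_iff using card by simp
qed

lemma row_of_first:
  assumes "1 \<le> x" "x \<le> a 1"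
  shows "row_of a x = 1"
proof -
  have "(1, x) \<in> diagram a" "row_tableau a 1 x = x"
    using assms by (auto simp: diagram_def row_tableau_def)
  then show ?thesis using row_of_row_tableau[of 1 x a] by simp
qed

lemma row_of_drop_part:
  assumes "composition n a" "y \<in> {1..n - a 1}"
  shows "row_of a (y + a 1) = row_of (drop_part a) y + 1"
proof -
  obtain r c where rc: "(r, c) \<in> diagram (drop_part a)" "y = row_tableau (drop_part a) r c"
    using row_tableau_cases[OF composition_drop_part(1)[OF assms(1)] assms(2)] by blast
  then have r: "(r + 1, c) \<in> diagram a" "1 \<le> r" by (auto simp: diagram_drop_part)
  have "row_of a (row_tableau (drop_part a) r c + a 1) = r + 1"
    using row_of_row_tableau[OF r(1)] unfolding row_tableau_drop_part[OF r(2)] .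
  then show ?thesis using rc by simp
qed

text \<open>The type of a truncated tableau is given only as a count of occurrences. Counting boxes
  by entry gives its size, and positivity of the entries gives the normalisation at index 0.\<close>

lemma composition_tableau_type:
  assumes a: "composition n a" and pos: "\<And>r c. (r, c) \<in> diagram a \<Longrightarrow> 1 \<le> A r c"
  shows "composition n (tableau_type a A)"
  unfolding composition_def
proof (intro conjI)
  let ?A = "\<lambda>(r, c). A r c"
  have fin: "finite (diagram a)" and card: "card (diagram a) = n"
    using bij_betw_finite[OF bij_betw_row_tableau[OF a]] a by (simp_all add: composition_iff)
  have t: "tableau_type a A i = card {p \<in> diagram a. ?A p = i}" for i
    unfolding tableau_type_def by (intro arg_cong[of _ _ card]) auto
  have sub: "{i. tableau_type a A i \<noteq> 0} = ?A ` diagram a"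
    unfolding t using fin by (auto simp: card_eq_0_iff)
  show "finite {i. tableau_type a A i \<noteq> 0}" unfolding sub using fin by simp
  show "tableau_type a A 0 = 0"
    using pos unfolding t by (fastforce simp: card_eq_0_iff)
  have "(\<Sum>i \<in> ?A ` diagram a. tableau_type a A i)
      = (\<Sum>i \<in> ?A ` diagram a. \<Sum>p \<in> {p \<in> diagram a. ?A p = i}. 1)"
    unfolding t by simp
  also have "\<dots> = (\<Sum>p \<in> diagram a. 1)"
    using fin by (intro sum.group) auto
  finally show "(\<Sum>i | tableau_type a A i \<noteq> 0. tableau_type a A i) = n"
    unfolding sub using card by simp
qed

lemma tableau_of_type_drop_row:
  assumes "tableau_of_type a b A"
  shows "tableau_of_type (drop_part a) (tableau_type (drop_part a) (drop_row A)) (drop_row A)"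
  using assms by (auto simp: tableau_of_type_def drop_row_def diagram_drop_part)

lemma composition_drop_row_type:
  assumes "composition n a" "tableau_of_type a b A"
  shows "composition (n - a 1) (tableau_type (drop_part a) (drop_row A))"
  using tableau_of_type_drop_row[OF assms(2)]
  by (intro composition_tableau_type[OF composition_drop_part(1)[OF assms(1)]])
    (auto simp: tableau_of_type_def)

text \<open>The function min x (m + 1) separates the points 1, ..., m from everything else and
  identifies all later ones, so its stabiliser moves only points beyond m. It is the monotone
  function describing the embedded smaller symmetric group.\<close>

lemma block_group_min:
  assumes "m \<le> n"
  shows "block_group n (\<lambda>x. min x (m + 1)) = shift_perm m ` {v. v permutes {1..n - m}}"
proof (intro equalityI subsetI)
  let ?k = "n - m"
  fix v assume "v \<in> block_group n (\<lambda>x. min x (m + 1))"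
  then have vp: "v permutes {1..n}" and f: "\<And>x. x \<in> {1..n} \<Longrightarrow> min (v x) (m + 1) = min x (m + 1)"
    unfolding block_group_def by blast+
  have small: "v x = x" if "x \<le> m" for x
  proof (cases "x = 0")
    case True
    then show ?thesis using permutes_not_in[OF vp, of x] by simp
  next
    case False
    then show ?thesis using f[of x] that assms by (auto simp: min_def split: if_splits)
  qed
  have big: "v (y + m) - m \<in> {1..?k}" "m < v (y + m)" if y: "y \<in> {1..?k}" for y
  proof -
    have y': "y + m \<in> {1..n}" using y assms by auto
    then have "v (y + m) \<le> n" using permutes_le[OF vp, of "y + m"] by simp
    moreover show "m < v (y + m)" using f[OF y'] y by (auto simp: min_def split: if_splits)
    ultimately show "v (y + m) - m \<in> {1..?k}" by auto
  qed
  define t where "t y = (if y \<in> {1..?k} then v (y + m) - m else y)" for y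
  have "inj_on t {1..?k}"
  proof (rule inj_onI)
    fix x y assume xy: "x \<in> {1..?k}" "y \<in> {1..?k}" "t x = t y"
    then have "v (x + m) - m = v (y + m) - m" by (simp add: t_def)
    then have "v (x + m) = v (y + m)" using big(2)[OF xy(1)] big(2)[OF xy(2)] by linarith
    then show "x = y" using inj_eq[OF permutes_inj[OF vp]] by simp
  qed
  moreover have "t ` {1..?k} \<subseteq> {1..?k}" using big(1) by (auto simp: t_def)
  ultimately have "bij_betw t {1..?k} {1..?k}"
    using endo_inj_surj[of "{1..?k}" t] by (simp add: bij_betw_def)
  then have tp: "t permutes {1..?k}" by (rule bij_imp_permutes) (auto simp: t_def)
  have "v = shift_perm m t"
  proof
    fix x
    consider "x \<le> m" | "m < x" "x \<le> n" | "n < x" by linarith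
    then show "v x = shift_perm m t x"
    proof cases
      case 1
      then show ?thesis by (simp add: shift_perm_def small)
    next
      case 2
      then have x: "x - m \<in> {1..?k}" by auto
      then show ?thesis using big(2)[OF x] 2 by (simp add: shift_perm_def t_def)
    next
      case 3
      then have "x - m \<notin> {1..?k}" using assms by auto
      then show ?thesis
        using 3 assms permutes_not_in[OF vp, of x] by (simp add: shift_perm_def t_def)
    qed
  qed
  then show "v \<in> shift_perm m ` {v. v permutes {1..?k}}" using tp by blast
next
  fix v assume "v \<in> shift_perm m ` {v. v permutes {1..n - m}}"
  then obtain t where t: "t permutes {1..n - m}" "v = shift_perm m t" by blast
  have "min (shift_perm m t x) (m + 1) = min x (m + 1)" if "x \<in> {1..n}" for x
  proof (cases "x \<le> m")
    case False
    then have "0 < t (x - m)" by (intro permutes_pos[OF t(1)]) simp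
    then show ?thesis using False by (simp add: shift_perm_def)
  qed (simp add: shift_perm_def)
  then show "v \<in> block_group n (\<lambda>x. min x (m + 1))"
    using shift_perm_permutes[OF t(1), of m n] assms unfolding block_group_def t(2) by simp
qed

text \<open>
  The left factor of the double coset of \<open>A\<close>. Since it sees \<open>A\<close> only through the content
  \<open>nu\<close> of the first row, it is common to all the tableaux in the theorem.
\<close>

definition first_row_reps :: "nat \<Rightarrow> nat \<Rightarrow> (nat \<Rightarrow> nat) \<Rightarrow> (nat \<Rightarrow> nat) \<Rightarrow> (nat \<Rightarrow> nat) set" where
  "first_row_reps n m b nu = {g. g permutes {1..n} \<and> right_minimal n (\<lambda>x. min x (m + 1)) g \<and>
     (\<forall>i. card {x \<in> {1..n}. row_of b x = i \<and> g x \<le> m} = nu i)}"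

lemma row_of_permutes_nonzero:
  assumes "composition n a" "u permutes {1..n}" "x \<in> {1..n}"
  shows "row_of a (u x) \<noteq> 0"
  using row_of_pos[OF assms(1), of "u x"] permutes_in_image[OF assms(2), of x] assms(3) by simp

text \<open>Needed to see that row i of t^b, once the points sent into the first row of t^a are
  removed, has as many points left as the truncated type prescribes.\<close>

lemma card_row_content_split:
  assumes a: "composition n a" and b: "composition n b" and A: "tableau_of_type a b A"
  shows "card {x \<in> {1..n}. row_of b x = i}
    = card {c \<in> {1..a 1}. A 1 c = i} + tableau_type (drop_part a) (drop_row A) i"
proof -
  have fin: "finite (diagram a)"
    using bij_betw_finite[OF bij_betw_row_tableau[OF a]] by simp
  have "card {x \<in> {1..n}. row_of b x = i} = card {y \<in> {1..n}. entry_of a A y = i}"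
    by (rule card_entry_of_type[OF a b A, symmetric])
  also have "\<dots> = card {(r, c). (r, c) \<in> diagram a \<and> A r c = i}"
    by (rule card_entry_of[OF a])
  also have "{(r, c). (r, c) \<in> diagram a \<and> A r c = i}
      = Pair 1 ` {c \<in> {1..a 1}. A 1 c = i}
        \<union> (\<lambda>(r, c). (r + 1, c)) ` {(r, c). (r, c) \<in> diagram (drop_part a) \<and> drop_row A r c = i}"
    (is "?L = ?R1 \<union> ?R2")
  proof (intro equalityI subsetI)
    fix p assume "p \<in> ?L"
    then obtain r c where p: "p = (r, c)" "(r, c) \<in> diagram a" "A r c = i" by auto
    show "p \<in> ?R1 \<union> ?R2"
    proof (cases "r = 1")
      case True
      then show ?thesis using p by (auto simp: diagram_def)
    next
      case False
      then have "(r - 1, c) \<in> diagram (drop_part a)" "drop_row A (r - 1) c = i" "r = r - 1 + 1"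
        using p by (auto simp: diagram_def drop_part_def drop_row_def)
      then show ?thesis using p(1) by (intro UnI2 rev_image_eqI[of "(r - 1, c)"]) auto
    qed
  qed (auto simp: diagram_def drop_part_def drop_row_def split: if_splits)
  also have "card (?R1 \<union> ?R2) = card ?R1 + card ?R2"
  proof (rule card_Un_disjoint)
    have "{(r, c). (r, c) \<in> diagram (drop_part a) \<and> drop_row A r c = i} \<subseteq> diagram (drop_part a)"
      by auto
    moreover have "finite (diagram (drop_part a))"
      using bij_betw_finite[OF bij_betw_row_tableau[OF composition_drop_part(1)[OF a]]] by simp
    ultimately show "finite ?R2" by (meson finite_imageI finite_subset)
  qed (auto simp: diagram_def)
  also have "card ?R1 = card {c \<in> {1..a 1}. A 1 c = i}"
    by (rule card_image) (auto simp: inj_on_def)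
  also have "card ?R2 = tableau_type (drop_part a) (drop_row A) i"
    unfolding tableau_type_def by (rule card_image) (auto simp: inj_on_def)
  finally show ?thesis .
qed

section \<open>Factorisation of the double coset sum\<close>

context
  fixes n :: nat and a b :: "nat \<Rightarrow> nat" and A :: tableau
  assumes a: "composition n a" and b: "composition n b" and A: "tableau_of_type a b A"
begin

private abbreviation (input) "m \<equiv> a 1"
private abbreviation (input) "k \<equiv> n - a 1"
private abbreviation (input) "a' \<equiv> drop_part a"
private abbreviation (input) "A' \<equiv> drop_row A"
private abbreviation (input) "b' \<equiv> tableau_type a' A'"
private abbreviation (input) "nu \<equiv> \<lambda>i. card {c \<in> {1..a 1}. A 1 c = i}"
private abbreviation (input) "D \<equiv> double_coset n b (one_perm n a b A) a"
private abbreviation (input) "D' \<equiv> double_coset k b' (one_perm k a' b' A') a'"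

private lemma m_le: "m \<le> n" and a': "composition k a'" and b': "composition k b'"
  and A': "tableau_of_type a' b' A'"
  by (rule composition_drop_part[OF a] composition_drop_row_type[OF a A]
      tableau_of_type_drop_row[OF A])+

text \<open>Minimality makes the inverse of d increasing on the points beyond m, so the rows of b
  met in this order weakly increase. The content of the first row fixes how often each row is met. A
  sorted sequence with these multiplicities is the row function of the truncated type.\<close>

private lemma row_of_after_first_row:
  assumes d: "d \<in> first_row_reps n m b nu" and y: "y \<in> {1..k}"
  shows "row_of b (inv_into UNIV d (y + m)) = row_of b' y"
proof (rule mono_eq_of_fibres[where f = "\<lambda>y. row_of b (inv_into UNIV d (y + m))", OF _ _ _ y])
  have dp: "d permutes {1..n}" and dmin: "right_minimal n (\<lambda>x. min x (m + 1)) d"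
    and dnu: "\<And>i. card {x \<in> {1..n}. row_of b x = i \<and> d x \<le> m} = nu i"
    using d unfolding first_row_reps_def by blast+
  let ?e = "\<lambda>y. inv_into UNIV d (y + m)"
  have e: "?e y \<in> {1..n}" "d (?e y) = y + m" if "y \<in> {1..k}" for y
  proof -
    have "y + m \<in> {1..n}" using that m_le by auto
    then show "?e y \<in> {1..n}" using permutes_in_image[OF permutes_inv[OF dp]] by simp
    show "d (?e y) = y + m" using permutes_inverses(1)[OF dp] by simp
  qed
  show "row_of b (?e x) \<le> row_of b (?e y)" if "x \<in> {1..k}" "y \<in> {1..k}" "x \<le> y" for x y
  proof (rule row_of_mono[OF b e(1)[OF that(1)] e(1)[OF that(2)]], rule ccontr)
    assume "\<not> ?e x \<le> ?e y"
    then have "d (?e y) < d (?e x)"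
      using dmin[unfolded right_minimal_def, rule_format, OF e(1)[OF that(2)] e(1)[OF that(1)]]
        e(2)[OF that(1)] e(2)[OF that(2)] that by simp
    then show False using e(2)[OF that(1)] e(2)[OF that(2)] that(3) by simp
  qed
  show "row_of b' x \<le> row_of b' y" if "x \<in> {1..k}" "y \<in> {1..k}" "x \<le> y" for x y
    by (rule row_of_mono[OF b' that])
  show "card {y \<in> {1..k}. row_of b (?e y) = i} = card {y \<in> {1..k}. row_of b' y = i}" for i
  proof -
    have img: "?e ` {y \<in> {1..k}. row_of b (?e y) = i} = {x \<in> {1..n}. row_of b x = i \<and> \<not> d x \<le> m}"
    proof (intro equalityI subsetI)
      fix x assume "x \<in> ?e ` {y \<in> {1..k}. row_of b (?e y) = i}"
      then obtain y where y: "y \<in> {1..k}" "row_of b (?e y) = i" "x = ?e y" by blast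
      then show "x \<in> {x \<in> {1..n}. row_of b x = i \<and> \<not> d x \<le> m}"
        using e[OF y(1)] y(1) by simp
    next
      fix x assume x: "x \<in> {x \<in> {1..n}. row_of b x = i \<and> \<not> d x \<le> m}"
      then have "d x \<in> {1..n}" using permutes_in_image[OF dp, of x] by simp
      then have k: "d x - m \<in> {1..k}" using x by auto
      have "?e (d x - m) = x" using x permutes_inverses(2)[OF dp] by simp
      then show "x \<in> ?e ` {y \<in> {1..k}. row_of b (?e y) = i}"
        using k x by (intro rev_image_eqI[of "d x - m"]) auto
    qed
    have inj: "inj_on ?e {y \<in> {1..k}. row_of b (?e y) = i}"
      using inj_eq[OF permutes_inj[OF permutes_inv[OF dp]]] by (simp add: inj_on_def)
    have 1: "card {y \<in> {1..k}. row_of b (?e y) = i} = card {x \<in> {1..n}. row_of b x = i \<and> \<not> d x \<le> m}"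
      by (simp only: img[symmetric] card_image[OF inj])
    have "{x \<in> {1..n}. row_of b x = i}
        = {x \<in> {1..n}. row_of b x = i \<and> d x \<le> m} \<union> {x \<in> {1..n}. row_of b x = i \<and> \<not> d x \<le> m}"
      by auto
    then have "card {x \<in> {1..n}. row_of b x = i}
        = card {x \<in> {1..n}. row_of b x = i \<and> d x \<le> m} + card {x \<in> {1..n}. row_of b x = i \<and> \<not> d x \<le> m}"
      by (subst card_Un_disjoint[symmetric]) auto
    then have "card {x \<in> {1..n}. row_of b x = i \<and> \<not> d x \<le> m} = b' i"
      using card_row_content_split[OF a b A, of i] dnu[of i] by simp
    moreover have "card {y \<in> {1..k}. row_of b' y = i} = b' i"
    proof (cases "i = 0")
      case True
      have "b' 0 = 0" using b' by (simp add: composition_def)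
      moreover have "{y \<in> {1..k}. row_of b' y = 0} = {}" using row_of_pos[OF b'] by fastforce
      ultimately show ?thesis using True by (simp only: card.empty)
    next
      case False
      then show ?thesis by (intro card_row_of[OF b']) simp
    qed
    ultimately show ?thesis using 1 by simp
  qed
qed

private lemma row_of_prod_first:
  assumes "d permutes {1..n}" "v permutes {1..k}" "x \<in> {1..n}"
  shows "row_of a ((d \<cdot>\<^sub>p shift_perm m v) x) = 1 \<longleftrightarrow> d x \<le> m"
proof -
  have dx: "d x \<in> {1..n}" using permutes_in_image[OF assms(1), of x] assms(3) by simp
  show ?thesis
  proof (cases "d x \<le> m")
    case True
    then show ?thesis using dx row_of_first[of "d x" a] by (simp add: perm_prod_apply shift_perm_def)
  next
    case False
    then have y: "d x - m \<in> {1..k}" using dx by auto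
    then have "v (d x - m) \<in> {1..k}" using permutes_in_image[OF assms(2)] by blast
    then have "row_of a (v (d x - m) + m) = row_of a' (v (d x - m)) + 1"
      "1 \<le> row_of a' (v (d x - m))"
      using row_of_drop_part[OF a] row_of_pos[OF a'] by blast+
    then show ?thesis using False by (simp add: perm_prod_apply shift_perm_def)
  qed
qed

text \<open>Substitutes x = d^(-1)(y + m), which runs through exactly the points that the product
  does not send to the first row.\<close>

private lemma card_prod_later_rows:
  assumes d: "d permutes {1..n}" and v: "v permutes {1..k}"
    and dr: "\<And>y. y \<in> {1..k} \<Longrightarrow> row_of b (inv_into UNIV d (y + m)) = row_of b' y"
    and j: "1 \<le> j"
  shows "card {x \<in> {1..n}. row_of b x = i \<and> row_of a ((d \<cdot>\<^sub>p shift_perm m v) x) = j + 1}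
    = card {y \<in> {1..k}. row_of b' y = i \<and> row_of a' (v y) = j}"
proof -
  let ?e = "\<lambda>y. inv_into UNIV d (y + m)"
  have dv: "row_of a ((d \<cdot>\<^sub>p shift_perm m v) (?e y)) = row_of a' (v y) + 1" if y: "y \<in> {1..k}" for y
  proof -
    have "v y \<in> {1..k}" using permutes_in_image[OF v] y by blast
    then have "row_of a (v y + m) = row_of a' (v y) + 1" by (rule row_of_drop_part[OF a])
    moreover have "(d \<cdot>\<^sub>p shift_perm m v) (?e y) = v y + m"
      using y permutes_inverses(1)[OF d] by (simp add: perm_prod_apply shift_perm_def)
    ultimately show ?thesis by simp
  qed
  have img: "?e ` {y \<in> {1..k}. row_of b' y = i \<and> row_of a' (v y) = j}
      = {x \<in> {1..n}. row_of b x = i \<and> row_of a ((d \<cdot>\<^sub>p shift_perm m v) x) = j + 1}"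
  proof (intro equalityI subsetI)
    fix x assume "x \<in> ?e ` {y \<in> {1..k}. row_of b' y = i \<and> row_of a' (v y) = j}"
    then obtain y where y: "y \<in> {1..k}" "row_of b' y = i" "row_of a' (v y) = j" "x = ?e y" by blast
    have "y + m \<in> {1..n}" using y(1) m_le by auto
    then have "?e y \<in> {1..n}" using permutes_in_image[OF permutes_inv[OF d]] by simp
    then show "x \<in> {x \<in> {1..n}. row_of b x = i \<and> row_of a ((d \<cdot>\<^sub>p shift_perm m v) x) = j + 1}"
      using dv[OF y(1)] dr[OF y(1)] y by simp
  next
    fix x assume x: "x \<in> {x \<in> {1..n}. row_of b x = i \<and> row_of a ((d \<cdot>\<^sub>p shift_perm m v) x) = j + 1}"
    then have "\<not> d x \<le> m" using row_of_prod_first[OF d v, of x] j by auto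
    moreover have "d x \<in> {1..n}" using x permutes_in_image[OF d, of x] by simp
    ultimately have y: "d x - m \<in> {1..k}" and ex: "?e (d x - m) = x"
      using permutes_inverses(2)[OF d] by auto
    show "x \<in> ?e ` {y \<in> {1..k}. row_of b' y = i \<and> row_of a' (v y) = j}"
      using y ex dv[OF y] dr[OF y] x by (intro rev_image_eqI[of "d x - m"]) auto
  qed
  have inj: "inj_on ?e {y \<in> {1..k}. row_of b' y = i \<and> row_of a' (v y) = j}"
    using inj_eq[OF permutes_inj[OF permutes_inv[OF d]]] by (simp add: inj_on_def)
  show ?thesis by (simp only: img[symmetric] card_image[OF inj])
qed

private lemma row_content_simps:
  "card {(r, c). (r, c) \<in> diagram a \<and> A r c = i \<and> r = 1} = nu i"
  "1 \<le> j \<Longrightarrow> card {(r, c). (r, c) \<in> diagram a \<and> A r c = i \<and> r = j + 1}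
    = card {(r, c). (r, c) \<in> diagram a' \<and> A' r c = i \<and> r = j}"
proof -
  have "{(r, c). (r, c) \<in> diagram a \<and> A r c = i \<and> r = 1} = Pair 1 ` {c \<in> {1..a 1}. A 1 c = i}"
    by (auto simp: diagram_def)
  then show "card {(r, c). (r, c) \<in> diagram a \<and> A r c = i \<and> r = 1} = nu i"
    by (simp add: card_image inj_on_def)
  assume "1 \<le> j"
  then have "{(r, c). (r, c) \<in> diagram a \<and> A r c = i \<and> r = j + 1}
      = (\<lambda>(r, c). (r + 1, c)) ` {(r, c). (r, c) \<in> diagram a' \<and> A' r c = i \<and> r = j}"
    by (force simp: diagram_drop_part drop_row_def image_iff)
  moreover have "inj_on (\<lambda>(r, c). (r + 1, c)) {(r, c). (r, c) \<in> diagram a' \<and> A' r c = i \<and> r = j}"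
    by (auto simp: inj_on_def)
  ultimately show "card {(r, c). (r, c) \<in> diagram a \<and> A r c = i \<and> r = j + 1}
      = card {(r, c). (r, c) \<in> diagram a' \<and> A' r c = i \<and> r = j}"
    by (simp only: card_image)
qed

text \<open>The matrix of the product is compared with that of A column by column. Column 1 depends
  only on d and expresses membership in \<open>first_row_reps\<close>; given this, the later columns
  form the matrix of v relative to the truncated shapes.\<close>

private lemma prod_in_double_coset_iff:
  assumes d: "d permutes {1..n}" "right_minimal n (\<lambda>x. min x (m + 1)) d" and v: "v permutes {1..k}"
  shows "d \<cdot>\<^sub>p shift_perm m v \<in> D \<longleftrightarrow> d \<in> first_row_reps n m b nu \<and> v \<in> D'"
proof -
  let ?w = "d \<cdot>\<^sub>p shift_perm m v"
  let ?C = "\<lambda>i j. card {x \<in> {1..n}. row_of b x = i \<and> row_of a (?w x) = j}"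
  let ?N = "\<lambda>i j. card {(r, c). (r, c) \<in> diagram a \<and> A r c = i \<and> r = j}"
  let ?C' = "\<lambda>i j. card {y \<in> {1..k}. row_of b' y = i \<and> row_of a' (v y) = j}"
  let ?N' = "\<lambda>i j. card {(r, c). (r, c) \<in> diagram a' \<and> A' r c = i \<and> r = j}"
  have sv: "shift_perm m v permutes {1..n}" using v m_le by (intro shift_perm_permutes) auto
  have w: "?w permutes {1..n}" by (rule perm_prod_permutes[OF d(1) sv])
  \<comment> \<open>The column index ranges over all naturals while rows are numbered from 1, so
    index 0 contributes only zeros on both sides.\<close>
  have zero: "?C i 0 = 0" "?N i 0 = 0" "?C' i 0 = 0" "?N' i 0 = 0" for i
  proof -
    have "{x \<in> {1..n}. row_of b x = i \<and> row_of a (?w x) = 0} = {}"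
      using row_of_permutes_nonzero[OF a w] by blast
    then show "?C i 0 = 0" by (simp only: card.empty)
    have "{y \<in> {1..k}. row_of b' y = i \<and> row_of a' (v y) = 0} = {}"
      using row_of_permutes_nonzero[OF a' v] by blast
    then show "?C' i 0 = 0" by (simp only: card.empty)
    have "{(r, c). (r, c) \<in> diagram a \<and> A r c = i \<and> r = 0} = {}"
      "{(r, c). (r, c) \<in> diagram a' \<and> A' r c = i \<and> r = 0} = {}" by (auto simp: diagram_def)
    then show "?N i 0 = 0" "?N' i 0 = 0" by (simp_all only: card.empty)
  qed
  have first: "?C i 1 = card {x \<in> {1..n}. row_of b x = i \<and> d x \<le> m}" for i
    using row_of_prod_first[OF d(1) v] by (intro arg_cong[of _ _ card]) blast
  have G: "d \<in> first_row_reps n m b nu \<longleftrightarrow> (\<forall>i. ?C i 1 = ?N i 1)"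
    using d unfolding first_row_reps_def first row_content_simps(1) by blast
  have later: "?C i (j + 1) = ?C' i j \<and> ?N i (j + 1) = ?N' i j"
    if "d \<in> first_row_reps n m b nu" "1 \<le> j" for i j
    using card_prod_later_rows[OF d(1) v row_of_after_first_row[OF that(1)] that(2)]
      row_content_simps(2)[OF that(2)] by blast
  have "?w \<in> D \<longleftrightarrow> (\<forall>i j. ?C i j = ?N i j)"
    using w unfolding double_coset_one_perm[OF a b A] by blast
  also have "\<dots> \<longleftrightarrow> (\<forall>i. ?C i 1 = ?N i 1) \<and> (\<forall>i j. 1 \<le> j \<longrightarrow> ?C i (j + 1) = ?N i (j + 1))"
    (is "?X \<longleftrightarrow> ?Y")
  proof
    assume Y: ?Y
    show ?X
    proof (intro allI)
      fix i j :: nat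
      consider "j = 0" | "j = 1" | "1 \<le> j - 1" "j - 1 + 1 = j" by linarith
      then show "?C i j = ?N i j"
      proof cases
        case 1
        then show ?thesis using zero(1,2)[of i] by simp
      next
        case 2
        then show ?thesis using Y by blast
      next
        case 3
        have "?C i (j - 1 + 1) = ?N i (j - 1 + 1)" using Y 3(1) by blast
        then show ?thesis unfolding 3(2) .
      qed
    qed
  qed blast
  \<comment> \<open>The later columns can be rewritten only when the first one is right, since the
    rows of b seen beyond m depend on the content of the first row.\<close>
  also have "\<dots> \<longleftrightarrow> d \<in> first_row_reps n m b nu \<and> (\<forall>i j. 1 \<le> j \<longrightarrow> ?C' i j = ?N' i j)"
    unfolding G[symmetric]
  proof (intro conj_cong refl iff_allI imp_cong)
    fix i j :: nat assume "d \<in> first_row_reps n m b nu" "1 \<le> j"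
    from later[OF this, of i] show "(?C i (j + 1) = ?N i (j + 1)) = (?C' i j = ?N' i j)"
      by (elim conjE) (simp only:)
  qed
  also have "(\<forall>i j. 1 \<le> j \<longrightarrow> ?C' i j = ?N' i j) \<longleftrightarrow> (\<forall>i j. ?C' i j = ?N' i j)"
  proof (intro iffI allI impI)
    fix i j :: nat assume *: "\<forall>i j. 1 \<le> j \<longrightarrow> ?C' i j = ?N' i j"
    show "?C' i j = ?N' i j"
    proof (cases "j = 0")
      case True
      then show ?thesis using zero(3,4)[of i] by simp
    next
      case False
      then show ?thesis using * by simp
    qed
  qed blast
  also have "\<dots> \<longleftrightarrow> v \<in> D'"
    using v unfolding double_coset_one_perm[OF a' b' A'] by blast
  finally show ?thesis .
qed

lemma hecke_sum_double_coset_drop_row: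
  "hecke_sum n q 1 (double_coset n b (one_perm n a b A) a)
    = hecke_sum n q 1 (first_row_reps n (a 1) b (\<lambda>i. card {c \<in> {1..a 1}. A 1 c = i}))
      \<otimes>\<^bsub>hecke n q\<^esub> hecke_shift n (a 1) q
        (hecke_sum (n - a 1) q 1
          (double_coset (n - a 1) (tableau_type (drop_part a) (drop_row A))
            (one_perm (n - a 1) (drop_part a) (tableau_type (drop_part a) (drop_row A)) (drop_row A))
            (drop_part a)))"
proof -
  let ?f = "\<lambda>x. min x (m + 1)"
  let ?G = "first_row_reps n m b nu"
  let ?P = "{w. w permutes {1..n}}"
  note D' = double_coset_perms[OF one_perm_properties(1)[OF a' b' A'], of b' a']
  note D = double_coset_perms[OF one_perm_properties(1)[OF a b A], of b a]
  note bg = block_group_min[OF m_le]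
  have G: "?G \<subseteq> {d \<in> ?P. right_minimal n ?f d}" unfolding first_row_reps_def by blast
  have sD': "shift_perm m ` D' \<subseteq> block_group n ?f" unfolding bg using D' by blast
  \<comment> \<open>The coset bijection is taken on the whole symmetric group and then restricted,
    so injectivity comes for free and only the image has to be identified.\<close>
  have bij: "bij_betw (\<lambda>(d, v). d \<cdot>\<^sub>p v) ({d \<in> ?P. right_minimal n ?f d} \<times> block_group n ?f) ?P"
    by (rule bij_betw_right_cosets) (use perm_prod_permutes in \<open>auto simp: block_group_def\<close>)
  have "bij_betw (\<lambda>(d, v). d \<cdot>\<^sub>p v) (?G \<times> shift_perm m ` D') D"
  proof (rule bij_betw_subset[OF bij])
    show "?G \<times> shift_perm m ` D' \<subseteq> {d \<in> ?P. right_minimal n ?f d} \<times> block_group n ?f"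
      using G sD' by blast
    show "(\<lambda>(d, v). d \<cdot>\<^sub>p v) ` (?G \<times> shift_perm m ` D') = D"
    proof (intro equalityI subsetI)
      fix w assume "w \<in> (\<lambda>(d, v). d \<cdot>\<^sub>p v) ` (?G \<times> shift_perm m ` D')"
      then obtain d v where dv: "d \<in> ?G" "v \<in> D'" "w = d \<cdot>\<^sub>p shift_perm m v" by auto
      have "d permutes {1..n}" "right_minimal n ?f d" "v permutes {1..k}"
        using dv(1,2) G D' by blast+
      from prod_in_double_coset_iff[OF this] show "w \<in> D" using dv by blast
    next
      fix w assume w: "w \<in> D"
      then have "w \<in> (\<lambda>(d, v). d \<cdot>\<^sub>p v) ` ({d \<in> ?P. right_minimal n ?f d} \<times> block_group n ?f)"
        using D bij_betw_imp_surj_on[OF bij] by blast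
      then obtain d v where dv: "d permutes {1..n}" "right_minimal n ?f d" "v permutes {1..k}"
        "w = d \<cdot>\<^sub>p shift_perm m v"
        unfolding bg by auto
      then have "d \<in> ?G" "v \<in> D'" using prod_in_double_coset_iff[OF dv(1-3)] w by blast+
      then show "w \<in> (\<lambda>(d, v). d \<cdot>\<^sub>p v) ` (?G \<times> shift_perm m ` D')"
        using dv(4) by (intro rev_image_eqI[of "(d, shift_perm m v)"]) auto
    qed
  qed
  then have "hecke_sum n q 1 D = hecke_sum n q 1 ?G \<otimes>\<^bsub>hecke n q\<^esub> hecke_sum n q 1 (shift_perm m ` D')"
  proof (rule hecke_sum_factor[rotated -1])
    show "?G \<subseteq> ?P" using G by blast
    show "shift_perm m ` D' \<subseteq> ?P" using sD' block_group_perms by blast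
    show "reduced_pair n u v" if "u \<in> ?G" "v \<in> shift_perm m ` D'" for u v
      by (rule reduced_pair_right_minimal[where f = ?f]) (use that G sD' in auto)
  qed
  then show ?thesis
    using hecke_shift_sum[OF D', of m n q 1] m_le by simp
qed

end

section \<open>The generator of the Specht module\<close>

lemma downset_eq_atLeastAtMost:
  fixes S :: "nat set"
  assumes "finite S" "\<And>i. i \<in> S \<Longrightarrow> 1 \<le> i" "\<And>i j. i \<in> S \<Longrightarrow> 1 \<le> j \<Longrightarrow> j \<le> i \<Longrightarrow> j \<in> S"
  shows "S = {1..card S}"
proof (cases "S = {}")
  case False
  then have M: "Max S \<in> S" using assms(1) by simp
  have "S = {1..Max S}"
  proof (intro equalityI subsetI)
    fix i assume "i \<in> S"
    then show "i \<in> {1..Max S}" using assms(2)[of i] Max_ge[OF assms(1), of i] by simp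
  next
    fix i assume "i \<in> {1..Max S}"
    then show "i \<in> S" using assms(3)[OF M, of i] by simp
  qed
  then show ?thesis by (metis card_atLeastAtMost diff_Suc_1)
qed simp

lemma partition_antimono:
  assumes "is_partition n a" "1 \<le> i" "i \<le> j"
  shows "a j \<le> a i"
  using assms(3)
proof (induction j rule: dec_induct)
  case (step j)
  then have "a (j + 1) \<le> a j" using assms(1,2) unfolding is_partition_def by simp
  then show ?case using step by simp
qed simp

text \<open>In a partition the rows of length at least c form an initial segment, so counting them
  decides which rows they are.\<close>

lemma conjugate_le_iff:
  assumes "is_partition n a" "1 \<le> r" "1 \<le> c"
  shows "r \<le> conjugate a c \<longleftrightarrow> c \<le> a r"
proof -
  let ?S = "{i. 1 \<le> i \<and> c \<le> a i}"
  have "finite {i. a i \<noteq> 0}" using assms(1) by (simp add: is_partition_def composition_def)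
  then have "finite ?S" by (rule finite_subset[rotated]) (use assms(3) in auto)
  moreover have "j \<in> ?S" if "i \<in> ?S" "1 \<le> j" "j \<le> i" for i j
    using partition_antimono[OF assms(1) that(2,3)] that by simp
  ultimately have "?S = {1..card ?S}" by (intro downset_eq_atLeastAtMost) auto
  then have "r \<in> ?S \<longleftrightarrow> r \<le> card ?S" using assms(2) by (metis atLeastAtMost_iff)
  then show ?thesis using assms(2,3) by (simp add: conjugate_def)
qed

lemma diagram_conjugate:
  assumes "is_partition n a"
  shows "(c, r) \<in> diagram (conjugate a) \<longleftrightarrow> (r, c) \<in> diagram a"
  using conjugate_le_iff[OF assms, of r c] by (auto simp: diagram_def)

lemma composition_conjugate:
  assumes "is_partition n a"
  shows "composition n (conjugate a)"
  unfolding composition_iff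
proof (intro conjI)
  have a: "composition n a" using assms by (simp add: is_partition_def)
  have "diagram (conjugate a) = prod.swap ` diagram a"
  proof (intro equalityI subsetI)
    fix p assume "p \<in> diagram (conjugate a)"
    then show "p \<in> prod.swap ` diagram a"
      using diagram_conjugate[OF assms] by (cases p) (auto intro: rev_image_eqI)
  qed (use diagram_conjugate[OF assms] in auto)
  then show "card (diagram (conjugate a)) = n"
    using a by (simp add: composition_iff card_image)
  have "{j. conjugate a j \<noteq> 0} \<subseteq> {..a 1}"
  proof
    fix j assume j: "j \<in> {j. conjugate a j \<noteq> 0}"
    then have "1 \<le> j" by (simp add: conjugate_def split: if_splits)
    then show "j \<in> {..a 1}" using conjugate_le_iff[OF assms, of 1 j] j by simp
  qed
  then show "finite {i. conjugate a i \<noteq> 0}" by (rule finite_subset) simp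
qed (simp add: conjugate_def)

lemma col_tableau_conjugate: "col_tableau a r c = row_tableau (conjugate a) c r"
  by (simp add: col_tableau_def row_tableau_def)

lemma is_partition_drop_part:
  assumes "is_partition n a"
  shows "is_partition (n - a 1) (drop_part a)"
  using assms composition_drop_part(1) by (simp add: is_partition_def drop_part_def)

text \<open>The tableau t_a is the transpose of t^(a'), so both tableaux number the boxes of one
  diagram bijectively by {1..n}; composing one numbering with the inverse of the other gives the
  permutation.\<close>

lemma w_perm_properties:
  assumes "is_partition n a"
  shows "w_perm n a permutes {1..n}"
    and "\<And>r c. (r, c) \<in> diagram a \<Longrightarrow>
      w_perm n a (row_tableau a r c) = row_tableau (conjugate a) c r"
proof -
  have a: "composition n a" using assms by (simp add: is_partition_def)
  note a' = composition_conjugate[OF assms]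
  let ?P = "\<lambda>w. w permutes {1..n} \<and> (\<forall>(r, c) \<in> diagram a. w (row_tableau a r c) = col_tableau a r c)"
  let ?t = "\<lambda>(r, c). row_tableau a r c" and ?u = "\<lambda>(r, c). row_tableau (conjugate a) c r"
  have bt: "bij_betw ?t (diagram a) {1..n}" by (rule bij_betw_row_tableau[OF a])
  have "bij_betw prod.swap (diagram a) (diagram (conjugate a))"
    unfolding bij_betw_def
  proof
    show "prod.swap ` diagram a = diagram (conjugate a)"
    proof (intro equalityI subsetI)
      fix p assume "p \<in> diagram (conjugate a)"
      then show "p \<in> prod.swap ` diagram a"
        using diagram_conjugate[OF assms] by (cases p) (auto intro: rev_image_eqI)
    qed (use diagram_conjugate[OF assms] in auto)
  qed simp
  from bij_betw_trans[OF this bij_betw_row_tableau[OF a']]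
  have "bij_betw ((\<lambda>(r, c). row_tableau (conjugate a) r c) \<circ> prod.swap) (diagram a) {1..n}" .
  moreover have "(\<lambda>(r, c). row_tableau (conjugate a) r c) \<circ> prod.swap = ?u" by auto
  ultimately have bu: "bij_betw ?u (diagram a) {1..n}" by simp
  let ?w = "\<lambda>x. if x \<in> {1..n} then ?u (inv_into (diagram a) ?t x) else x"
  have "bij_betw (?u \<circ> inv_into (diagram a) ?t) {1..n} {1..n}"
    by (rule bij_betw_trans[OF bij_betw_inv_into[OF bt] bu])
  then have "bij_betw ?w {1..n} {1..n}" by (rule bij_betw_cong[THEN iffD1, rotated]) simp
  then have wp: "?w permutes {1..n}" by (rule bij_imp_permutes) auto
  have wv: "?w (row_tableau a r c) = col_tableau a r c" if "(r, c) \<in> diagram a" for r c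
  proof -
    have "inv_into (diagram a) ?t (?t (r, c)) = (r, c)"
      by (rule inv_into_f_f[OF bij_betw_imp_inj_on[OF bt] that])
    then show ?thesis
      using row_tableau_in_range[OF a that] by (simp add: col_tableau_conjugate)
  qed
  have "\<exists>!w. ?P w"
  proof (rule ex1I[of _ ?w])
    show "?P ?w" using wp wv by blast
    fix w assume w: "?P w"
    show "w = ?w"
    proof (rule permutes_eqI[OF _ wp])
      show "w permutes {1..n}" using w by blast
      fix x assume "x \<in> {1..n}"
      then obtain r c where rc: "(r, c) \<in> diagram a" "x = row_tableau a r c"
        using row_tableau_cases[OF a] by blast
      then show "w x = ?w x" using w wv[OF rc(1)] by auto
    qed
  qed
  from theI'[OF this] have *: "?P (w_perm n a)" unfolding w_perm_def .
  then show "w_perm n a permutes {1..n}" by blast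
  show "w_perm n a (row_tableau a r c) = row_tableau (conjugate a) c r" if "(r, c) \<in> diagram a" for r c
    using * that by (auto simp: col_tableau_conjugate)
qed

text \<open>Adding m to the values of f keeps them above the values 1, ..., m of the fixed points,
  which remain singleton blocks. This is why f must be positive.\<close>

lemma block_group_shift:
  assumes "m \<le> n" and pos: "\<And>y. y \<in> {1..n - m} \<Longrightarrow> 1 \<le> f y"
  shows "block_group n (\<lambda>x. if x \<le> m then x else m + f (x - m)) = shift_perm m ` block_group (n - m) f"
proof (intro equalityI subsetI)
  let ?f = "\<lambda>x. if x \<le> m then x else m + f (x - m)"
  fix u assume "u \<in> block_group n ?f"
  then have up: "u permutes {1..n}" and fu: "\<And>x. x \<in> {1..n} \<Longrightarrow> ?f (u x) = ?f x"
    unfolding block_group_def by blast+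
  have "min (u x) (m + 1) = min x (m + 1)" if x: "x \<in> {1..n}" for x
  proof -
    have ux: "u x \<in> {1..n}" using permutes_in_image[OF up, of x] x by simp
    have *: "m < ?f z" if "z \<in> {1..n}" "\<not> z \<le> m" for z
    proof -
      have "z - m \<in> {1..n - m}" using that by auto
      then show ?thesis using pos[of "z - m"] that by simp
    qed
    show ?thesis using fu[OF x] *[OF x] *[OF ux] by (auto split: if_splits)
  qed
  then have "u \<in> block_group n (\<lambda>x. min x (m + 1))" using up unfolding block_group_def by blast
  then obtain v where v: "v permutes {1..n - m}" "u = shift_perm m v"
    unfolding block_group_min[OF assms(1)] by blast
  have "f (v y) = f y" if y: "y \<in> {1..n - m}" for y
  proof -
    have "y + m \<in> {1..n}" using y assms(1) by auto
    moreover have "0 < v y" using y by (intro permutes_pos[OF v(1)]) simp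
    ultimately show ?thesis using fu[of "y + m"] y by (simp add: v(2) shift_perm_def)
  qed
  then show "u \<in> shift_perm m ` block_group (n - m) f" using v unfolding block_group_def by blast
next
  let ?f = "\<lambda>x. if x \<le> m then x else m + f (x - m)"
  fix u assume "u \<in> shift_perm m ` block_group (n - m) f"
  then obtain v where v: "v permutes {1..n - m}" "\<And>y. y \<in> {1..n - m} \<Longrightarrow> f (v y) = f y"
    "u = shift_perm m v"
    unfolding block_group_def by blast
  have "?f (u x) = ?f x" if x: "x \<in> {1..n}" for x
  proof (cases "x \<le> m")
    case False
    then have "x - m \<in> {1..n - m}" using x by auto
    moreover have "0 < v (x - m)" using False by (intro permutes_pos[OF v(1)]) simp
    ultimately show ?thesis using False v(2)[of "x - m"] by (simp add: v(3) shift_perm_def)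
  qed (simp add: v(3) shift_perm_def)
  then show "u \<in> block_group n ?f"
    using shift_perm_permutes[OF v(1), of m n] assms(1) unfolding block_group_def v(3) by simp
qed

section \<open>Factorisation of the generator of the Specht module\<close>

context
  fixes n :: nat and a :: "nat \<Rightarrow> nat"
  assumes part: "is_partition n a"
begin

private abbreviation (input) "m\<^sub>1 \<equiv> a 1"
private abbreviation (input) "k\<^sub>1 \<equiv> n - a 1"
private abbreviation (input) "a\<^sub>1 \<equiv> drop_part a"
private abbreviation (input) "w \<equiv> w_perm n a"
private abbreviation (input) "w\<^sub>1 \<equiv> w_perm k\<^sub>1 a\<^sub>1"

text \<open>What is left of w after the shifted w_mu~ has been split off at the front. On boxes, z
  goes from the numbering by the first row followed by the columns of the rest to the numbering by
  full columns.\<close>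

private definition "z = w \<circ> inv_into UNIV (shift_perm m\<^sub>1 w\<^sub>1)"

private lemma a: "composition n a"
  using part by (simp add: is_partition_def)

private lemma part': "is_partition k\<^sub>1 a\<^sub>1"
  by (rule is_partition_drop_part[OF part])

private lemma first_part_le: "m\<^sub>1 \<le> n"
  by (rule composition_drop_part[OF a])

private lemma shift_w': "shift_perm m\<^sub>1 w\<^sub>1 permutes {1..n}"
  using w_perm_properties(1)[OF part'] first_part_le by (intro shift_perm_permutes) auto

private lemma z_permutes: "z permutes {1..n}"
  unfolding z_def
  by (rule permutes_compose[OF permutes_inv[OF shift_w'] w_perm_properties(1)[OF part]])

private lemma z_shift: "z (shift_perm m\<^sub>1 w\<^sub>1 x) = w x"
  unfolding z_def using permutes_inverses(2)[OF shift_w'] by simp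

private lemma w_factor: "w = shift_perm m\<^sub>1 w\<^sub>1 \<cdot>\<^sub>p z"
  by (rule ext) (simp only: perm_prod_apply z_shift)

private lemma z_first:
  assumes "1 \<le> x" "x \<le> m\<^sub>1"
  shows "(1, x) \<in> diagram a" "z x = row_tableau (conjugate a) x 1"
proof -
  show d: "(1, x) \<in> diagram a" using assms by (simp add: diagram_def)
  have "z x = w x" using z_shift[of x] assms by (simp add: shift_perm_def)
  moreover have "row_tableau a 1 x = x" by (simp add: row_tableau_def)
  ultimately show "z x = row_tableau (conjugate a) x 1"
    using w_perm_properties(2)[OF part d] by simp
qed

private lemma z_later:
  assumes "(r, c) \<in> diagram a\<^sub>1"
  shows "(r + 1, c) \<in> diagram a"
    "z (row_tableau (conjugate a\<^sub>1) c r + m\<^sub>1) = row_tableau (conjugate a) c (r + 1)"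
proof -
  show d: "(r + 1, c) \<in> diagram a" using assms by (simp add: diagram_drop_part)
  have r: "1 \<le> r" using assms by (simp add: diagram_drop_part)
  have "0 < row_tableau a\<^sub>1 r c" using assms by (simp add: row_tableau_def diagram_def)
  then have "shift_perm m\<^sub>1 w\<^sub>1 (row_tableau a\<^sub>1 r c + m\<^sub>1) = row_tableau (conjugate a\<^sub>1) c r + m\<^sub>1"
    using w_perm_properties(2)[OF part' assms] by (simp add: shift_perm_def)
  then have "z (row_tableau (conjugate a\<^sub>1) c r + m\<^sub>1) = w (row_tableau a\<^sub>1 r c + m\<^sub>1)"
    using z_shift by metis
  also have "\<dots> = row_tableau (conjugate a) c (r + 1)"
    using w_perm_properties(2)[OF part d] unfolding row_tableau_drop_part[OF r] .
  finally show "z (row_tableau (conjugate a\<^sub>1) c r + m\<^sub>1) = row_tableau (conjugate a) c (r + 1)" .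
qed

private lemma later_cases:
  assumes "x \<in> {1..n}" "\<not> x \<le> m\<^sub>1"
  obtains r c where "(r, c) \<in> diagram a\<^sub>1" "x = row_tableau (conjugate a\<^sub>1) c r + m\<^sub>1"
proof -
  have "x - m\<^sub>1 \<in> {1..k\<^sub>1}" using assms by auto
  then obtain c r where "(c, r) \<in> diagram (conjugate a\<^sub>1)" "x - m\<^sub>1 = row_tableau (conjugate a\<^sub>1) c r"
    using row_tableau_cases[OF composition_conjugate[OF part']] by blast
  then have "(r, c) \<in> diagram a\<^sub>1" "x = row_tableau (conjugate a\<^sub>1) c r + m\<^sub>1"
    using diagram_conjugate[OF part'] assms(2) by auto
  then show ?thesis by (rule that)
qed

text \<open>Deleting the first row does not change the order in which reading down the columns meets
  the other boxes, so z increases beyond m. This makes lengths add in w = sh(w_mu~) z.\<close>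

private lemma z_left_minimal: "left_minimal n (\<lambda>x. min x (m\<^sub>1 + 1)) z"
  unfolding left_minimal_def
proof (intro ballI impI)
  fix x y assume x: "x \<in> {1..n}" and y: "y \<in> {1..n}" and xy: "x < y \<and> min x (m\<^sub>1 + 1) = min y (m\<^sub>1 + 1)"
  then have "\<not> x \<le> m\<^sub>1" "\<not> y \<le> m\<^sub>1" by auto
  then obtain r c r' c' where rc: "(r, c) \<in> diagram a\<^sub>1" "x = row_tableau (conjugate a\<^sub>1) c r + m\<^sub>1"
    "(r', c') \<in> diagram a\<^sub>1" "y = row_tableau (conjugate a\<^sub>1) c' r' + m\<^sub>1"
    using later_cases x y by metis
  have "(c, r) \<in> diagram (conjugate a\<^sub>1)" "(c', r') \<in> diagram (conjugate a\<^sub>1)"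
    "(c, r + 1) \<in> diagram (conjugate a)" "(c', r' + 1) \<in> diagram (conjugate a)"
    using rc z_later(1) diagram_conjugate[OF part'] diagram_conjugate[OF part] by blast+
  then show "z x < z y"
    using xy rc z_later(2) row_tableau_less_iff[of c r "conjugate a\<^sub>1" c' r']
      row_tableau_less_iff[of c "r + 1" "conjugate a" c' "r' + 1"] by simp
qed

text \<open>Within one column the box of the first row comes from a point up to m, hence before the
  others, whose order z preserves. Two boxes of the first row never share a column.\<close>

private lemma z_right_minimal: "right_minimal n (row_of (conjugate a)) z"
  unfolding right_minimal_def
proof (intro ballI impI)
  fix x y assume x: "x \<in> {1..n}" and y: "y \<in> {1..n}"
    and xy: "x < y \<and> row_of (conjugate a) (z x) = row_of (conjugate a) (z y)"
  show "z x < z y"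
  proof (cases "x \<le> m\<^sub>1")
    case False
    then show ?thesis
      using z_left_minimal[unfolded left_minimal_def, rule_format, OF x y] xy by simp
  next
    case True
    then have zx: "(x, 1) \<in> diagram (conjugate a)" "z x = row_tableau (conjugate a) x 1"
      using z_first[of x] x diagram_conjugate[OF part] by auto
    show ?thesis
    proof (cases "y \<le> m\<^sub>1")
      case True
      then have "(y, 1) \<in> diagram (conjugate a)" "z y = row_tableau (conjugate a) y 1"
        using z_first[of y] y diagram_conjugate[OF part] by auto
      then show ?thesis using xy zx by auto
    next
      case False
      then obtain r c where rc: "(r, c) \<in> diagram a\<^sub>1" "y = row_tableau (conjugate a\<^sub>1) c r + m\<^sub>1"
        using later_cases[OF y] by blast
      have d: "(c, r + 1) \<in> diagram (conjugate a)" "z y = row_tableau (conjugate a) c (r + 1)"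
        using z_later[OF rc(1)] diagram_conjugate[OF part] rc(2) by auto
      moreover have "1 \<le> r" using rc(1) by (simp add: diagram_def)
      moreover have "c = x" using xy zx d by simp
      ultimately show ?thesis using zx by (simp add: row_tableau_def)
    qed
  qed
qed

text \<open>A box keeps its column when the first row is deleted. Hence the shifted column group of
  the smaller shape, acting before z, does not change the column reached.\<close>

private lemma z_column:
  assumes "y \<in> {1..k\<^sub>1}"
  shows "row_of (conjugate a) (z (y + m\<^sub>1)) = row_of (conjugate a\<^sub>1) y"
proof -
  obtain c r where cr: "(c, r) \<in> diagram (conjugate a\<^sub>1)" "y = row_tableau (conjugate a\<^sub>1) c r"
    using row_tableau_cases[OF composition_conjugate[OF part'] assms] by blast
  then have "(r, c) \<in> diagram a\<^sub>1" using diagram_conjugate[OF part'] by blast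
  from z_later[OF this] show ?thesis
    using cr diagram_conjugate[OF part, of c "r + 1"] by simp
qed

text \<open>The coset of z under the column group is summed in two ways: as T_z times y on the one
  hand, and, being stable under the shifted smaller column group on the left, as the shifted smaller
  y times a sum over minimal representatives on the other.\<close>

lemma specht_generator_factor:
  assumes "q \<noteq> 0"
  shows "\<exists>K \<in> carrier (hecke n q).
    hecke_T n q (w_perm n a) \<otimes>\<^bsub>hecke n q\<^esub> y_elem n q (conjugate a)
    = hecke_shift n (a 1) q (hecke_T (n - a 1) q (w_perm (n - a 1) (drop_part a))
        \<otimes>\<^bsub>hecke (n - a 1) q\<^esub> y_elem (n - a 1) q (conjugate (drop_part a)))
      \<otimes>\<^bsub>hecke n q\<^esub> K"
proof -
  let ?R = "hecke n q" and ?q = "inverse (- q)"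
  let ?c = "row_of (conjugate a)" and ?c' = "row_of (conjugate a\<^sub>1)"
  let ?f = "\<lambda>x. if x \<le> m\<^sub>1 then x else m\<^sub>1 + ?c' (x - m\<^sub>1)"
  let ?Z = "{v. v permutes {1..n} \<and> (\<forall>x \<in> {1..n}. ?c (v x) = ?c (z x))}"
  note conj = composition_conjugate[OF part] and conj' = composition_conjugate[OF part']
  have pos: "1 \<le> ?c' y" if "y \<in> {1..k\<^sub>1}" for y by (rule row_of_pos[OF conj' that])
  have km: "k\<^sub>1 + m\<^sub>1 \<le> n" using first_part_le by simp
  note bs = block_group_shift[where f = ?c', OF first_part_le pos]
  define Y where "Y = hecke_sum n q ?q (block_group n ?c)"
  define Y' where "Y' = hecke_sum k\<^sub>1 q ?q (block_group k\<^sub>1 ?c')"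
  have Y: "y_elem n q (conjugate a) = Y" "Y \<in> carrier ?R"
    unfolding Y_def y_elem_hecke_sum[OF conj] by (rule refl hecke_sum_closed[OF block_group_perms])+
  have Y': "y_elem k\<^sub>1 q (conjugate a\<^sub>1) = Y'" "Y' \<in> carrier (hecke k\<^sub>1 q)"
    unfolding Y'_def y_elem_hecke_sum[OF conj'] by (rule refl hecke_sum_closed[OF block_group_perms])+
  have T: "hecke_T n q w = hecke_T n q (shift_perm m\<^sub>1 w\<^sub>1) \<otimes>\<^bsub>?R\<^esub> hecke_T n q z"
  proof -
    have "shift_perm m\<^sub>1 w\<^sub>1 \<in> block_group n (\<lambda>x. min x (m\<^sub>1 + 1))"
      unfolding block_group_min[OF first_part_le] using w_perm_properties(1)[OF part'] by blast
    then have "reduced_pair n (shift_perm m\<^sub>1 w\<^sub>1) z"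
      by (intro reduced_pair_left_minimal[where f = "\<lambda>x. min x (m\<^sub>1 + 1)"] z_permutes z_left_minimal)
        auto
    from hecke_T_prod[OF shift_w' z_permutes this, of q] show ?thesis
      by (simp only: w_factor[symmetric])
  qed
  \<comment> \<open>The set \<open>?Z\<close> is the coset of z, described by the column of each
    image; in this form stability on either side is a pointwise check.\<close>
  have "bij_betw (\<lambda>(u, v). u \<cdot>\<^sub>p v) ({z} \<times> block_group n ?c) ?Z"
  proof (rule bij_betw_imageI)
    show "inj_on (\<lambda>(u, v). u \<cdot>\<^sub>p v) ({z} \<times> block_group n ?c)"
    proof (rule inj_onI)
      fix s t assume "s \<in> {z} \<times> block_group n ?c" "t \<in> {z} \<times> block_group n ?c"
        and st: "(case s of (u, v) \<Rightarrow> u \<cdot>\<^sub>p v) = (case t of (u, v) \<Rightarrow> u \<cdot>\<^sub>p v)"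
      then obtain u v where uv: "s = (z, u)" "t = (z, v)" by blast
      then have eq: "z \<cdot>\<^sub>p u = z \<cdot>\<^sub>p v" using st by simp
      have "u = v"
      proof
        fix y
        obtain x where "y = z x" using permutes_surj[OF z_permutes] by (rule surjE)
        then show "u y = v y" using fun_cong[OF eq, of x] by (simp add: perm_prod_apply)
      qed
      then show "s = t" using uv by simp
    qed
    show "(\<lambda>(u, v). u \<cdot>\<^sub>p v) ` ({z} \<times> block_group n ?c) = ?Z"
    proof (intro equalityI subsetI)
      fix s assume "s \<in> (\<lambda>(u, v). u \<cdot>\<^sub>p v) ` ({z} \<times> block_group n ?c)"
      then obtain v where v: "v permutes {1..n}" "\<And>x. x \<in> {1..n} \<Longrightarrow> ?c (v x) = ?c x" "s = z \<cdot>\<^sub>p v"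
        unfolding block_group_def by auto
      have "?c (s x) = ?c (z x)" if "x \<in> {1..n}" for x
        using v(2)[of "z x"] permutes_in_image[OF z_permutes, of x] that
        by (simp add: v(3) perm_prod_apply)
      then show "s \<in> ?Z" using perm_prod_permutes[OF z_permutes v(1)] v(3) by blast
    next
      fix s assume s: "s \<in> ?Z"
      define v where "v = s \<circ> inv_into UNIV z"
      have vz: "v (z x) = s x" for x unfolding v_def using permutes_inverses(2)[OF z_permutes] by simp
      have vp: "v permutes {1..n}"
        unfolding v_def by (rule permutes_compose[OF permutes_inv[OF z_permutes]]) (use s in blast)
      have "?c (v y) = ?c y" if "y \<in> {1..n}" for y
      proof -
        have "y \<in> z ` {1..n}" using that permutes_image[OF z_permutes] by simp
        then obtain x where "x \<in> {1..n}" "y = z x" by blast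
        then show ?thesis using s vz[of x] by simp
      qed
      then have "v \<in> block_group n ?c" using vp unfolding block_group_def by blast
      moreover have "s = z \<cdot>\<^sub>p v" by (simp add: fun_eq_iff perm_prod_apply vz)
      ultimately show "s \<in> (\<lambda>(u, v). u \<cdot>\<^sub>p v) ` ({z} \<times> block_group n ?c)" by auto
    qed
  qed
  then have Z1: "hecke_sum n q ?q ?Z = hecke_sum n q ?q {z} \<otimes>\<^bsub>?R\<^esub> Y"
    unfolding Y_def
  proof (rule hecke_sum_factor[rotated -1])
    show "reduced_pair n u v" if "u \<in> {z}" "v \<in> block_group n ?c" for u v
      using that reduced_pair_right_minimal[where f = ?c, OF row_of_mono[OF conj] z_permutes z_right_minimal]
      by simp
  qed (use z_permutes block_group_perms in auto)
  have Z2: "hecke_sum n q ?q ?Z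
      = hecke_sum n q ?q (block_group n ?f) \<otimes>\<^bsub>?R\<^esub> hecke_sum n q ?q {d \<in> ?Z. left_minimal n ?f d}"
  proof (rule hecke_sum_left_cosets)
    fix x y assume xy: "x \<in> {1..n}" "y \<in> {1..n}" "x \<le> y"
    show "?f x \<le> ?f y"
    proof (cases "x \<le> m\<^sub>1")
      case False
      then have "x - m\<^sub>1 \<in> {1..k\<^sub>1}" "y - m\<^sub>1 \<in> {1..k\<^sub>1}" "x - m\<^sub>1 \<le> y - m\<^sub>1" using xy by auto
      from row_of_mono[OF conj' this] show ?thesis using False xy by simp
    qed (use xy in simp)
  next
    fix d u assume d: "d \<in> ?Z" and "u \<in> block_group n ?f"
    then have "u \<in> shift_perm m\<^sub>1 ` block_group k\<^sub>1 ?c'" by (simp only: bs)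
    then obtain v where v: "v permutes {1..k\<^sub>1}" "\<And>y. y \<in> {1..k\<^sub>1} \<Longrightarrow> ?c' (v y) = ?c' y"
      "u = shift_perm m\<^sub>1 v"
      unfolding block_group_def by blast
    have up: "u permutes {1..n}" unfolding v(3) by (rule shift_perm_permutes[OF v(1) km])
    have "?c ((u \<cdot>\<^sub>p d) x) = ?c (z x)" if x: "x \<in> {1..n}" for x
    proof -
      have "u x \<in> {1..n}" using permutes_in_image[OF up, of x] x by simp
      then have "?c (d (u x)) = ?c (z (u x))" using d by blast
      also have "?c (z (u x)) = ?c (z x)"
      proof (cases "x \<le> m\<^sub>1")
        case False
        then have y: "x - m\<^sub>1 \<in> {1..k\<^sub>1}" using x by auto
        then have vy: "v (x - m\<^sub>1) \<in> {1..k\<^sub>1}" using permutes_in_image[OF v(1)] by blast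
        have "?c (z (x - m\<^sub>1 + m\<^sub>1)) = ?c (z (v (x - m\<^sub>1) + m\<^sub>1))"
          unfolding z_column[OF y] z_column[OF vy] by (rule v(2)[OF y, symmetric])
        then show ?thesis using False by (simp add: v(3) shift_perm_def)
      qed (simp add: v(3) shift_perm_def)
      finally show ?thesis by (simp add: perm_prod_apply)
    qed
    then show "u \<cdot>\<^sub>p d \<in> ?Z" using perm_prod_permutes[OF up, of d] d by blast
  qed blast
  define K where "K = hecke_sum n q ?q {d \<in> ?Z. left_minimal n ?f d}"
  have K: "K \<in> carrier ?R" unfolding K_def by (rule hecke_sum_closed) blast
  have sY: "hecke_sum n q ?q (block_group n ?f) = hecke_shift n m\<^sub>1 q Y'"
    by (simp only: bs Y'_def hecke_shift_sum[OF block_group_perms km])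
  have sY_closed: "hecke_shift n m\<^sub>1 q Y' \<in> carrier ?R"
    by (rule ring_hom_closed[OF hecke_shift_hom[OF km] Y'(2)])
  let ?e = "?q ^ card (inversions n z)"
  have Tz: "hecke_T n q z \<in> carrier ?R" by (rule hecke_T_closed[OF z_permutes])
  have "hecke_smult n q ?e (hecke_T n q z \<otimes>\<^bsub>?R\<^esub> Y) = hecke_shift n m\<^sub>1 q Y' \<otimes>\<^bsub>?R\<^esub> K"
    using Z1 Z2 unfolding K_def[symmetric] sY hecke_sum_singleton[OF z_permutes]
      hecke_smult_mult(1)[OF Tz Y(2)] by simp
  then have "hecke_smult n q (inverse ?e) (hecke_smult n q ?e (hecke_T n q z \<otimes>\<^bsub>?R\<^esub> Y))
      = hecke_smult n q (inverse ?e) (hecke_shift n m\<^sub>1 q Y' \<otimes>\<^bsub>?R\<^esub> K)" by simp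
  \<comment> \<open>The weighted sum over {z} is T_z times (-1/q)^l(z). This scalar is cancelled,
    which is where q must be non-zero; its inverse is absorbed into the right factor.\<close>
  moreover have "inverse ?e * ?e = 1" using assms by simp
  ultimately have zY: "hecke_T n q z \<otimes>\<^bsub>?R\<^esub> Y
      = hecke_shift n m\<^sub>1 q Y' \<otimes>\<^bsub>?R\<^esub> hecke_smult n q (inverse ?e) K"
    using hecke_smult_mult(3)[of "hecke_T n q z \<otimes>\<^bsub>?R\<^esub> Y" n q Y "inverse ?e" ?e]
      hecke_smult_mult(2)[OF sY_closed K] Tz Y(2)
    by (simp only: hecke_smult_one hecke.m_closed)
  have Tw': "hecke_T k\<^sub>1 q w\<^sub>1 \<in> carrier (hecke k\<^sub>1 q)"
    by (rule hecke_T_closed[OF w_perm_properties(1)[OF part']])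
  have sT: "hecke_shift n m\<^sub>1 q (hecke_T k\<^sub>1 q w\<^sub>1) = hecke_T n q (shift_perm m\<^sub>1 w\<^sub>1)"
    by (rule hecke_shift_T[OF w_perm_properties(1)[OF part'] km])
  have "hecke_T n q w \<otimes>\<^bsub>?R\<^esub> Y
      = hecke_T n q (shift_perm m\<^sub>1 w\<^sub>1) \<otimes>\<^bsub>?R\<^esub> (hecke_T n q z \<otimes>\<^bsub>?R\<^esub> Y)"
    unfolding T using hecke_T_closed[OF shift_w'] Tz Y(2) by (rule hecke.m_assoc)
  also have "\<dots> = hecke_shift n m\<^sub>1 q (hecke_T k\<^sub>1 q w\<^sub>1) \<otimes>\<^bsub>?R\<^esub> hecke_shift n m\<^sub>1 q Y'
      \<otimes>\<^bsub>?R\<^esub> hecke_smult n q (inverse ?e) K"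
    unfolding zY sT using hecke_T_closed[OF shift_w'] sY_closed hecke_smult_closed[OF K]
    by (rule hecke.m_assoc[symmetric])
  also have "hecke_shift n m\<^sub>1 q (hecke_T k\<^sub>1 q w\<^sub>1) \<otimes>\<^bsub>?R\<^esub> hecke_shift n m\<^sub>1 q Y'
      = hecke_shift n m\<^sub>1 q (hecke_T k\<^sub>1 q w\<^sub>1 \<otimes>\<^bsub>hecke k\<^sub>1 q\<^esub> Y')"
    by (rule ring_hom_mult[OF hecke_shift_hom[OF km] Tw' Y'(2), symmetric])
  finally show ?thesis
    unfolding Y(1) Y'(1) using hecke_smult_closed[OF K] by blast
qed

end

theorem proposition4p1:
  fixes q :: "'f::field"
    and n r :: nat
    and mu lam :: "nat \<Rightarrow> nat"
    and A :: "nat \<Rightarrow> tableau"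
    and c :: "nat \<Rightarrow> 'f"
  assumes "q \<noteq> 0"
    and "is_partition n mu"
    and "composition n lam"
    and "\<And>i. i \<in> {1..r} \<Longrightarrow> tableau_of_type mu lam (A i)"
    and "\<And>i. i \<in> {1..r} \<Longrightarrow> row_standard mu (A i)"
    and "\<And>i j k. i \<in> {1..r} \<Longrightarrow> j \<in> {1..r} \<Longrightarrow> k \<in> {1..mu 1} \<Longrightarrow> A i 1 k = A j 1 k"
    and "\<forall>m \<in> specht_module (n - mu 1) q (drop_part mu).
           (\<Oplus>\<^bsub>hecke (n - mu 1) q\<^esub>i \<in> {1..r}.
              hecke_smult (n - mu 1) q (c i)
                (phi_hat (n - mu 1) q (drop_part mu)
                   (tableau_type (drop_part mu) (drop_row (A i))) (drop_row (A i)) m))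
           = \<zero>\<^bsub>hecke (n - mu 1) q\<^esub>"
  shows "\<forall>m \<in> specht_module n q mu.
           (\<Oplus>\<^bsub>hecke n q\<^esub>i \<in> {1..r}. hecke_smult n q (c i) (phi_hat n q mu lam (A i) m))
           = \<zero>\<^bsub>hecke n q\<^esub>"
proof
  fix s assume s: "s \<in> specht_module n q mu"
  define k where "k = n - mu 1"
  define mu' where "mu' = drop_part mu"
  define B where "B i = drop_row (A i)" for i
  define lam' where "lam' i = tableau_type mu' (B i)" for i
  let ?R = "hecke n q" and ?S = "hecke k q" and ?sh = "hecke_shift n (mu 1) q"
  note type = assms(4)
  have mu: "composition n mu" using assms(2) by (simp add: is_partition_def)
  have part': "is_partition k mu'" unfolding k_def mu'_def by (rule is_partition_drop_part[OF assms(2)])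
  have mu': "composition k mu'" using part' by (simp add: is_partition_def)
  have km: "k + mu 1 \<le> n" unfolding k_def using composition_drop_part(2)[OF mu] by simp
  have lam': "composition k (lam' i)" and type': "tableau_of_type mu' (lam' i) (B i)" if "i \<in> {1..r}" for i
    unfolding k_def lam'_def mu'_def B_def
    by (rule composition_drop_row_type[OF mu type[OF that]] tableau_of_type_drop_row[OF type[OF that]])+
  define G where "G = hecke_sum n q 1
    (first_row_reps n (mu 1) lam (\<lambda>i. card {k \<in> {1..mu 1}. A 1 1 k = i}))"
  define D where "D i = hecke_sum n q 1 (double_coset n lam (one_perm n mu lam (A i)) mu)" for i
  define D' where "D' i = hecke_sum k q 1 (double_coset k (lam' i) (one_perm k mu' (lam' i) (B i)) mu')" for i
  define Ty where "Ty = hecke_T n q (w_perm n mu) \<otimes>\<^bsub>?R\<^esub> y_elem n q (conjugate mu)"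
  define Ty' where "Ty' = hecke_T k q (w_perm k mu') \<otimes>\<^bsub>?S\<^esub> y_elem k q (conjugate mu')"
  have G: "G \<in> carrier ?R"
    unfolding G_def by (rule hecke_sum_closed) (auto simp: first_row_reps_def)
  have D': "D' i \<in> carrier ?S" if "i \<in> {1..r}" for i
    unfolding D'_def
    by (rule hecke_sum_closed[OF double_coset_perms[OF one_perm_properties(1)[OF mu' lam'[OF that] type'[OF that]]]])
  have T: "hecke_T n q (w_perm n mu) \<in> carrier ?R" "hecke_T k q (w_perm k mu') \<in> carrier ?S"
    by (rule hecke_T_closed w_perm_properties(1) assms(2) part')+
  have y: "y_elem n q (conjugate mu) \<in> carrier ?R" "y_elem k q (conjugate mu') \<in> carrier ?S"
    unfolding y_elem_hecke_sum[OF composition_conjugate[OF assms(2)]]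
      y_elem_hecke_sum[OF composition_conjugate[OF part']]
    by (rule hecke_sum_closed[OF block_group_perms])+
  have x: "x_elem n q mu \<in> carrier ?R" "x_elem k q mu' \<in> carrier ?S"
    unfolding x_elem_hecke_sum[OF mu] x_elem_hecke_sum[OF mu']
    by (rule hecke_sum_closed[OF block_group_perms])+
  have Ty: "Ty \<in> carrier ?R" and Ty': "Ty' \<in> carrier ?S"
    unfolding Ty_def Ty'_def using T y by (simp_all only: hecke.m_closed)
  have DG: "D i = G \<otimes>\<^bsub>?R\<^esub> ?sh (D' i)" if i: "i \<in> {1..r}" for i
  proof -
    \<comment> \<open>The factor \<open>G\<close> is formed from the first tableau; as soon as some
      index i lies in {1..r}, so does 1, and the common first row makes \<open>G\<close> serve every
      i.\<close>
    have "{k \<in> {1..mu 1}. A i 1 k = e} = {k \<in> {1..mu 1}. A 1 1 k = e}" for e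
      using assms(6)[OF i, of 1] i by force
    then show ?thesis
      using hecke_sum_double_coset_drop_row[OF mu assms(3) type[OF i], of q]
      unfolding D_def D'_def G_def k_def lam'_def mu'_def B_def by simp
  qed
  obtain K where K: "K \<in> carrier ?R" "Ty = ?sh Ty' \<otimes>\<^bsub>?R\<^esub> K"
    using specht_generator_factor[OF assms(2,1)] unfolding Ty_def Ty'_def k_def mu'_def by blast
  \<comment> \<open>The hypothesis is evaluated only at the generator, that is, with h = 1; the
    remaining elements will enter through the factor K h on the right.\<close>
  have "x_elem k q mu' \<otimes>\<^bsub>?S\<^esub> Ty' \<in> specht_module k q mu'"
    unfolding specht_module_def cyclic_module_def Ty'_def
    using T(2) x(2) y(2)
    by (intro CollectI exI[of _ "\<one>\<^bsub>?S\<^esub>"]) (simp add: hecke.m_assoc)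
  then have "(\<Oplus>\<^bsub>?S\<^esub>i \<in> {1..r}. hecke_smult k q (c i)
      (phi_hat k q mu' (lam' i) (B i) (x_elem k q mu' \<otimes>\<^bsub>?S\<^esub> Ty'))) = \<zero>\<^bsub>?S\<^esub>"
    and mem': "x_elem k q mu' \<otimes>\<^bsub>?S\<^esub> Ty' \<in> specht_module k q mu'"
    using assms(7) unfolding k_def mu'_def lam'_def B_def by blast+
  moreover have "(\<Oplus>\<^bsub>?S\<^esub>i \<in> {1..r}. hecke_smult k q (c i)
      (phi_hat k q mu' (lam' i) (B i) (x_elem k q mu' \<otimes>\<^bsub>?S\<^esub> Ty')))
    = (\<Oplus>\<^bsub>?S\<^esub>i \<in> {1..r}. hecke_smult k q (c i) (D' i \<otimes>\<^bsub>?S\<^esub> Ty'))"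
  proof (rule hecke.finsum_cong')
    fix i assume i: "i \<in> {1..r}"
    show "hecke_smult k q (c i) (phi_hat k q mu' (lam' i) (B i) (x_elem k q mu' \<otimes>\<^bsub>?S\<^esub> Ty'))
        = hecke_smult k q (c i) (D' i \<otimes>\<^bsub>?S\<^esub> Ty')"
      using mem' phi_apply[OF mu' lam'[OF i] type'[OF i] Ty']
      by (simp add: phi_hat_def D'_def)
  qed (use D' Ty' in \<open>auto intro!: hecke_smult_closed hecke.m_closed\<close>)
  ultimately have zero': "(\<Oplus>\<^bsub>?S\<^esub>i \<in> {1..r}. hecke_smult k q (c i) (D' i \<otimes>\<^bsub>?S\<^esub> Ty')) = \<zero>\<^bsub>?S\<^esub>"
    by simp
  interpret sh: ring_hom_ring ?S ?R ?sh
    by (rule ring_hom_ringI2[OF hecke.ring_axioms hecke.ring_axioms hecke_shift_hom[OF km]])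
  have DT: "D' i \<otimes>\<^bsub>?S\<^esub> Ty' \<in> carrier ?S" if "i \<in> {1..r}" for i
    using D'[OF that] Ty' by (rule hecke.m_closed)
  have "?sh (\<Oplus>\<^bsub>?S\<^esub>i \<in> {1..r}. hecke_smult k q (c i) (D' i \<otimes>\<^bsub>?S\<^esub> Ty'))
      = (\<Oplus>\<^bsub>?R\<^esub>i \<in> {1..r}. ?sh (hecke_smult k q (c i) (D' i \<otimes>\<^bsub>?S\<^esub> Ty')))"
    by (rule ring_hom_finsum[OF hecke.ring_axioms hecke.ring_axioms hecke_shift_hom[OF km]])
      (use DT in \<open>auto intro!: hecke_smult_closed\<close>)
  then have zero: "(\<Oplus>\<^bsub>?R\<^esub>i \<in> {1..r}. ?sh (hecke_smult k q (c i) (D' i \<otimes>\<^bsub>?S\<^esub> Ty'))) = \<zero>\<^bsub>?R\<^esub>"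
    unfolding zero' sh.hom_zero by (rule sym)
  obtain h where h: "h \<in> carrier ?R"
    "s = x_elem n q mu \<otimes>\<^bsub>?R\<^esub> hecke_T n q (w_perm n mu) \<otimes>\<^bsub>?R\<^esub> y_elem n q (conjugate mu) \<otimes>\<^bsub>?R\<^esub> h"
    using s unfolding specht_module_def cyclic_module_def by blast
  have s_eq: "s = x_elem n q mu \<otimes>\<^bsub>?R\<^esub> (Ty \<otimes>\<^bsub>?R\<^esub> h)"
    unfolding h(2) Ty_def using T(1) x(1) y(1) h(1) by (simp add: hecke.m_assoc)
  let ?t = "\<lambda>i. ?sh (hecke_smult k q (c i) (D' i \<otimes>\<^bsub>?S\<^esub> Ty'))"
  have t: "?t i \<in> carrier ?R" if "i \<in> {1..r}" for i
    by (intro sh.hom_closed hecke_smult_closed DT that)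
  have Kh: "K \<otimes>\<^bsub>?R\<^esub> h \<in> carrier ?R" using K(1) h(1) by (rule hecke.m_closed)
  \<comment> \<open>The factors \<open>G\<close> on the left and K h on the right are the same for
    all i, so the sum can be moved inside, where it is the shifted relation.\<close>
  have "(\<Oplus>\<^bsub>?R\<^esub>i \<in> {1..r}. hecke_smult n q (c i) (phi_hat n q mu lam (A i) s))
      = (\<Oplus>\<^bsub>?R\<^esub>i \<in> {1..r}. G \<otimes>\<^bsub>?R\<^esub> ?t i \<otimes>\<^bsub>?R\<^esub> (K \<otimes>\<^bsub>?R\<^esub> h))"
  proof (rule hecke.finsum_cong')
    fix i assume i: "i \<in> {1..r}"
    have sD: "?sh (D' i) \<in> carrier ?R" and sT: "?sh Ty' \<in> carrier ?R"
      by (rule sh.hom_closed D'[OF i] Ty')+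
    have "phi_hat n q mu lam (A i) s = D i \<otimes>\<^bsub>?R\<^esub> (Ty \<otimes>\<^bsub>?R\<^esub> h)"
      using s phi_apply[OF mu assms(3) type[OF i], of "Ty \<otimes>\<^bsub>?R\<^esub> h" q] Ty h(1)
      by (simp add: phi_hat_def D_def) (simp add: s_eq)
    also have "\<dots> = G \<otimes>\<^bsub>?R\<^esub> (?sh (D' i) \<otimes>\<^bsub>?R\<^esub> ?sh Ty') \<otimes>\<^bsub>?R\<^esub> (K \<otimes>\<^bsub>?R\<^esub> h)"
      unfolding DG[OF i] K(2) using G sD sT K(1) h(1) by (simp add: hecke.m_assoc)
    also have "?sh (D' i) \<otimes>\<^bsub>?R\<^esub> ?sh Ty' = ?sh (D' i \<otimes>\<^bsub>?S\<^esub> Ty')"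
      by (rule sh.hom_mult[OF D'[OF i] Ty', symmetric])
    finally have phi: "phi_hat n q mu lam (A i) s
      = G \<otimes>\<^bsub>?R\<^esub> ?sh (D' i \<otimes>\<^bsub>?S\<^esub> Ty') \<otimes>\<^bsub>?R\<^esub> (K \<otimes>\<^bsub>?R\<^esub> h)" .
    have sDT: "?sh (D' i \<otimes>\<^bsub>?S\<^esub> Ty') \<in> carrier ?R" by (rule sh.hom_closed[OF DT[OF i]])
    show "hecke_smult n q (c i) (phi_hat n q mu lam (A i) s)
        = G \<otimes>\<^bsub>?R\<^esub> ?t i \<otimes>\<^bsub>?R\<^esub> (K \<otimes>\<^bsub>?R\<^esub> h)"
      unfolding phi hecke_shift_smult[OF km DT[OF i]]
        hecke_smult_mult(2)[OF G sDT] hecke_smult_mult(1)[OF hecke.m_closed[OF G sDT] Kh] ..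
  next
    show "(\<lambda>i. G \<otimes>\<^bsub>?R\<^esub> ?t i \<otimes>\<^bsub>?R\<^esub> (K \<otimes>\<^bsub>?R\<^esub> h)) \<in> {1..r} \<rightarrow> carrier ?R"
      by (intro Pi_I hecke.m_closed G t Kh)
  qed simp
  also have "\<dots> = (\<Oplus>\<^bsub>?R\<^esub>i \<in> {1..r}. G \<otimes>\<^bsub>?R\<^esub> ?t i) \<otimes>\<^bsub>?R\<^esub> (K \<otimes>\<^bsub>?R\<^esub> h)"
    by (rule hecke.finsum_ldistr[symmetric]) (intro Pi_I finite_atLeastAtMost hecke.m_closed G t Kh)+
  also have "(\<Oplus>\<^bsub>?R\<^esub>i \<in> {1..r}. G \<otimes>\<^bsub>?R\<^esub> ?t i) = G \<otimes>\<^bsub>?R\<^esub> (\<Oplus>\<^bsub>?R\<^esub>i \<in> {1..r}. ?t i)"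
    by (rule hecke.finsum_rdistr[symmetric]) (intro Pi_I finite_atLeastAtMost G t)+
  finally show "(\<Oplus>\<^bsub>?R\<^esub>i \<in> {1..r}. hecke_smult n q (c i) (phi_hat n q mu lam (A i) s)) = \<zero>\<^bsub>?R\<^esub>"
    unfolding zero using G Kh by simp
qed

end
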